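(* Let $(X,\mathsf d)$ be a complete separable metric space and let $\mathfrak m$ be a nonnegative Borel measure on $X$, finite on bounded sets, with $\operatorname{supp}\mathfrak m=X$. Assume that $\rho=g\mathfrak m\in\mathscr P_2(X)$ with $g\in L^\infty(X,\mathfrak m)$ and $\mathsf{Ch}(\sqrt g)<\infty$. If $\mathsf{Ch}$ is a quadratic form, then $\mathsf{Ch}_\rho$ is a quadratic form and $$\mathcal E_\rho(\log g,\varphi)=\mathcal E(g,\varphi)\qquad\text{for all Lipschitz }\varphi:X\to\mathbb R\text{ with bounded support.}$$
   Context: $\mathscr P_2(X)$ is the space of Borel probability measures with finite second moment. Let $\mathfrak n$ be a nonnegative Borel measure on $X$, finite on bounded sets. A 2-test plan relative to $\mathfrak n$ is a Borel probability measure $\pi$ on $C([0,1];X)$ concentrated on $AC^2([0,1];X)$, with $\int\int_0^1|\dot\gamma_t|^2dt\,d\pi(\gamma)<\infty$ ($|\dot\gamma_t|$ the metric derivative), and such that for some $C\ge0$, $(e_t)_\sharp\pi\le C\mathfrak n$ for all $t\in[0,1]$, where $e_t(\gamma)=\gamma_t$. A Borel $G:X\to[0,\infty]$ is a 2-weak upper gradient relative to $\mathfrak n$ of a Borel $f:X\to\mathbb R$ if for all 2-test plans $\pi$ relative to $\mathfrak n$ one has $|f(\gamma_1)-f(\gamma_0)|\le\int_0^1G(\gamma_s)|\dot\gamma_s|ds<\infty$ for $\pi$-a.e. $\gamma$. $f\in\mathcal S^2_{\mathfrak n}$ if $f$ has such a $G$ in $L^2(X,\mathfrak n)$; the one of minimal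 $L^2(X,\mathfrak n)$ norm is $|Df|_{w,\mathfrak n}$. These notions are invariant under modification on $\mathfrak n$-negligible sets. Conventions: $\mathcal S^2:=\mathcal S^2_{\mathfrak m}$, $|Df|_w:=|Df|_{w,\mathfrak m}$. Cheeger energies: $\mathsf{Ch}_{\mathfrak n}(f)=\frac12\int_X|Df|_{w,\mathfrak n}^2\,d\mathfrak n$ if $f\in\mathcal S^2_{\mathfrak n}$ and $+\infty$ otherwise; $\mathsf{Ch}:=\mathsf{Ch}_{\mathfrak m}$. (So $\mathsf{Ch}(\sqrt g)<\infty$ means $\sqrt g\in\mathcal S^2$.) "$\mathsf{Ch}_{\mathfrak n}$ is a quadratic form" means $\mathsf{Ch}_{\mathfrak n}(f+h)+\mathsf{Ch}_{\mathfrak n}(f-h)=2\mathsf{Ch}_{\mathfrak n}(f)+2\mathsf{Ch}_{\mathfrak n}(h)$ for all $f,h\in L^1(X,\mathfrak n)$. When $\mathsf{Ch}_{\mathfrak n}$ is quadratic, $\mathcal E_{\mathfrak n}(f,h):=\frac12\big(\mathsf{Ch}_{\mathfrak n}(f+h)-\mathsf{Ch}_{\mathfrak n}(f-h)\big)$ for $f,h\in\mathcal S^2_{\mathfrak n}$, and $\mathcal E:=\mathcal E_{\mathfrak m}$. Under the hypotheses of the theorem $\log g$ (finite $\rho$-a.e.) belongs to $\mathcal S^2_\rho$. *)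

theory Defs
  imports "HOL-Probability.Probability"
begin

definition borel_measure :: "'a::topological_space measure \<Rightarrow> bool" where
  "borel_measure n \<longleftrightarrow> sets n = sets borel"

definition finite_on_bounded :: "'a::metric_space measure \<Rightarrow> bool" where
  "finite_on_bounded n \<longleftrightarrow> (\<forall>B\<in>sets borel. bounded B \<longrightarrow> emeasure n B < \<infinity>)"

definition msupport :: "'a::topological_space measure \<Rightarrow> 'a set" where
  "msupport n = {x. \<forall>U. open U \<and> x \<in> U \<longrightarrow> emeasure n U > 0}"

definition P2 :: "'a::metric_space measure set" where
  "P2 = {\<mu>. borel_measure \<mu> \<and> prob_space \<mu> \<and>
             (\<exists>x0. (\<integral>\<^sup>+x. ennreal ((dist x x0)\<^sup>2) \<partial>\<mu>) < \<infinity>)}"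


subsection \<open>Curves\<close>

text \<open>
  A curve on the unit interval is encoded by its extension to the real line that is constant on
  each side of the interval. The uniform metric of the type of bounded continuous functions
  restricts to the uniform metric on the unit interval, so this set is an isometric copy of
  C([0,1];X).
\<close>

definition curves :: "(real \<Rightarrow>\<^sub>C 'a::metric_space) set" where
  "curves = {\<gamma>. \<forall>t. apply_bcontfun \<gamma> t = apply_bcontfun \<gamma> (max 0 (min 1 t))}"

definition AC2 :: "(real \<Rightarrow> 'a::metric_space) set" where
  "AC2 = {\<gamma>. \<exists>v :: real \<Rightarrow> ennreal. v \<in> borel_measurable borel \<and>
              (\<integral>\<^sup>+t\<in>{0..1}. (v t)\<^sup>2 \<partial>lborel) < \<infinity> \<and>
              (\<forall>s t. 0 \<le> s \<and> s \<le> t \<and> t \<le> 1 \<longrightarrow>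
                 ennreal (dist (\<gamma> s) (\<gamma> t)) \<le> (\<integral>\<^sup>+r\<in>{s..t}. v r \<partial>lborel))}"

text \<open>
  For curves in \<^const>\<open>AC2\<close> the limit exists at almost every time; where it does not exist, the
  value is irrelevant.
\<close>

definition metric_deriv :: "(real \<Rightarrow> 'a::metric_space) \<Rightarrow> real \<Rightarrow> real" where
  "metric_deriv \<gamma> t = Lim (at t within {0..1}) (\<lambda>s. dist (\<gamma> s) (\<gamma> t) / \<bar>s - t\<bar>)"


subsection \<open>Test plans, weak upper gradients and Cheeger energies\<close>

definition test_plan :: "'a::metric_space measure \<Rightarrow> (real \<Rightarrow>\<^sub>C 'a) measure \<Rightarrow> bool" where
  "test_plan n \<pi> \<longleftrightarrow>
     sets \<pi> = sets (restrict_space borel curves) \<and> prob_space \<pi> \<and>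
     (AE \<gamma> in \<pi>. apply_bcontfun \<gamma> \<in> AC2) \<and>
     (\<integral>\<^sup>+\<gamma>. (\<integral>\<^sup>+t\<in>{0..1}. ennreal ((metric_deriv (apply_bcontfun \<gamma>) t)\<^sup>2) \<partial>lborel) \<partial>\<pi>) < \<infinity> \<and>
     (\<exists>C::real. C \<ge> 0 \<and> (\<forall>t\<in>{0..1}. \<forall>A\<in>sets borel.
        emeasure (distr \<pi> borel (\<lambda>\<gamma>. apply_bcontfun \<gamma> t)) A \<le> ennreal C * emeasure n A))"

definition weak_upper_gradient ::
    "'a::metric_space measure \<Rightarrow> ('a \<Rightarrow> real) \<Rightarrow> ('a \<Rightarrow> ennreal) \<Rightarrow> bool" where
  "weak_upper_gradient n f G \<longleftrightarrow>
     f \<in> borel_measurable borel \<and> G \<in> borel_measurable borel \<and>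
     (\<forall>\<pi>. test_plan n \<pi> \<longrightarrow>
        (AE \<gamma> in \<pi>.
           ennreal \<bar>f (apply_bcontfun \<gamma> 1) - f (apply_bcontfun \<gamma> 0)\<bar>
             \<le> (\<integral>\<^sup>+s\<in>{0..1}. G (apply_bcontfun \<gamma> s) * ennreal (metric_deriv (apply_bcontfun \<gamma>) s) \<partial>lborel) \<and>
           (\<integral>\<^sup>+s\<in>{0..1}. G (apply_bcontfun \<gamma> s) * ennreal (metric_deriv (apply_bcontfun \<gamma>) s) \<partial>lborel) < \<infinity>))"

definition S2 :: "'a::metric_space measure \<Rightarrow> ('a \<Rightarrow> real) set" where
  "S2 n = {f. \<exists>G. weak_upper_gradient n f G \<and> (\<integral>\<^sup>+x. (G x)\<^sup>2 \<partial>n) < \<infinity>}"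

text \<open>The minimiser is unique only up to equality almost everywhere; a representative is chosen.\<close>

definition min_weak_upper_gradient ::
    "'a::metric_space measure \<Rightarrow> ('a \<Rightarrow> real) \<Rightarrow> 'a \<Rightarrow> ennreal" where
  "min_weak_upper_gradient n f =
     (SOME G. weak_upper_gradient n f G \<and> (\<integral>\<^sup>+x. (G x)\<^sup>2 \<partial>n) < \<infinity> \<and>
        (\<forall>H. weak_upper_gradient n f H \<longrightarrow> (\<integral>\<^sup>+x. (G x)\<^sup>2 \<partial>n) \<le> (\<integral>\<^sup>+x. (H x)\<^sup>2 \<partial>n)))"

definition cheeger :: "'a::metric_space measure \<Rightarrow> ('a \<Rightarrow> real) \<Rightarrow> ennreal" where
  "cheeger n f =
     (if f \<in> S2 n then (\<integral>\<^sup>+x. (min_weak_upper_gradient n f x)\<^sup>2 \<partial>n) / 2 else \<infinity>)"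

definition cheeger_quadratic :: "'a::metric_space measure \<Rightarrow> bool" where
  "cheeger_quadratic n \<longleftrightarrow>
     (\<forall>f h :: 'a \<Rightarrow> real. integrable n f \<and> integrable n h \<longrightarrow>
        cheeger n (\<lambda>x. f x + h x) + cheeger n (\<lambda>x. f x - h x) = 2 * cheeger n f + 2 * cheeger n h)"

text \<open>
  The form has domain \<^term>\<open>S2 n \<times> S2 n\<close>. Since \<^term>\<open>S2 n\<close> is a vector space, both energies below
  are finite there.
\<close>

definition cheeger_form :: "'a::metric_space measure \<Rightarrow> ('a \<Rightarrow> real) \<Rightarrow> ('a \<Rightarrow> real) \<Rightarrow> real" where
  "cheeger_form n f h =
     (if f \<in> S2 n \<and> h \<in> S2 n
      then (enn2real (cheeger n (\<lambda>x. f x + h x)) - enn2real (cheeger n (\<lambda>x. f x - h x))) / 2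
      else undefined)"

end

theory Submission
  imports Defs
begin

text \<open>
  Along almost every curve of a test plan a Sobolev function has an absolutely continuous
  representative. This gives locality of the minimal weak upper gradient, and locality allows the
  integrated parallelogram law for \<open>m\<close> to be localized to a pointwise one. A function that is
  Sobolev for \<open>\<rho> = g m\<close>, truncated at height \<open>\<plusminus>\<eta>\<close> with \<open>\<eta>\<close> a Sobolev function of \<open>\<surd>g\<close> supported where
  \<open>g\<close> is bounded below, is Sobolev for \<open>m\<close>: a curve either stays in the support of \<open>\<eta>\<close>, where test
  plans for \<open>m\<close> are test plans for \<open>\<rho>\<close>, or it meets a zero of \<open>\<eta>\<close>. Hence the two minimal gradients
  agree \<open>\<rho>\<close>-almost everywhere, the pointwise parallelogram law passes to \<open>\<rho>\<close>, and the identity of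
  the forms is the pointwise chain rule \<open>g \<Gamma>(log g, \<phi>) = \<Gamma>(g, \<phi>)\<close>, which follows from bilinearity over
  the rationals because \<open>log g - c g\<close> has small gradient where \<open>c\<close> is close to \<open>1/g\<close>.
\<close>

section \<open>Integrals over intervals and Lebesgue differentiation\<close>

text \<open>The metric derivative is a two-sided limit that exists only at almost every time of good
  curves. It is traded for the lower right derivative \<open>speed\<close>, which is defined for
  every curve and is jointly measurable in curve and time along continuous curves, so that Fubini
  can exchange "at each time, for almost every curve" with "for almost every curve, at almost every
  time". A weak upper gradient controls only the increment between the two end points; restricting
  plans to subintervals with rational ends recovers from this a continuous representative along the
  whole curve. Quadraticity of \<open>m\<close> speaks of integrable functions only, while elements
  of \<open>S2 m\<close> need not be integrable; this shapes the localization, which has to produce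
  bounded functions living on sets of finite measure. Plans for \<open>\<rho>\<close> are plans for
  \<open>m\<close>, so one comparison of the two gradients is formal; the other is not, because
  \<open>\<rho>\<close> has fewer plans, and there the Sobolev regularity of the root of
  \<open>g\<close> is used. Every pointwise identity has its own exceptional null set, hence
  parameters range over the rationals and real ones are reached by limits.\<close>

lemma AE_lborel_affine:
  fixes P :: "real \<Rightarrow> bool"
  assumes "AE x in lborel. P x" "c \<noteq> 0"
  shows "AE x in lborel. P (t + c * x)"
proof -
  obtain N where N: "{x. \<not> P x} \<subseteq> N" "N \<in> null_sets lborel"
    using AE_E[OF assms(1)] by (auto simp: null_sets_def)
  then have "N \<in> sets borel" by auto
  have "AE x in lborel. x \<notin> N"
    using N(2) by (rule AE_not_in)
  then have "AE x in lborel. t + c * x \<notin> N"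
    using \<open>N \<in> sets borel\<close> by (intro AE_borel_affine[OF assms(2)]) auto
  then show ?thesis
    by eventually_elim (use N in auto)
qed

lemma nn_integral_Icc_split:
  fixes v :: "real \<Rightarrow> ennreal"
  assumes [measurable]: "v \<in> borel_measurable borel" and "a \<le> b" "b \<le> c"
  shows "(\<integral>\<^sup>+t\<in>{a..c}. v t \<partial>lborel) = (\<integral>\<^sup>+t\<in>{a..b}. v t \<partial>lborel) + (\<integral>\<^sup>+t\<in>{b..c}. v t \<partial>lborel)"
proof -
  have "(\<integral>\<^sup>+t\<in>{a..b}. v t \<partial>lborel) + (\<integral>\<^sup>+t\<in>{b..c}. v t \<partial>lborel)
      = (\<integral>\<^sup>+t. v t * indicator {a..b} t + v t * indicator {b..c} t \<partial>lborel)"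
    by (rule nn_integral_add[symmetric]) auto
  also have "\<dots> = (\<integral>\<^sup>+t\<in>{a..c}. v t \<partial>lborel)"
    by (intro nn_integral_cong_AE, use AE_lborel_singleton[of b] in eventually_elim)
       (use assms in \<open>auto simp: indicator_def\<close>)
  finally show ?thesis by simp
qed

lemma nn_integral_Icc_affine:
  fixes v :: "real \<Rightarrow> ennreal"
  assumes [measurable]: "v \<in> borel_measurable borel" and "k > 0"
  shows "(\<integral>\<^sup>+r\<in>{s + k * a..s + k * b}. v r \<partial>lborel) = ennreal k * (\<integral>\<^sup>+r\<in>{a..b}. v (s + k * r) \<partial>lborel)"
  using assms(2) by (subst nn_integral_real_affine[of _ k s])
     (auto intro!: arg_cong[where f = "(*) _"] nn_integral_cong simp: indicator_def)

lemma nn_integral_Icc_reflect: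
  fixes v :: "real \<Rightarrow> ennreal"
  assumes [measurable]: "v \<in> borel_measurable borel"
  shows "(\<integral>\<^sup>+r\<in>{s..t}. v (1 - r) \<partial>lborel) = (\<integral>\<^sup>+r\<in>{1 - t..1 - s}. v r \<partial>lborel)"
  by (subst (2) nn_integral_real_affine[of _ "-1" 1])
     (auto intro!: nn_integral_cong simp: indicator_def)

lemma nn_integral_Icc_mono_set:
  fixes v :: "real \<Rightarrow> ennreal"
  assumes "A \<subseteq> B"
  shows "(\<integral>\<^sup>+t\<in>A. v t \<partial>lborel) \<le> (\<integral>\<^sup>+t\<in>B. v t \<partial>lborel)"
  using assms by (intro nn_integral_mono) (auto simp: indicator_def)

text \<open>Continuity from above of the finite measure with density \<open>v\<close> on the
  interval: the windows shrink to a point, which has measure zero.\<close>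

lemma nn_integral_Icc_small:
  fixes v :: "real \<Rightarrow> ennreal"
  assumes [measurable]: "v \<in> borel_measurable borel"
    and fin: "(\<integral>\<^sup>+r\<in>{a..b}. v r \<partial>lborel) < \<infinity>" and "e > 0"
  obtains d where "d > 0" "(\<integral>\<^sup>+r\<in>{x - d..x + d} \<inter> {a..b}. v r \<partial>lborel) < e"
proof -
  define M where "M = density lborel (\<lambda>r. v r * indicator {a..b} r)"
  have em: "emeasure M A = (\<integral>\<^sup>+r\<in>A \<inter> {a..b}. v r \<partial>lborel)" if "A \<in> sets borel" for A
    unfolding M_def using that
    by (subst emeasure_density) (auto intro!: nn_integral_cong simp: indicator_def)
  define A where "A = (\<lambda>n. {x - inverse (real (Suc n))..x + inverse (real (Suc n))})"
  have "decseq A"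
    unfolding A_def
    by (intro decseq_SucI) (auto intro: order_trans simp: field_simps)
  moreover have Aeq: "(\<Inter>n. A n) = {x}"
  proof -
    have "y = x" if "\<And>n. y \<in> A n" for y
    proof (rule ccontr)
      assume "y \<noteq> x"
      then obtain n where "inverse (real (Suc n)) < \<bar>y - x\<bar>"
        using reals_Archimedean[of "\<bar>y - x\<bar>"] by auto
      with that[of n] show False by (auto simp: A_def abs_real_def split: if_splits)
    qed
    then show ?thesis by (auto simp: A_def)
  qed
  moreover have "emeasure M (A n) \<noteq> \<infinity>" for n
  proof -
    have "emeasure M (A n) \<le> emeasure M UNIV"
      by (intro emeasure_mono) (auto simp: M_def)
    also have "\<dots> < \<infinity>" using fin by (simp add: em)
    finally show ?thesis by simp
  qed
  ultimately have "(\<lambda>n. emeasure M (A n)) \<longlonglongrightarrow> emeasure M (\<Inter>n. A n)"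
    by (intro Lim_emeasure_decseq) (auto simp: A_def M_def)
  moreover have "emeasure M {x} = 0"
  proof -
    have "AE r in lborel. v r * indicator ({x} \<inter> {a..b}) r = 0"
      using AE_lborel_singleton[of x] by eventually_elim (auto simp: indicator_def)
    then show ?thesis
      by (subst em, simp) (auto intro!: nn_integral_0_iff_AE[THEN iffD2])
  qed
  ultimately have "(\<lambda>n. emeasure M (A n)) \<longlonglongrightarrow> 0" using Aeq by simp
  then have "eventually (\<lambda>n. emeasure M (A n) < e) sequentially"
    using \<open>e > 0\<close> by (rule order_tendstoD(2))
  then obtain n where "emeasure M (A n) < e"
    by (auto simp: eventually_sequentially)
  then show ?thesis
    by (intro that[of "inverse (real (Suc n))"]) (auto simp: A_def em)
qed

text \<open>Averages to the right match the right derivative \<open>speed\<close>. Convergence is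
  stated as two inequalities multiplied out by \<open>h\<close>, which avoids subtraction and
  division of extended reals.\<close>

lemma lebesgue_differentiation_right:
  fixes v :: "real \<Rightarrow> ennreal"
  assumes [measurable]: "v \<in> borel_measurable borel"
    and fin: "(\<integral>\<^sup>+r. v r \<partial>lborel) < \<infinity>"
  shows "AE t in lborel. v t < \<infinity> \<and> (\<forall>e>0. \<forall>\<^sub>F h in at_right 0.
      (\<integral>\<^sup>+r\<in>{t..t+h}. v r \<partial>lborel) \<le> (v t + ennreal e) * ennreal h \<and>
      v t * ennreal h \<le> (\<integral>\<^sup>+r\<in>{t..t+h}. v r \<partial>lborel) + ennreal e * ennreal h)"
proof -
  define f where "f r = enn2real (v r)" for r
  have AEv: "AE r in lborel. v r < \<infinity>"
    using nn_integral_PInf_AE[of v lborel] fin by (auto simp: less_top)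
  have vf: "AE r in lborel. v r = ennreal (f r)"
    using AEv by eventually_elim (auto simp: f_def)
  have [measurable]: "f \<in> borel_measurable borel" unfolding f_def by measurable
  have f0: "f r \<ge> 0" for r by (simp add: f_def)
  have "(\<integral>\<^sup>+r. ennreal (norm (f r)) \<partial>lborel) = (\<integral>\<^sup>+r. v r \<partial>lborel)"
    using vf by (intro nn_integral_cong_AE) (auto simp: f0)
  then have intf: "integrable lborel f"
    using fin by (intro integrableI_bounded) auto
  have sint: "set_integrable lborel {a..b} f" for a b
    unfolding set_integrable_def using intf by (intro integrable_mult_indicator) auto
  have eq: "(\<integral>\<^sup>+r\<in>{a..b}. v r \<partial>lborel) = ennreal (integral {a..b} f)" for a b
  proof -
    have "(\<integral>\<^sup>+r\<in>{a..b}. v r \<partial>lborel) = (\<integral>\<^sup>+r. ennreal (indicator {a..b} r *\<^sub>R f r) \<partial>lborel)"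
      using vf by (intro nn_integral_cong_AE) (auto simp: indicator_def)
    also have "\<dots> = ennreal (LINT r:{a..b}|lborel. f r)"
      unfolding set_lebesgue_integral_def
      using sint[of a b] by (intro nn_integral_eq_integral) (auto simp: set_integrable_def f0)
    also have "(LINT r:{a..b}|lborel. f r) = integral {a..b} f"
      using sint[of a b] by (rule set_borel_integral_eq_integral)
    finally show ?thesis .
  qed
  have "f integrable_on cbox a b" for a b
    using set_borel_integral_eq_integral(1)[OF sint[of a b]] by simp
  \<comment> \<open>The library form of Lebesgue differentiation: off a negligible set the averages
    over right-sided cubes converge to the value of \<open>f\<close>.\<close>
  then obtain N where N: "negligible N"
    "\<And>x e. x \<notin> N \<Longrightarrow> 0 < e \<Longrightarrow> \<exists>d>0. \<forall>h. 0 < h \<and> h < d \<longrightarrow>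
        norm (integral (cbox x (x + h *\<^sub>R One)) f /\<^sub>R h ^ DIM(real) - f x) < e"
    using integrable_ccontinuous_explicit by blast
  have "AE x in lebesgue. x \<notin> N"
    using N(1) by (intro AE_not_in) (simp add: negligible_iff_null_sets)
  then have "AE x in lborel. x \<notin> N"
    by (simp add: AE_completion_iff)
  with vf show ?thesis
  proof eventually_elim
    case (elim t)
    show ?case
    proof (intro conjI allI impI)
      show "v t < \<infinity>" using elim by simp
      fix e :: real assume e: "e > 0"
      then obtain d where d: "d > 0" "\<And>h. 0 < h \<Longrightarrow> h < d \<Longrightarrow>
        norm (integral (cbox t (t + h *\<^sub>R One)) f /\<^sub>R h ^ DIM(real) - f t) < e"
        using N(2)[OF elim(2) e] by auto
      have "eventually (\<lambda>h. 0 < h \<and> h < d) (at_right (0::real))"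
        using d(1) by (auto simp: eventually_at_right_field)
      then show "\<forall>\<^sub>F h in at_right 0.
      (\<integral>\<^sup>+r\<in>{t..t+h}. v r \<partial>lborel) \<le> (v t + ennreal e) * ennreal h \<and>
      v t * ennreal h \<le> (\<integral>\<^sup>+r\<in>{t..t+h}. v r \<partial>lborel) + ennreal e * ennreal h"
      proof eventually_elim
        fix h :: real assume h: "0 < h \<and> h < d"
        define I where "I = integral {t..t+h} f"
        have I0: "I \<ge> 0" unfolding I_def by (rule integral_nonneg)
          (use set_borel_integral_eq_integral(1)[OF sint[of t "t+h"]] f0 in auto)
        have "\<bar>I / h - f t\<bar> < e"
          using d(2)[of h] h by (simp add: I_def divide_inverse_commute)
        then have *: "I / h \<le> f t + e" "f t \<le> I / h + e" by linarith+
        then have "I \<le> (f t + e) * h" "f t * h \<le> I + e * h"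
          using h by (auto simp: field_simps)
        moreover have "v t = ennreal (f t)" by (rule elim)
        ultimately show "(\<integral>\<^sup>+r\<in>{t..t+h}. v r \<partial>lborel) \<le> (v t + ennreal e) * ennreal h \<and>
      v t * ennreal h \<le> (\<integral>\<^sup>+r\<in>{t..t+h}. v r \<partial>lborel) + ennreal e * ennreal h"
          using h e I0 f0[of t]
          unfolding eq I_def[symmetric]
          by (simp add: ennreal_mult[symmetric] ennreal_plus[symmetric] del: ennreal_plus)
      qed
    qed
  qed
qed

section \<open>Metric speed\<close>

text \<open>The lower right metric derivative. It makes sense at every time of every curve, and
  along regular curves it coincides almost everywhere with \<open>metric_deriv\<close>.\<close>

definition speed :: "(real \<Rightarrow> 'a::metric_space) \<Rightarrow> real \<Rightarrow> ennreal" where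
  "speed c t = Liminf (at_right 0) (\<lambda>h. ennreal (dist (c (t + h)) (c t) / h))"

lemma speed_lessD:
  assumes "speed c t < x"
  shows "\<exists>\<^sub>F h in at_right 0. ennreal (dist (c (t + h)) (c t) / h) < x"
proof (rule ccontr)
  assume "\<not> ?thesis"
  then have "eventually (\<lambda>h. x \<le> ennreal (dist (c (t + h)) (c t) / h)) (at_right 0)"
    by (simp add: frequently_def not_less)
  then have "x \<le> speed c t"
    unfolding speed_def by (rule Liminf_bounded)
  with assms show False by simp
qed

lemma speed_greaterD:
  assumes "x < speed c t"
  shows "\<forall>\<^sub>F h in at_right 0. x < ennreal (dist (c (t + h)) (c t) / h)"
  using assms unfolding speed_def by (rule less_LiminfD)

text \<open>
  The set where the bound on the lower derivative fails is null, and an open set around it on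
  which the given upper gradient has small integral makes it harmless. Outside of it one moves
  forward by the small steps that the lower derivative provides, up to the supremum of the
  reachable times.
\<close>

lemma dist_le_integral_of_speed_le:
  fixes c :: "real \<Rightarrow> 'a::metric_space" and v w :: "real \<Rightarrow> ennreal"
  assumes ab: "a \<le> b"
    and [measurable]: "v \<in> borel_measurable borel" "w \<in> borel_measurable borel"
    and vfin: "(\<integral>\<^sup>+r\<in>{a..b}. v r \<partial>lborel) < \<infinity>"
    and vb: "\<And>s t. a \<le> s \<Longrightarrow> s \<le> t \<Longrightarrow> t \<le> b \<Longrightarrow>
        ennreal (dist (c s) (c t)) \<le> (\<integral>\<^sup>+r\<in>{s..t}. v r \<partial>lborel)"
    and sp: "AE t in lborel. a < t \<and> t < b \<longrightarrow> speed c t \<le> w t"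
  shows "ennreal (dist (c a) (c b)) \<le> (\<integral>\<^sup>+r\<in>{a..b}. w r \<partial>lborel)"
proof (cases "(\<integral>\<^sup>+r\<in>{a..b}. w r \<partial>lborel) < \<infinity>")
  case False
  then show ?thesis by (simp add: less_top[symmetric])
next
  case True
  define w' where "w' r = w r * indicator {a..b} r" for r
  have [measurable]: "w' \<in> borel_measurable borel" unfolding w'_def by measurable
  have w'fin: "(\<integral>\<^sup>+r. w' r \<partial>lborel) < \<infinity>" using True by (simp add: w'_def)
  have "ennreal (dist (c a) (c b)) \<le> (\<integral>\<^sup>+r\<in>{a..b}. w r \<partial>lborel) + ennreal e" if "e > 0" for e :: real
  proof -
    \<comment> \<open>Half of the error \<open>e\<close> pays for the extra slope \<open>e1\<close>
      on the whole interval, the other half for the open set \<open>U\<close> around the bad times.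
      The summand \<open>1\<close> keeps the denominator positive when \<open>a = b\<close>.\<close>
    define e1 where "e1 = e / (2 * (b - a + 1))"
    have e1: "e1 > 0" "e1 * (b - a) \<le> e / 2"
      using that ab by (auto simp: e1_def field_simps)
    define good where "good t \<longleftrightarrow> speed c t \<le> w t \<and> w' t < \<infinity> \<and> (\<forall>e>0. \<forall>\<^sub>F h in at_right 0.
      (\<integral>\<^sup>+r\<in>{t..t+h}. w' r \<partial>lborel) \<le> (w' t + ennreal e) * ennreal h \<and>
      w' t * ennreal h \<le> (\<integral>\<^sup>+r\<in>{t..t+h}. w' r \<partial>lborel) + ennreal e * ennreal h)" for t
    have "AE t in lborel. a < t \<and> t < b \<longrightarrow> good t"
      using lebesgue_differentiation_right[OF \<open>w' \<in> borel_measurable borel\<close> w'fin] sp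
      by eventually_elim (auto simp: good_def)
    from AE_E[OF this] obtain N0 where N0: "{t. \<not> (a < t \<and> t < b \<longrightarrow> good t)} \<subseteq> N0" "emeasure lborel N0 = 0" "N0 \<in> sets lborel"
      by auto
    \<comment> \<open>The bound on the derivative is assumed in the open interval only, so the
      starting time counts as bad; being in \<open>U\<close>, it can still be left with the help of
      \<open>v\<close>.\<close>
    define N where "N = insert a N0"
    have "{a} \<union> N0 \<in> null_sets lborel"
      using N0 by (intro null_sets.Un) auto
    then have N: "N \<in> sets borel" "emeasure lborel N = 0"
      by (auto simp: N_def null_sets_def)
    define \<nu> where "\<nu> = density lborel (\<lambda>r. v r * indicator {a..b} r)"
    have em: "emeasure \<nu> A = (\<integral>\<^sup>+r\<in>A \<inter> {a..b}. v r \<partial>lborel)" if "A \<in> sets borel" for A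
      unfolding \<nu>_def using that
      by (subst emeasure_density) (auto intro!: nn_integral_cong simp: indicator_def)
    have fin\<nu>: "emeasure \<nu> (space \<nu>) \<noteq> \<infinity>"
      using vfin em[of UNIV] by (simp add: \<nu>_def)
    have "emeasure \<nu> N = 0"
    proof -
      have "AE r in lborel. v r * indicator (N \<inter> {a..b}) r = 0"
        using AE_not_in[of N lborel] N by (auto simp: null_sets_def indicator_def elim: eventually_mono)
      then show ?thesis
        using N by (subst em) (auto intro!: nn_integral_0_iff_AE[THEN iffD2])
    qed
    \<comment> \<open>Outer regularity of the finite measure \<open>\<nu>\<close>, which does not
      charge the Lebesgue null set \<open>N\<close>.\<close>
    then have "(INF U \<in> {U. N \<subseteq> U \<and> open U}. emeasure \<nu> U) < ennreal (e / 2)"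
      using outer_regular[of \<nu> N] N fin\<nu> that by (simp add: \<nu>_def)
    then obtain U where U: "N \<subseteq> U" "open U" "emeasure \<nu> U < ennreal (e / 2)"
      by (auto simp: INF_less_iff)
    then have [measurable]: "U \<in> sets borel" by auto
    define u where "u r = w r + ennreal e1 + v r * indicator U r" for r
    have [measurable]: "u \<in> borel_measurable borel" unfolding u_def by measurable
    define S where "S = {t \<in> {a..b}. ennreal (dist (c a) (c t)) \<le> (\<integral>\<^sup>+r\<in>{a..t}. u r \<partial>lborel)}"
    have "a \<in> S" using ab by (auto simp: S_def)
    define T where "T = Sup S"
    have bdd: "bdd_above S" by (auto simp: S_def bdd_above_def)
    have aT: "a \<le> T" unfolding T_def using \<open>a \<in> S\<close> bdd by (rule cSup_upper)
    have Tb: "T \<le> b" unfolding T_def using \<open>a \<in> S\<close> by (intro cSup_least) (auto simp: S_def)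
    \<comment> \<open>A reachable time close to the supremum is joined to it by means of
      \<open>v\<close>, whose integral over a short window is small.\<close>
    have "T \<in> S"
    proof -
      have "ennreal (dist (c a) (c T)) \<le> (\<integral>\<^sup>+r\<in>{a..T}. u r \<partial>lborel) + ennreal d" if "d > 0" for d
      proof -
        obtain \<delta> where \<delta>: "\<delta> > 0" "(\<integral>\<^sup>+r\<in>{T - \<delta>..T + \<delta>} \<inter> {a..b}. v r \<partial>lborel) < ennreal d"
          by (rule nn_integral_Icc_small[OF \<open>v \<in> borel_measurable borel\<close> vfin, of "ennreal d" T])
             (use \<open>d > 0\<close> in auto)
        obtain s where s: "s \<in> S" "T - \<delta> < s"
          using less_cSupD[of S "T - \<delta>"] \<open>a \<in> S\<close> \<delta> by (auto simp: T_def)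
        have "s \<le> T" unfolding T_def using s bdd by (intro cSup_upper)
        have "ennreal (dist (c a) (c T)) \<le> ennreal (dist (c a) (c s)) + ennreal (dist (c s) (c T))"
          by (simp add: ennreal_plus[symmetric] dist_triangle del: ennreal_plus)
        also have "\<dots> \<le> (\<integral>\<^sup>+r\<in>{a..s}. u r \<partial>lborel) + (\<integral>\<^sup>+r\<in>{s..T}. v r \<partial>lborel)"
          using s \<open>s \<le> T\<close> Tb by (intro add_mono vb) (auto simp: S_def)
        also have "\<dots> \<le> (\<integral>\<^sup>+r\<in>{a..T}. u r \<partial>lborel) + (\<integral>\<^sup>+r\<in>{T - \<delta>..T + \<delta>} \<inter> {a..b}. v r \<partial>lborel)"
          using s \<open>s \<le> T\<close> Tb \<delta> by (intro add_mono nn_integral_Icc_mono_set) (auto simp: S_def)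
        also have "\<dots> \<le> (\<integral>\<^sup>+r\<in>{a..T}. u r \<partial>lborel) + ennreal d"
          using \<delta> by (intro add_mono) auto
        finally show ?thesis .
      qed
      then have "ennreal (dist (c a) (c T)) \<le> (\<integral>\<^sup>+r\<in>{a..T}. u r \<partial>lborel)"
        by (rule ennreal_le_epsilon)
      then show ?thesis using aT Tb by (simp add: S_def)
    qed
    have "T = b"
    proof (rule ccontr)
      assume "T \<noteq> b"
      then have "T < b" using Tb by simp
      have small: "eventually (\<lambda>h. h < b - T) (at_right (0::real))"
        using \<open>T < b\<close> by (auto simp: eventually_at_right_field intro: exI[of _ "b - T"])
      have pos: "eventually (\<lambda>h. h > (0::real)) (at_right 0)"
        by (simp add: eventually_at_right_less)
      have "\<exists>h. 0 < h \<and> h < b - T \<and> ennreal (dist (c T) (c (T + h))) \<le> (\<integral>\<^sup>+r\<in>{T..T+h}. u r \<partial>lborel)"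
      proof (cases "T \<in> U")
        case True
        then obtain \<delta> where \<delta>: "\<delta> > 0" "ball T \<delta> \<subseteq> U"
          using U(2) open_contains_ball by blast
        define h where "h = min (\<delta> / 2) ((b - T) / 2)"
        have h: "0 < h" "h < b - T" "h < \<delta>" using \<delta> \<open>T < b\<close> by (auto simp: h_def min_def)
        then have "{T..T+h} \<subseteq> U" using \<delta> by (auto simp: subset_eq dist_real_def)
        have "ennreal (dist (c T) (c (T + h))) \<le> (\<integral>\<^sup>+r\<in>{T..T+h}. v r \<partial>lborel)"
          using h aT by (intro vb) auto
        also have "\<dots> \<le> (\<integral>\<^sup>+r\<in>{T..T+h}. u r \<partial>lborel)"
          using \<open>{T..T+h} \<subseteq> U\<close> by (intro nn_integral_mono) (auto simp: u_def indicator_def)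
        finally show ?thesis using h by auto
      next
        case False
        then have "T \<notin> N" using U by auto
        then have "T \<noteq> a" "T \<notin> N0" by (auto simp: N_def)
        have "a < T" using \<open>T \<noteq> a\<close> aT by simp
        then have "good T" using \<open>T \<notin> N0\<close> N0(1) \<open>T < b\<close> by auto
        moreover have w'T: "w' T = w T" using aT Tb by (simp add: w'_def)
        ultimately have wT: "speed c T \<le> w T" "w T < \<infinity>" by (auto simp: good_def)
        have "w T + 0 < w T + ennreal (e1 / 2)"
          using wT(2) e1 by (subst ennreal_add_left_cancel_less) auto
        then have "w T < w T + ennreal (e1 / 2)" by (simp only: add_0_right)
        with wT(1) have "speed c T < w T + ennreal (e1 / 2)" by (rule le_less_trans)
        then have fr: "\<exists>\<^sub>F h in at_right 0. ennreal (dist (c (T + h)) (c T) / h) < w T + ennreal (e1 / 2)"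
          by (rule speed_lessD)
        have "\<forall>\<^sub>F h in at_right 0. w' T * ennreal h \<le> (\<integral>\<^sup>+r\<in>{T..T+h}. w' r \<partial>lborel) + ennreal (e1 / 2) * ennreal h"
          by (rule eventually_mono[OF conjunct2[OF conjunct2[OF \<open>good T\<close>[unfolded good_def]], rule_format, of "e1 / 2"]])
             (use e1 in auto)
        with small pos have "\<forall>\<^sub>F h in at_right 0. 0 < h \<and> h < b - T \<and>
           w T * ennreal h \<le> (\<integral>\<^sup>+r\<in>{T..T+h}. w' r \<partial>lborel) + ennreal (e1 / 2) * ennreal h"
          by eventually_elim (simp add: w'T)
        \<comment> \<open>A lower limit provides only arbitrarily small good steps, not all small
          steps. One is enough, and it can be chosen where the averages of \<open>w'\<close> are
          already close to \<open>w' T\<close>.\<close>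
        from frequently_ex[OF frequently_eventually_frequently[OF fr this]]
        obtain h where h: "ennreal (dist (c (T + h)) (c T) / h) < w T + ennreal (e1 / 2)" "0 < h" "h < b - T"
           "w T * ennreal h \<le> (\<integral>\<^sup>+r\<in>{T..T+h}. w' r \<partial>lborel) + ennreal (e1 / 2) * ennreal h"
          by blast
        have "ennreal (dist (c T) (c (T + h))) = ennreal (dist (c (T + h)) (c T) / h) * ennreal h"
          using h by (simp add: ennreal_mult[symmetric] dist_commute)
        also have "\<dots> \<le> (w T + ennreal (e1 / 2)) * ennreal h"
          using h by (intro mult_right_mono) auto
        also have "\<dots> = w T * ennreal h + ennreal (e1 / 2) * ennreal h" by (simp add: distrib_right)
        also have "\<dots> \<le> (\<integral>\<^sup>+r\<in>{T..T+h}. w' r \<partial>lborel) + ennreal (e1 / 2) * ennreal h + ennreal (e1 / 2) * ennreal h"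
          using h by (intro add_right_mono)
        also have "\<dots> = (\<integral>\<^sup>+r\<in>{T..T+h}. w' r \<partial>lborel) + ennreal e1 * ennreal h"
          using e1 h by (simp add: add.assoc ennreal_mult[symmetric] ennreal_plus[symmetric] del: ennreal_plus)
        also have "\<dots> = (\<integral>\<^sup>+r\<in>{T..T+h}. w' r \<partial>lborel) + (\<integral>\<^sup>+r\<in>{T..T+h}. ennreal e1 \<partial>lborel)"
          using h by (simp add: nn_integral_cmult_indicator)
        also have "\<dots> = (\<integral>\<^sup>+r. w' r * indicator {T..T+h} r + ennreal e1 * indicator {T..T+h} r \<partial>lborel)"
          by (rule nn_integral_add[symmetric]) auto
        also have "\<dots> \<le> (\<integral>\<^sup>+r\<in>{T..T+h}. u r \<partial>lborel)"
          by (intro nn_integral_mono) (auto simp: u_def w'_def indicator_def)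
        finally show ?thesis using h by auto
      qed
      then obtain h where h: "0 < h" "h < b - T" "ennreal (dist (c T) (c (T + h))) \<le> (\<integral>\<^sup>+r\<in>{T..T+h}. u r \<partial>lborel)"
        by auto
      have "ennreal (dist (c a) (c (T + h))) \<le> ennreal (dist (c a) (c T)) + ennreal (dist (c T) (c (T + h)))"
        by (simp add: ennreal_plus[symmetric] dist_triangle del: ennreal_plus)
      also have "\<dots> \<le> (\<integral>\<^sup>+r\<in>{a..T}. u r \<partial>lborel) + (\<integral>\<^sup>+r\<in>{T..T+h}. u r \<partial>lborel)"
        using \<open>T \<in> S\<close> h by (intro add_mono) (auto simp: S_def)
      also have "\<dots> = (\<integral>\<^sup>+r\<in>{a..T+h}. u r \<partial>lborel)"
        using aT h by (intro nn_integral_Icc_split[symmetric]) auto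
      finally have "T + h \<in> S" using h aT by (auto simp: S_def)
      then have "T + h \<le> T" unfolding T_def using bdd by (rule cSup_upper)
      with h show False by simp
    qed
    with \<open>T \<in> S\<close> have "ennreal (dist (c a) (c b)) \<le> (\<integral>\<^sup>+r\<in>{a..b}. u r \<partial>lborel)"
      by (simp add: S_def)
    also have "\<dots> = (\<integral>\<^sup>+r. w r * indicator {a..b} r + (ennreal e1 * indicator {a..b} r + v r * indicator (U \<inter> {a..b}) r) \<partial>lborel)"
      by (intro nn_integral_cong) (auto simp: u_def indicator_def add.assoc)
    also have "\<dots> = (\<integral>\<^sup>+r\<in>{a..b}. w r \<partial>lborel) + ((\<integral>\<^sup>+r\<in>{a..b}. ennreal e1 \<partial>lborel) + emeasure \<nu> U)"
      by (simp add: nn_integral_add em)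
    also have "(\<integral>\<^sup>+r\<in>{a..b}. ennreal e1 \<partial>lborel) = ennreal (e1 * (b - a))"
      using e1 ab by (simp add: nn_integral_cmult_indicator ennreal_mult)
    also have "(\<integral>\<^sup>+r\<in>{a..b}. w r \<partial>lborel) + (ennreal (e1 * (b - a)) + emeasure \<nu> U)
        \<le> (\<integral>\<^sup>+r\<in>{a..b}. w r \<partial>lborel) + (ennreal (e / 2) + ennreal (e / 2))"
      using e1 U by (intro add_mono ennreal_leI) auto
    also have "ennreal (e / 2) + ennreal (e / 2) = ennreal e"
      using that by (simp add: ennreal_plus[symmetric] del: ennreal_plus)
    finally show ?thesis .
  qed
  then show ?thesis by (rule ennreal_le_epsilon) auto
qed

text \<open>The quotient is dominated by the average of \<open>v\<close> over the step, which is
  close to \<open>v t\<close> at a Lebesgue point. The bound holds for all small steps; this is what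
  later turns the lower limit into a limit.\<close>

lemma eventually_quotient_le:
  fixes c :: "real \<Rightarrow> 'a::metric_space" and v :: "real \<Rightarrow> ennreal"
  assumes [measurable]: "v \<in> borel_measurable borel"
    and vfin: "(\<integral>\<^sup>+r\<in>{a..b}. v r \<partial>lborel) < \<infinity>"
    and vb: "\<And>s t. a \<le> s \<Longrightarrow> s \<le> t \<Longrightarrow> t \<le> b \<Longrightarrow>
        ennreal (dist (c s) (c t)) \<le> (\<integral>\<^sup>+r\<in>{s..t}. v r \<partial>lborel)"
  shows "AE t in lborel. a < t \<and> t < b \<longrightarrow> v t < \<infinity> \<and>
      (\<forall>e>0. \<forall>\<^sub>F h in at_right 0. ennreal (dist (c (t + h)) (c t) / h) \<le> v t + ennreal e)"
proof -
  define v' where "v' r = v r * indicator {a..b} r" for r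
  have [measurable]: "v' \<in> borel_measurable borel" unfolding v'_def by measurable
  have v'fin: "(\<integral>\<^sup>+r. v' r \<partial>lborel) < \<infinity>" using vfin by (simp add: v'_def)
  show ?thesis
    using lebesgue_differentiation_right[OF \<open>v' \<in> borel_measurable borel\<close> v'fin]
  proof eventually_elim
    case (elim t)
    show ?case
    proof (intro impI conjI allI)
      assume t: "a < t \<and> t < b"
      then have v't: "v' t = v t" by (simp add: v'_def)
      then show "v t < \<infinity>" using elim by simp
      fix e :: real assume e: "e > 0"
      have "\<forall>\<^sub>F h in at_right 0. (\<integral>\<^sup>+r\<in>{t..t+h}. v' r \<partial>lborel) \<le> (v' t + ennreal e) * ennreal h"
        by (rule eventually_mono[OF conjunct2[OF elim, rule_format, OF e]]) auto
      moreover have "eventually (\<lambda>h. h < b - t) (at_right (0::real))"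
        using t by (auto simp: eventually_at_right_field intro: exI[of _ "b - t"])
      moreover have "eventually (\<lambda>h. h > (0::real)) (at_right 0)"
        by (simp add: eventually_at_right_less)
      ultimately show "\<forall>\<^sub>F h in at_right 0. ennreal (dist (c (t + h)) (c t) / h) \<le> v t + ennreal e"
      proof eventually_elim
        case (elim h)
        have "ennreal (dist (c (t + h)) (c t)) \<le> (\<integral>\<^sup>+r\<in>{t..t+h}. v r \<partial>lborel)"
          using vb[of t "t + h"] t elim by (simp add: dist_commute)
        also have "\<dots> = (\<integral>\<^sup>+r\<in>{t..t+h}. v' r \<partial>lborel)"
          using t elim by (intro nn_integral_cong) (auto simp: v'_def indicator_def)
        also have "\<dots> \<le> (v t + ennreal e) * ennreal h"
          using elim v't by simp
        finally have "ennreal (dist (c (t + h)) (c t)) / ennreal h \<le> (v t + ennreal e) * ennreal h / ennreal h"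
          by (rule divide_right_mono_ennreal)
        then show ?case
          using elim by (simp add: divide_ennreal ennreal_mult_divide_eq)
      qed
    qed
  qed
qed

lemma speed_le_of_eventually:
  assumes "\<And>e. e > 0 \<Longrightarrow> \<forall>\<^sub>F h in at_right 0. ennreal (dist (c (t + h)) (c t) / h) \<le> x + ennreal e"
  shows "speed c t \<le> x"
proof (rule ennreal_le_epsilon)
  fix e :: real assume "e > 0"
  show "speed c t \<le> x + ennreal e"
  proof (rule ccontr)
    assume "\<not> ?thesis"
    then have "\<forall>\<^sub>F h in at_right 0. x + ennreal e < ennreal (dist (c (t + h)) (c t) / h)"
      by (intro speed_greaterD) auto
    with assms[OF \<open>e > 0\<close>] have "\<forall>\<^sub>F h in at_right (0::real). False"
      by eventually_elim auto
    then show False by simp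
  qed
qed

lemma speed_le_of_bound:
  fixes c :: "real \<Rightarrow> 'a::metric_space" and v :: "real \<Rightarrow> ennreal"
  assumes "v \<in> borel_measurable borel" "(\<integral>\<^sup>+r\<in>{a..b}. v r \<partial>lborel) < \<infinity>"
    and "\<And>s t. a \<le> s \<Longrightarrow> s \<le> t \<Longrightarrow> t \<le> b \<Longrightarrow>
        ennreal (dist (c s) (c t)) \<le> (\<integral>\<^sup>+r\<in>{s..t}. v r \<partial>lborel)"
  shows "AE t in lborel. a < t \<and> t < b \<longrightarrow> speed c t \<le> v t"
proof -
  have "AE t in lborel. a < t \<and> t < b \<longrightarrow> v t < \<infinity> \<and>
      (\<forall>e>0. \<forall>\<^sub>F h in at_right 0. ennreal (dist (c (t + h)) (c t) / h) \<le> v t + ennreal e)"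
    using assms by (intro eventually_quotient_le) auto
  then show ?thesis by eventually_elim (auto intro: speed_le_of_eventually)
qed

text \<open>For \<open>h > 0\<close> the quotient is continuous in \<open>h\<close>, so a step can
  be replaced by a rational one slightly to its right, where the strict bound on \<open>h\<close>
  leaves room. The formula is countable and thus yields measurability.\<close>

lemma speed_eq_SUP_INF_Rats:
  fixes c :: "real \<Rightarrow> 'a::metric_space"
  assumes c: "continuous_on UNIV c"
  shows "speed c t = (SUP k::nat. INF h\<in>{h\<in>\<rat>. 0 < h \<and> h < 1 / real (Suc k)}. ennreal (dist (c (t + h)) (c t) / h))"
    (is "_ = (SUP k. INF h\<in>?R k. ?q h)")
proof (rule antisym)
  show "speed c t \<le> (SUP k. INF h\<in>?R k. ?q h)"
  proof (rule dense_le)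
    fix y assume "y < speed c t"
    then have "\<forall>\<^sub>F h in at_right 0. y < ?q h" by (rule speed_greaterD)
    then obtain d where d: "d > 0" "\<And>h. 0 < h \<Longrightarrow> h < d \<Longrightarrow> y < ?q h"
      by (auto simp: eventually_at_right_field)
    obtain k where "1 / real (Suc k) < d"
      using d(1) reals_Archimedean[of d] by (auto simp: inverse_eq_divide)
    then have "y \<le> (INF h\<in>?R k. ?q h)"
      using d by (intro INF_greatest less_imp_le) auto
    then show "y \<le> (SUP k. INF h\<in>?R k. ?q h)"
      by (rule order_trans) (rule SUP_upper, simp)
  qed
next
  show "(SUP k. INF h\<in>?R k. ?q h) \<le> speed c t"
  proof (rule SUP_least)
    fix k
    have "(INF h\<in>?R k. ?q h) \<le> ?q h" if h: "0 < h" "h < 1 / real (Suc k)" for h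
    proof (rule ccontr)
      assume "\<not> ?thesis"
      then have "?q h < (INF h\<in>?R k. ?q h)" by simp
      moreover have "((\<lambda>h. ?q h) \<longlongrightarrow> ?q h) (at h)"
      proof (intro tendsto_intros)
        have "isCont c (t + h)" using c by (simp add: continuous_on_eq_continuous_at)
        then have "isCont (\<lambda>h. c (t + h)) h"
          by (intro isCont_o2[of h "\<lambda>h. t + h" c]) auto
        then show "((\<lambda>h. c (t + h)) \<longlongrightarrow> c (t + h)) (at h)"
          by (simp add: isCont_def)
      qed (use h in auto)
      ultimately have "eventually (\<lambda>x. ?q x < (INF h\<in>?R k. ?q h)) (at h)"
        by (intro order_tendstoD(2))
      then obtain d where d: "d > 0" "\<And>x. x \<noteq> h \<Longrightarrow> dist x h < d \<Longrightarrow> ?q x < (INF h\<in>?R k. ?q h)"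
        by (auto simp: eventually_at)
      obtain r where r: "r \<in> \<rat>" "h < r" "r < min (h + d) (1 / real (Suc k))"
        using Rats_dense_in_real[of h "min (h + d) (1 / real (Suc k))"] h d by auto
      then have "?q r < (INF h\<in>?R k. ?q h)" using d(2)[of r] by (auto simp: dist_real_def)
      moreover have "(INF h\<in>?R k. ?q h) \<le> ?q r" using r h by (intro INF_lower) auto
      ultimately show False by simp
    qed
    moreover have "\<forall>\<^sub>F h in at_right 0. 0 < h \<and> h < 1 / real (Suc k)"
      by (auto simp: eventually_at_right_field intro!: exI[of _ "1 / real (Suc k)"])
    ultimately show "(INF h\<in>?R k. ?q h) \<le> speed c t"
      unfolding speed_def by (intro Liminf_bounded) (auto elim: eventually_mono)
  qed
qed

text \<open>Measurable in one variable and continuous in the other: time is rounded down to the grid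
  of mesh \<open>1 / (n + 1)\<close>, which gives countably many measurable pieces, and the rounding
  error tends to zero.\<close>

lemma measurable_evaluation_of_continuous:
  fixes X :: "'w \<Rightarrow> real \<Rightarrow> 'a::{metric_space, second_countable_topology}"
  assumes X: "\<And>t. (\<lambda>\<omega>. X \<omega> t) \<in> borel_measurable M"
    and c: "\<And>\<omega>. \<omega> \<in> space M \<Longrightarrow> continuous_on UNIV (X \<omega>)"
  shows "(\<lambda>(\<omega>, t). X \<omega> t) \<in> borel_measurable (M \<Otimes>\<^sub>M borel)"
proof (rule borel_measurable_LIMSEQ_metric)
  fix n :: nat
  show "(\<lambda>p. X (fst p) (of_int \<lfloor>real (Suc n) * snd p\<rfloor> / real (Suc n))) \<in> borel_measurable (M \<Otimes>\<^sub>M borel)"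
    by (rule measurable_compose_countable[of "\<lambda>i p. X (fst p) (of_int i / real (Suc n))"])
       (use measurable_compose[OF measurable_fst X] in measurable)
next
  fix p assume "p \<in> space (M \<Otimes>\<^sub>M (borel :: real measure))"
  then have "continuous_on UNIV (X (fst p))"
    by (intro c) (auto simp: space_pair_measure)
  then have "isCont (X (fst p)) (snd p)" by (simp add: continuous_on_eq_continuous_at)
  moreover have "(\<lambda>n. of_int \<lfloor>real (Suc n) * snd p\<rfloor> / real (Suc n)) \<longlonglongrightarrow> snd p"
  proof (rule LIMSEQ_norm_0[THEN LIM_zero_cancel])
    fix n :: nat
    have "\<bar>of_int \<lfloor>real (Suc n) * snd p\<rfloor> - real (Suc n) * snd p\<bar> < 1" by linarith
    moreover have "of_int \<lfloor>real (Suc n) * snd p\<rfloor> / real (Suc n) - snd p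
        = (of_int \<lfloor>real (Suc n) * snd p\<rfloor> - real (Suc n) * snd p) / real (Suc n)"
      by (simp add: field_simps)
    ultimately show "norm (of_int \<lfloor>real (Suc n) * snd p\<rfloor> / real (Suc n) - snd p) < 1 / real (Suc n)"
      by (simp add: abs_divide divide_strict_right_mono)
  qed
  ultimately show "(\<lambda>n. X (fst p) (of_int \<lfloor>real (Suc n) * snd p\<rfloor> / real (Suc n)))
      \<longlonglongrightarrow> (case p of (\<omega>, t) \<Rightarrow> X \<omega> t)"
    unfolding case_prod_beta by (rule isCont_tendsto_compose)
qed

lemma measurable_speed_of_continuous:
  fixes X :: "'w \<Rightarrow> real \<Rightarrow> 'a::{metric_space, second_countable_topology}"
  assumes X: "\<And>t. (\<lambda>\<omega>. X \<omega> t) \<in> borel_measurable M"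
    and c: "\<And>\<omega>. \<omega> \<in> space M \<Longrightarrow> continuous_on UNIV (X \<omega>)"
  shows "(\<lambda>(\<omega>, t). speed (X \<omega>) t) \<in> borel_measurable (M \<Otimes>\<^sub>M borel)"
proof -
  note [measurable] = measurable_evaluation_of_continuous[OF X c]
  have "countable {h\<in>\<rat>. 0 < h \<and> h < 1 / real (Suc k)}" for k
    by (rule countable_subset[OF _ countable_rat]) auto
  then have "(\<lambda>(\<omega>, t). SUP k::nat. INF h\<in>{h\<in>\<rat>. 0 < h \<and> h < 1 / real (Suc k)}.
      ennreal (dist (X \<omega> (t + h)) (X \<omega> t) / h)) \<in> borel_measurable (M \<Otimes>\<^sub>M borel)"
    by measurable
  then show ?thesis
    by (subst measurable_cong) (auto simp: space_pair_measure speed_eq_SUP_INF_Rats[OF c])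
qed

lemma borel_measurable_speed:
  fixes c :: "real \<Rightarrow> 'a::{metric_space, second_countable_topology}"
  assumes "continuous_on UNIV c"
  shows "speed c \<in> borel_measurable borel"
proof -
  have "(\<lambda>(\<omega>, t). speed c t) \<in> borel_measurable (count_space (UNIV :: unit set) \<Otimes>\<^sub>M borel)"
    using assms by (intro measurable_speed_of_continuous) auto
  from measurable_compose[OF _ this, of "\<lambda>t. ((), t)"] show ?thesis by simp
qed

text \<open>As soon as some integrable \<open>v\<close> bounds the increments, the speed does so
  too. By \<open>speed_le_of_bound\<close> it is then the least such bound up to null sets.\<close>

lemma dist_le_integral_speed:
  fixes c :: "real \<Rightarrow> 'a::{metric_space, second_countable_topology}"
  assumes c: "continuous_on UNIV c"
    and [measurable]: "v \<in> borel_measurable borel"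
    and vfin: "(\<integral>\<^sup>+r\<in>{a..b}. v r \<partial>lborel) < \<infinity>"
    and vb: "\<And>s t. a \<le> s \<Longrightarrow> s \<le> t \<Longrightarrow> t \<le> b \<Longrightarrow>
        ennreal (dist (c s) (c t)) \<le> (\<integral>\<^sup>+r\<in>{s..t}. v r \<partial>lborel)"
    and st: "a \<le> s" "s \<le> t" "t \<le> b"
  shows "ennreal (dist (c s) (c t)) \<le> (\<integral>\<^sup>+r\<in>{s..t}. speed c r \<partial>lborel)"
proof (rule dist_le_integral_of_speed_le[OF st(2) \<open>v \<in> borel_measurable borel\<close> borel_measurable_speed[OF c]])
  have "(\<integral>\<^sup>+r\<in>{s..t}. v r \<partial>lborel) \<le> (\<integral>\<^sup>+r\<in>{a..b}. v r \<partial>lborel)"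
    using st by (intro nn_integral_Icc_mono_set) auto
  with vfin show "(\<integral>\<^sup>+r\<in>{s..t}. v r \<partial>lborel) < \<infinity>" by (rule le_less_trans[rotated])
qed (use st vb in auto)

text \<open>Reversing time turns left quotients of \<open>c\<close> into right quotients of
  \<open>c'\<close>. The reflected speed of each curve is a bound for the other one, so minimality
  compares the two speeds. On either side the quotients are eventually bounded above by the speed
  plus any error and, by the lower limit, below; hence both one-sided limits exist and
  agree.\<close>

lemma metric_deriv_eq_speed:
  fixes c :: "real \<Rightarrow> 'a::{metric_space, second_countable_topology}"
  assumes c: "continuous_on UNIV c"
    and [measurable]: "v \<in> borel_measurable borel"
    and vfin: "(\<integral>\<^sup>+r\<in>{0..1}. v r \<partial>lborel) < \<infinity>"
    and vb: "\<And>s t. 0 \<le> s \<Longrightarrow> s \<le> t \<Longrightarrow> t \<le> 1 \<Longrightarrow>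
        ennreal (dist (c s) (c t)) \<le> (\<integral>\<^sup>+r\<in>{s..t}. v r \<partial>lborel)"
  shows "AE t in lborel. 0 < t \<and> t < 1 \<longrightarrow>
      0 \<le> metric_deriv c t \<and> ennreal (metric_deriv c t) = speed c t"
proof -
  note [measurable] = borel_measurable_speed[OF c]
  have fin: "(\<integral>\<^sup>+r\<in>{0..1}. speed c r \<partial>lborel) < \<infinity>"
  proof -
    have "AE t in lborel. 0 < t \<and> t < 1 \<longrightarrow> speed c t \<le> v t"
      using vfin vb by (intro speed_le_of_bound) auto
    then have "(\<integral>\<^sup>+r\<in>{0..1}. speed c r \<partial>lborel) \<le> (\<integral>\<^sup>+r\<in>{0..1}. v r \<partial>lborel)"
      using AE_lborel_singleton[of 0] AE_lborel_singleton[of 1]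
      by (intro nn_integral_mono_AE, eventually_elim) (auto simp: indicator_def)
    with vfin show ?thesis by simp
  qed
  have db: "ennreal (dist (c s) (c t)) \<le> (\<integral>\<^sup>+r\<in>{s..t}. speed c r \<partial>lborel)"
    if "0 \<le> s" "s \<le> t" "t \<le> 1" for s t
    by (rule dist_le_integral_speed[OF c \<open>v \<in> borel_measurable borel\<close> vfin vb that])
  define c' where "c' t = c (1 - t)" for t
  have cc: "c' (1 - r) = c r" for r by (simp add: c'_def)
  have c': "continuous_on UNIV c'"
    unfolding c'_def by (intro continuous_on_compose2[OF c] continuous_intros) auto
  note [measurable] = borel_measurable_speed[OF c']
  \<comment> \<open>\<open>u\<close> is the speed of \<open>c\<close> used as a bound for the
    reversed curve, and \<open>l\<close> the speed of the reversed curve used as a bound for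
    \<open>c\<close>.\<close>
  define u where "u t = speed c (1 - t)" for t
  define l where "l t = speed c' (1 - t)" for t
  have [measurable]: "u \<in> borel_measurable borel" "l \<in> borel_measurable borel"
    unfolding u_def l_def by measurable
  have ufin: "(\<integral>\<^sup>+r\<in>{0..1}. u r \<partial>lborel) < \<infinity>"
    unfolding u_def using nn_integral_Icc_reflect[of "speed c" 0 1] fin by simp
  have ub: "ennreal (dist (c' s) (c' t)) \<le> (\<integral>\<^sup>+r\<in>{s..t}. u r \<partial>lborel)"
    if "0 \<le> s" "s \<le> t" "t \<le> 1" for s t
    unfolding u_def c'_def using nn_integral_Icc_reflect[of "speed c" s t] db[of "1 - t" "1 - s"] that
    by (simp add: dist_commute)
  have lb: "ennreal (dist (c s) (c t)) \<le> (\<integral>\<^sup>+r\<in>{s..t}. l r \<partial>lborel)"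
    if "0 \<le> s" "s \<le> t" "t \<le> 1" for s t
    using dist_le_integral_speed[OF c' \<open>u \<in> borel_measurable borel\<close> ufin ub, of "1 - t" "1 - s"] that
      nn_integral_Icc_reflect[of "speed c'" s t]
    by (simp add: l_def dist_commute cc)
  have lfin: "(\<integral>\<^sup>+r\<in>{0..1}. l r \<partial>lborel) < \<infinity>"
  proof -
    have AEu: "AE t in lborel. 0 < t \<and> t < 1 \<longrightarrow> speed c' t \<le> u t"
      using ufin ub by (intro speed_le_of_bound) auto
    have "(\<integral>\<^sup>+r\<in>{0..1}. l r \<partial>lborel) = (\<integral>\<^sup>+r\<in>{0..1}. speed c' r \<partial>lborel)"
      unfolding l_def using nn_integral_Icc_reflect[of "speed c'" 0 1] by simp
    also have "\<dots> \<le> (\<integral>\<^sup>+r\<in>{0..1}. u r \<partial>lborel)"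
      using AEu AE_lborel_singleton[of 0] AE_lborel_singleton[of 1]
      by (intro nn_integral_mono_AE, eventually_elim) (auto simp: indicator_def)
    finally show ?thesis using ufin by simp
  qed
  have "AE t in lborel. 0 < t \<and> t < 1 \<longrightarrow> speed c t < \<infinity> \<and>
      (\<forall>e>0. \<forall>\<^sub>F h in at_right 0. ennreal (dist (c (t + h)) (c t) / h) \<le> speed c t + ennreal e)"
    using fin db by (intro eventually_quotient_le) auto
  moreover have "AE t in lborel. 0 < t \<and> t < 1 \<longrightarrow> speed c t \<le> l t"
    using lfin lb by (intro speed_le_of_bound) auto
  moreover have uq: "AE t in lborel. 0 < t \<and> t < 1 \<longrightarrow> u t < \<infinity> \<and>
      (\<forall>e>0. \<forall>\<^sub>F h in at_right 0. ennreal (dist (c' (t + h)) (c' t) / h) \<le> u t + ennreal e)"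
    using ufin ub by (intro eventually_quotient_le) auto
  moreover have "AE t in lborel. 0 < 1 - t \<and> 1 - t < 1 \<longrightarrow> u (1 - t) < \<infinity> \<and>
      (\<forall>e>0. \<forall>\<^sub>F h in at_right 0. ennreal (dist (c' (1 - t + h)) (c' (1 - t)) / h) \<le> u (1 - t) + ennreal e)"
    using AE_lborel_affine[OF uq, of "-1" 1]
    by simp
  ultimately show ?thesis
  proof eventually_elim
    case (elim t)
    note elim = elim(1,2,4)
    show ?case
    proof
      assume t: "0 < t \<and> t < 1"
      define x where "x = enn2real (speed c t)"
      have sx: "speed c t = ennreal x" using elim(1) t by (simp add: x_def less_top)
      have x0: "x \<ge> 0" by (simp add: x_def)
      have R: "((\<lambda>h. dist (c (t + h)) (c t) / h) \<longlongrightarrow> x) (at_right 0)"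
      proof (rule order_tendstoI)
        fix y assume "y < x"
        show "\<forall>\<^sub>F h in at_right 0. y < dist (c (t + h)) (c t) / h"
        proof (cases "y < 0")
          case True
          then show ?thesis
            by (intro eventually_mono[OF eventually_at_right_less[of 0]]) (auto intro: less_le_trans)
        next
          case False
          then have "ennreal y < speed c t" using \<open>y < x\<close> sx by (simp add: ennreal_lessI)
          from speed_greaterD[OF this] eventually_at_right_less[of 0] show ?thesis
            by eventually_elim (use False in \<open>simp add: ennreal_less_iff\<close>)
        qed
      next
        fix y assume "y > x"
        then have "\<forall>\<^sub>F h in at_right 0. ennreal (dist (c (t + h)) (c t) / h) \<le> speed c t + ennreal ((y - x) / 2)"
          using elim(1) t by simp
        with eventually_at_right_less[of 0] show "\<forall>\<^sub>F h in at_right 0. dist (c (t + h)) (c t) / h < y"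
        proof eventually_elim
          case (elim h)
          then have "dist (c (t + h)) (c t) / h \<le> x + (y - x) / 2"
            using x0 \<open>y > x\<close> unfolding sx by (simp add: ennreal_plus[symmetric] del: ennreal_plus)
          then show ?case using \<open>y > x\<close> by (simp add: field_simps)
        qed
      qed
      have L: "((\<lambda>h. dist (c (t - h)) (c t) / h) \<longlongrightarrow> x) (at_right 0)"
      proof (rule order_tendstoI)
        fix y assume "y < x"
        show "\<forall>\<^sub>F h in at_right 0. y < dist (c (t - h)) (c t) / h"
        proof (cases "y < 0")
          case True
          then show ?thesis
            by (intro eventually_mono[OF eventually_at_right_less[of 0]]) (auto intro: less_le_trans)
        next
          case False
          have "ennreal y < speed c t" using \<open>y < x\<close> sx False by (simp add: ennreal_lessI)
          also have "speed c t \<le> speed c' (1 - t)" using elim(2) t by (simp add: l_def)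
          finally have "ennreal y < speed c' (1 - t)" .
          from speed_greaterD[OF this] eventually_at_right_less[of 0] show ?thesis
            by eventually_elim (use False in \<open>simp add: ennreal_less_iff c'_def\<close>)
        qed
      next
        fix y assume "y > x"
        then have "\<forall>\<^sub>F h in at_right 0. ennreal (dist (c' (1 - t + h)) (c' (1 - t)) / h) \<le> u (1 - t) + ennreal ((y - x) / 2)"
          using elim(3) t by simp
        with eventually_at_right_less[of 0] show "\<forall>\<^sub>F h in at_right 0. dist (c (t - h)) (c t) / h < y"
        proof eventually_elim
          case (elim h)
          then have "dist (c (t - h)) (c t) / h \<le> x + (y - x) / 2"
            using x0 \<open>y > x\<close> by (simp add: u_def c'_def sx ennreal_plus[symmetric] del: ennreal_plus)
          then show ?case using \<open>y > x\<close> by (simp add: field_simps)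
        qed
      qed
      have "((\<lambda>s. dist (c s) (c t) / \<bar>s - t\<bar>) \<longlongrightarrow> x) (at_right t)"
        unfolding filterlim_at_right_to_0[of _ _ t]
        by (rule Lim_transform_eventually[OF R], rule eventually_mono[OF eventually_at_right_less[of 0]])
           (simp add: add.commute)
      moreover have "((\<lambda>s. dist (c s) (c t) / \<bar>s - t\<bar>) \<longlongrightarrow> x) (at_left t)"
        unfolding filterlim_at_left_to_right filterlim_at_right_to_0[of _ _ "-t"]
        by (rule Lim_transform_eventually[OF L], rule eventually_mono[OF eventually_at_right_less[of 0]])
           (simp add: add.commute)
      ultimately have "((\<lambda>s. dist (c s) (c t) / \<bar>s - t\<bar>) \<longlongrightarrow> x) (at t)"
        by (simp add: filterlim_split_at)
      then have "((\<lambda>s. dist (c s) (c t) / \<bar>s - t\<bar>) \<longlongrightarrow> x) (at t within {0..1})"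
        by (rule tendsto_mono[rotated]) (simp add: at_le)
      moreover have "at t within {0..1} \<noteq> bot"
        using t by (simp add: trivial_limit_within islimpt_Icc)
      ultimately have "metric_deriv c t = x"
        unfolding metric_deriv_def by (intro tendsto_Lim)
      then show "0 \<le> metric_deriv c t \<and> ennreal (metric_deriv c t) = speed c t" by (simp add: sx x0)
    qed
  qed
qed

section \<open>Test plans in terms of the metric speed\<close>

text \<open>The affine relation is asked for small increments only, since a subcurve is affinely
  reparametrized just until it reaches its end. This direction bounds line integrals and energies of
  subcurves from above.\<close>

lemma speed_affine_le:
  assumes k: "k > 0" and c': "\<forall>\<^sub>F h in at_right 0. c' (r + h) = c (x + k * h)" "c' r = c x"
  shows "speed c' r \<le> ennreal k * speed c x"
proof (cases "speed c x = \<infinity>")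
  case True
  then show ?thesis using k by (simp add: ennreal_mult_top)
next
  case False
  show ?thesis
  proof (rule ennreal_le_epsilon)
    fix e :: real assume e: "e > 0"
    show "speed c' r \<le> ennreal k * speed c x + ennreal e"
    proof (rule ccontr)
      assume "\<not> ?thesis"
      then have "\<forall>\<^sub>F h in at_right 0. ennreal k * speed c x + ennreal e < ennreal (dist (c' (r + h)) (c' r) / h)"
        by (intro speed_greaterD) auto
      with c'(1) eventually_at_right_less[of 0]
      have ev: "\<forall>\<^sub>F h in at_right 0. ennreal k * speed c x + ennreal e < ennreal k * ennreal (dist (c (x + k * h)) (c x) / (k * h))"
      proof eventually_elim
        case (elim h)
        then show ?case using k c'(2) by (simp add: ennreal_mult[symmetric])
      qed
      have "speed c x + 0 < speed c x + ennreal (e / k)"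
        using False k e by (subst ennreal_add_left_cancel_less) (auto simp: top_unique)
      then have "speed c x < speed c x + ennreal (e / k)" by (simp only: add_0_right)
      from speed_lessD[OF this]
      have "\<exists>\<^sub>F h in filtermap (times k) (at_right 0). ennreal (dist (c (x + h)) (c x) / h) < speed c x + ennreal (e / k)"
        using filtermap_times_pos_at_right[OF k, of 0] by simp
      then have "\<exists>\<^sub>F h in at_right 0. ennreal (dist (c (x + k * h)) (c x) / (k * h)) < speed c x + ennreal (e / k)"
        by (simp add: frequently_def eventually_filtermap)
      from frequently_ex[OF frequently_eventually_frequently[OF this ev]]
      obtain h where h: "ennreal (dist (c (x + k * h)) (c x) / (k * h)) < speed c x + ennreal (e / k)"
        "ennreal k * speed c x + ennreal e < ennreal k * ennreal (dist (c (x + k * h)) (c x) / (k * h))" by blast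
      have "ennreal k * ennreal (dist (c (x + k * h)) (c x) / (k * h)) \<le> ennreal k * (speed c x + ennreal (e / k))"
        using h(1) by (intro mult_left_mono) auto
      also have "\<dots> = ennreal k * speed c x + ennreal e"
        using k e by (simp add: distrib_left ennreal_mult[symmetric])
      finally show False using h(2) by simp
    qed
  qed
qed

text \<open>Written with \<open>speed\<close> instead of \<open>metric_deriv\<close> for the sake of
  measurability; \<open>weak_upper_gradient_iff\<close> shows that the notion of weak upper gradient
  is the same.\<close>

definition line_int :: "('a::metric_space \<Rightarrow> ennreal) \<Rightarrow> (real \<Rightarrow> 'a) \<Rightarrow> real \<Rightarrow> real \<Rightarrow> ennreal" where
  "line_int G c s t = (\<integral>\<^sup>+r\<in>{s..t}. G (c r) * speed c r \<partial>lborel)"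

definition energy :: "(real \<Rightarrow> 'a::metric_space) \<Rightarrow> ennreal" where
  "energy c = (\<integral>\<^sup>+r\<in>{0..1}. (speed c r)\<^sup>2 \<partial>lborel)"

abbreviation curve_space :: "(real \<Rightarrow>\<^sub>C 'a::metric_space) measure" where
  "curve_space \<equiv> restrict_space borel curves"

section \<open>Measurability on the space of curves\<close>

lemma continuous_on_bcontfun: "continuous_on A (apply_bcontfun \<gamma>)"
  using apply_bcontfun[of \<gamma>] by (auto simp: bcontfun_def intro: continuous_on_subset)

lemma measurable_curve_eval:
  fixes \<pi> :: "(real \<Rightarrow>\<^sub>C 'a::metric_space) measure"
  assumes "sets \<pi> = sets curve_space"
  shows "(\<lambda>\<gamma>. apply_bcontfun \<gamma> t) \<in> borel_measurable \<pi>"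
proof -
  have "continuous_on UNIV (\<lambda>\<gamma> :: real \<Rightarrow>\<^sub>C 'a. apply_bcontfun \<gamma> t)"
    unfolding continuous_on_iff using dist_bounded le_less_trans by blast
  then have "(\<lambda>\<gamma> :: real \<Rightarrow>\<^sub>C 'a. apply_bcontfun \<gamma> t) \<in> borel_measurable borel"
    by (rule borel_measurable_continuous_onI)
  then show ?thesis
    unfolding measurable_cong_sets[OF assms refl] by (rule measurable_restrict_space1)
qed

lemma
  fixes \<pi> :: "(real \<Rightarrow>\<^sub>C 'a::{metric_space, second_countable_topology}) measure"
  assumes "sets \<pi> = sets curve_space"
  shows measurable_curve_eval_pair:
      "(\<lambda>p. apply_bcontfun (fst p) (snd p)) \<in> borel_measurable (\<pi> \<Otimes>\<^sub>M lborel)"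
    and measurable_speed_pair:
      "(\<lambda>p. speed (apply_bcontfun (fst p)) (snd p)) \<in> borel_measurable (\<pi> \<Otimes>\<^sub>M lborel)"
proof -
  have *: "borel_measurable (\<pi> \<Otimes>\<^sub>M lborel) = borel_measurable (\<pi> \<Otimes>\<^sub>M borel)"
    by (intro measurable_cong_sets sets_pair_measure_cong) auto
  show "(\<lambda>p. apply_bcontfun (fst p) (snd p)) \<in> borel_measurable (\<pi> \<Otimes>\<^sub>M lborel)"
    unfolding * using measurable_evaluation_of_continuous[OF measurable_curve_eval[OF assms] continuous_on_bcontfun]
    by (simp add: case_prod_beta')
  show "(\<lambda>p. speed (apply_bcontfun (fst p)) (snd p)) \<in> borel_measurable (\<pi> \<Otimes>\<^sub>M lborel)"
    unfolding * using measurable_speed_of_continuous[OF measurable_curve_eval[OF assms] continuous_on_bcontfun]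
    by (simp add: case_prod_beta')
qed

text \<open>The limits of integration may vary with the curve and the time: Fubini will be applied
  to increments between a fixed time and a variable one.\<close>

lemma measurable_line_int_pair:
  fixes \<pi> :: "(real \<Rightarrow>\<^sub>C 'a::{metric_space, second_countable_topology}) measure"
  assumes \<pi>: "sets \<pi> = sets curve_space" and [measurable]: "G \<in> borel_measurable borel"
    and [measurable]: "a \<in> borel_measurable (\<pi> \<Otimes>\<^sub>M lborel)" "b \<in> borel_measurable (\<pi> \<Otimes>\<^sub>M lborel)"
  shows "(\<lambda>p. line_int G (apply_bcontfun (fst p)) (a p) (b p)) \<in> borel_measurable (\<pi> \<Otimes>\<^sub>M lborel)"
proof -
  note [measurable] = measurable_curve_eval_pair[OF \<pi>] measurable_speed_pair[OF \<pi>]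
  have [measurable]: "(\<lambda>x. apply_bcontfun (fst (fst x)) (snd x)) \<in> borel_measurable ((\<pi> \<Otimes>\<^sub>M lborel) \<Otimes>\<^sub>M lborel)"
    by (rule measurable_compose[of "\<lambda>x. (fst (fst x), snd x)" _ "\<pi> \<Otimes>\<^sub>M lborel" "\<lambda>p. apply_bcontfun (fst p) (snd p)", simplified]) measurable
  have [measurable]: "(\<lambda>x. speed (apply_bcontfun (fst (fst x))) (snd x)) \<in> borel_measurable ((\<pi> \<Otimes>\<^sub>M lborel) \<Otimes>\<^sub>M lborel)"
    by (rule measurable_compose[of "\<lambda>x. (fst (fst x), snd x)" _ "\<pi> \<Otimes>\<^sub>M lborel" "\<lambda>p. speed (apply_bcontfun (fst p)) (snd p)", simplified]) measurable
  have "(\<lambda>p. \<integral>\<^sup>+r. G (apply_bcontfun (fst p) r) * speed (apply_bcontfun (fst p)) r * (if a p \<le> r \<and> r \<le> b p then 1 else 0) \<partial>lborel)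
      \<in> borel_measurable (\<pi> \<Otimes>\<^sub>M lborel)"
    by (intro lborel.borel_measurable_nn_integral) (simp add: case_prod_beta', measurable)
  moreover have "line_int G (apply_bcontfun (fst p)) (a p) (b p)
      = (\<integral>\<^sup>+r. G (apply_bcontfun (fst p) r) * speed (apply_bcontfun (fst p)) r * (if a p \<le> r \<and> r \<le> b p then 1 else 0) \<partial>lborel)" for p
    unfolding line_int_def by (intro nn_integral_cong) (simp add: indicator_def)
  ultimately show ?thesis by simp
qed

lemma
  fixes \<pi> :: "(real \<Rightarrow>\<^sub>C 'a::{metric_space, second_countable_topology}) measure"
  assumes \<pi>: "sets \<pi> = sets curve_space"
  shows measurable_line_int: "G \<in> borel_measurable borel \<Longrightarrow>
        (\<lambda>\<gamma>. line_int G (apply_bcontfun \<gamma>) s t) \<in> borel_measurable \<pi>"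
    and measurable_energy: "(\<lambda>\<gamma>. energy (apply_bcontfun \<gamma>)) \<in> borel_measurable \<pi>"
proof -
  note [measurable] = measurable_curve_eval_pair[OF \<pi>] measurable_speed_pair[OF \<pi>]
  { assume [measurable]: "G \<in> borel_measurable borel"
    show "(\<lambda>\<gamma>. line_int G (apply_bcontfun \<gamma>) s t) \<in> borel_measurable \<pi>"
      unfolding line_int_def
      by (intro lborel.borel_measurable_nn_integral) (simp add: case_prod_beta', measurable) }
  show "(\<lambda>\<gamma>. energy (apply_bcontfun \<gamma>)) \<in> borel_measurable \<pi>"
    unfolding energy_def
    by (intro lborel.borel_measurable_nn_integral) (simp add: case_prod_beta', measurable)
qed

lemma measurable_line_int_integrand:
  fixes \<gamma> :: "real \<Rightarrow>\<^sub>C 'a::{metric_space, second_countable_topology}"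
  assumes [measurable]: "G \<in> borel_measurable borel"
  shows "(\<lambda>r. G (apply_bcontfun \<gamma> r) * speed (apply_bcontfun \<gamma>) r) \<in> borel_measurable borel"
proof -
  have [measurable]: "apply_bcontfun \<gamma> \<in> borel_measurable borel"
    by (intro borel_measurable_continuous_onI continuous_on_bcontfun)
  have [measurable]: "speed (apply_bcontfun \<gamma>) \<in> borel_measurable borel"
    by (intro borel_measurable_speed continuous_on_bcontfun)
  show ?thesis by measurable
qed

text \<open>Membership in \<open>AC2\<close> with the canonical bound \<open>speed\<close> in place
  of an arbitrary one, and with rational times, so that the condition is countable and defines a
  measurable set of curves.\<close>

definition regular_curve :: "(real \<Rightarrow> 'a::metric_space) \<Rightarrow> bool" where
  "regular_curve c \<longleftrightarrow> energy c < \<infinity> \<and> (\<forall>s\<in>\<rat>. \<forall>t\<in>\<rat>. 0 \<le> s \<longrightarrow> s \<le> t \<longrightarrow> t \<le> 1 \<longrightarrow>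
      ennreal (dist (c s) (c t)) \<le> (\<integral>\<^sup>+r\<in>{s..t}. speed c r \<partial>lborel))"

text \<open>By \<open>x \<le> 1 + x^2\<close> on an interval of length one.\<close>

lemma nn_integral_le_of_square:
  fixes v :: "real \<Rightarrow> ennreal"
  assumes [measurable]: "v \<in> borel_measurable borel" and "(\<integral>\<^sup>+t\<in>{0..1}. (v t)\<^sup>2 \<partial>lborel) < \<infinity>"
  shows "(\<integral>\<^sup>+t\<in>{0..1}. v t \<partial>lborel) < \<infinity>"
proof -
  have le: "x \<le> 1 + x\<^sup>2" for x :: ennreal
  proof (cases "x \<le> 1")
    case False
    then have "x * 1 \<le> x * x" by (intro mult_left_mono) auto
    also have "\<dots> \<le> 1 + x\<^sup>2" by (simp add: power2_eq_square)
    finally show ?thesis by simp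
  qed (auto intro: order_trans)
  have "(\<integral>\<^sup>+t\<in>{0..1}. v t \<partial>lborel) \<le> (\<integral>\<^sup>+t. indicator {0..1} t + (v t)\<^sup>2 * indicator {0..1} t \<partial>lborel)"
    by (intro nn_integral_mono) (use le in \<open>auto simp: indicator_def\<close>)
  also have "\<dots> = 1 + (\<integral>\<^sup>+t\<in>{0..1}. (v t)\<^sup>2 \<partial>lborel)"
    by (subst nn_integral_add) auto
  also have "\<dots> < \<infinity>" using assms by (simp add: less_top)
  finally show ?thesis .
qed

lemma regular_curve_dist_le:
  fixes c :: "real \<Rightarrow> 'a::{metric_space, second_countable_topology}"
  assumes reg: "regular_curve c" and c: "continuous_on UNIV c" and st: "0 \<le> s" "s \<le> t" "t \<le> 1"
  shows "ennreal (dist (c s) (c t)) \<le> (\<integral>\<^sup>+r\<in>{s..t}. speed c r \<partial>lborel)"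
proof (cases "s = t")
  case False
  with st have st': "s < t" by simp
  show ?thesis
  proof (rule ennreal_le_epsilon)
    fix e :: real assume e: "e > 0"
    have "isCont c s" "isCont c t" using c by (auto simp: continuous_on_eq_continuous_at)
    then have "\<exists>d>0. \<forall>x. dist x s < d \<longrightarrow> dist (c x) (c s) < e / 2"
      "\<exists>d>0. \<forall>x. dist x t < d \<longrightarrow> dist (c x) (c t) < e / 2"
      using half_gt_zero[OF e] unfolding continuous_at_eps_delta by blast+
    then obtain d1 d2 where d: "d1 > 0" "\<And>x. dist x s < d1 \<Longrightarrow> dist (c x) (c s) < e / 2"
      "d2 > 0" "\<And>x. dist x t < d2 \<Longrightarrow> dist (c x) (c t) < e / 2"
      by blast
    \<comment> \<open>The rational times are taken inside the interval, one on each side of the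
      midpoint, so they stay ordered and the integral between them is at most the one from
      \<open>s\<close> to \<open>t\<close>.\<close>
    obtain s' where s': "s' \<in> \<rat>" "s < s'" "s' < min (s + d1) ((s + t) / 2)"
      using Rats_dense_in_real[of s "min (s + d1) ((s + t) / 2)"] d st' by auto
    obtain t' where t': "t' \<in> \<rat>" "t' < t" "max (t - d2) ((s + t) / 2) < t'"
      using Rats_dense_in_real[of "max (t - d2) ((s + t) / 2)" t] d st' by auto
    have "dist (c s') (c s) < e / 2" "dist (c t') (c t) < e / 2"
      using s' t' d(2)[of s'] d(4)[of t'] by (auto simp: dist_real_def)
    then have "dist (c s) (c t) \<le> dist (c s') (c t') + e"
      using dist_triangle[of "c s" "c t" "c s'"] dist_triangle[of "c s'" "c t" "c t'"]
      by (simp add: dist_commute)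
    then have "ennreal (dist (c s) (c t)) \<le> ennreal (dist (c s') (c t')) + ennreal e"
      using e by (simp add: ennreal_plus[symmetric] ennreal_leI del: ennreal_plus)
    also have "ennreal (dist (c s') (c t')) \<le> (\<integral>\<^sup>+r\<in>{s'..t'}. speed c r \<partial>lborel)"
      using reg s' t' st unfolding regular_curve_def by auto
    also have "\<dots> \<le> (\<integral>\<^sup>+r\<in>{s..t}. speed c r \<partial>lborel)"
      using s' t' by (intro nn_integral_Icc_mono_set) auto
    finally show "ennreal (dist (c s) (c t)) \<le> (\<integral>\<^sup>+r\<in>{s..t}. speed c r \<partial>lborel) + ennreal e"
      by simp
  qed
qed simp

text \<open>Any bound admissible for \<open>AC2\<close> dominates the speed almost everywhere, which
  makes the energy finite; conversely the speed is itself an admissible bound.\<close>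

lemma AC2_iff_regular_curve:
  fixes c :: "real \<Rightarrow> 'a::{metric_space, second_countable_topology}"
  assumes c: "continuous_on UNIV c"
  shows "c \<in> AC2 \<longleftrightarrow> regular_curve c"
proof
  assume "regular_curve c"
  then show "c \<in> AC2"
    unfolding AC2_def mem_Collect_eq using borel_measurable_speed[OF c] regular_curve_dist_le[OF _ c]
    by (intro exI[of _ "speed c"]) (auto simp: regular_curve_def energy_def)
next
  assume "c \<in> AC2"
  then obtain v where v[measurable]: "v \<in> borel_measurable borel"
    and v2: "(\<integral>\<^sup>+t\<in>{0..1}. (v t)\<^sup>2 \<partial>lborel) < \<infinity>"
    and vb: "\<And>s t. 0 \<le> s \<Longrightarrow> s \<le> t \<Longrightarrow> t \<le> 1 \<Longrightarrow> ennreal (dist (c s) (c t)) \<le> (\<integral>\<^sup>+r\<in>{s..t}. v r \<partial>lborel)"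
    unfolding AC2_def by auto
  have vfin: "(\<integral>\<^sup>+t\<in>{0..1}. v t \<partial>lborel) < \<infinity>"
    using v v2 by (rule nn_integral_le_of_square)
  have "AE t in lborel. 0 < t \<and> t < 1 \<longrightarrow> speed c t \<le> v t"
    using vfin vb by (intro speed_le_of_bound) auto
  then have "energy c \<le> (\<integral>\<^sup>+t\<in>{0..1}. (v t)\<^sup>2 \<partial>lborel)"
    unfolding energy_def using AE_lborel_singleton[of 0] AE_lborel_singleton[of 1]
    by (intro nn_integral_mono_AE, eventually_elim) (auto simp: indicator_def intro: power_mono)
  then have "energy c < \<infinity>" using v2 by (rule le_less_trans)
  moreover have "ennreal (dist (c s) (c t)) \<le> (\<integral>\<^sup>+r\<in>{s..t}. speed c r \<partial>lborel)"
    if "0 \<le> s" "s \<le> t" "t \<le> 1" for s t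
    by (rule dist_le_integral_speed[OF c v vfin]) (use vb that in auto)
  ultimately show "regular_curve c" by (auto simp: regular_curve_def)
qed

lemma regular_curve_metric_deriv:
  fixes c :: "real \<Rightarrow> 'a::{metric_space, second_countable_topology}"
  assumes c: "continuous_on UNIV c" and reg: "regular_curve c"
  shows "AE t in lborel. t \<in> {0..1} \<longrightarrow> 0 \<le> metric_deriv c t \<and> ennreal (metric_deriv c t) = speed c t"
proof -
  have "(\<integral>\<^sup>+t\<in>{0..1}. speed c t \<partial>lborel) < \<infinity>"
    by (rule nn_integral_le_of_square[OF borel_measurable_speed[OF c]])
       (use reg in \<open>simp add: regular_curve_def energy_def\<close>)
  then have "AE t in lborel. 0 < t \<and> t < 1 \<longrightarrow> 0 \<le> metric_deriv c t \<and> ennreal (metric_deriv c t) = speed c t"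
    using regular_curve_dist_le[OF reg c] borel_measurable_speed[OF c] by (intro metric_deriv_eq_speed[where v = "speed c"] c) auto
  then show ?thesis
    using AE_lborel_singleton[of 0] AE_lborel_singleton[of 1] by eventually_elim auto
qed

text \<open>An almost-everywhere statement passes to an image measure through a measurable
  condition; this is used for plans restricted to subintervals.\<close>

lemma sets_regular_curve:
  fixes \<pi> :: "(real \<Rightarrow>\<^sub>C 'a::{metric_space, second_countable_topology}) measure"
  assumes \<pi>: "sets \<pi> = sets curve_space"
  shows "{\<gamma> \<in> space \<pi>. regular_curve (apply_bcontfun \<gamma>)} \<in> sets \<pi>"
proof -
  note [measurable] = measurable_energy[OF \<pi>] measurable_curve_eval[OF \<pi>]
  have [measurable]: "(\<lambda>\<gamma>. \<integral>\<^sup>+r\<in>{s..t}. speed (apply_bcontfun \<gamma>) r \<partial>lborel) \<in> borel_measurable \<pi>" for s t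
    using measurable_line_int[OF \<pi>, of "\<lambda>_. 1" s t] by (simp add: line_int_def)
  have [measurable]: "Measurable.pred \<pi> (\<lambda>\<gamma>. \<forall>p q :: rat. 0 \<le> p \<longrightarrow> p \<le> q \<longrightarrow> q \<le> 1 \<longrightarrow>
      ennreal (dist (apply_bcontfun \<gamma> (of_rat p)) (apply_bcontfun \<gamma> (of_rat q)))
        \<le> (\<integral>\<^sup>+r\<in>{of_rat p..of_rat q}. speed (apply_bcontfun \<gamma>) r \<partial>lborel))"
    by measurable
  have eq: "regular_curve (apply_bcontfun \<gamma>) \<longleftrightarrow> energy (apply_bcontfun \<gamma>) < \<infinity> \<and>
      (\<forall>p q :: rat. 0 \<le> p \<longrightarrow> p \<le> q \<longrightarrow> q \<le> 1 \<longrightarrow>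
      ennreal (dist (apply_bcontfun \<gamma> (of_rat p)) (apply_bcontfun \<gamma> (of_rat q)))
        \<le> (\<integral>\<^sup>+r\<in>{of_rat p..of_rat q}. speed (apply_bcontfun \<gamma>) r \<partial>lborel))" for \<gamma>
    unfolding regular_curve_def Rats_def ball_simps
    by (simp add: of_rat_less_eq)
  show ?thesis unfolding eq by measurable
qed

lemma test_plan_iff:
  fixes \<pi> :: "(real \<Rightarrow>\<^sub>C 'a::{metric_space, second_countable_topology}) measure"
  shows "test_plan n \<pi> \<longleftrightarrow> sets \<pi> = sets curve_space \<and> prob_space \<pi> \<and>
     (AE \<gamma> in \<pi>. regular_curve (apply_bcontfun \<gamma>)) \<and>
     (\<integral>\<^sup>+\<gamma>. energy (apply_bcontfun \<gamma>) \<partial>\<pi>) < \<infinity> \<and>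
     (\<exists>C::real. C \<ge> 0 \<and> (\<forall>t\<in>{0..1}. \<forall>A\<in>sets borel.
        emeasure \<pi> {\<gamma> \<in> space \<pi>. apply_bcontfun \<gamma> t \<in> A} \<le> ennreal C * emeasure n A))"
proof (cases "sets \<pi> = sets curve_space")
  case True
  have 1: "(AE \<gamma> in \<pi>. apply_bcontfun \<gamma> \<in> AC2) \<longleftrightarrow> (AE \<gamma> in \<pi>. regular_curve (apply_bcontfun \<gamma>))"
    by (simp add: AC2_iff_regular_curve[OF continuous_on_bcontfun])
  have 2: "(\<integral>\<^sup>+\<gamma>. (\<integral>\<^sup>+t\<in>{0..1}. ennreal ((metric_deriv (apply_bcontfun \<gamma>) t)\<^sup>2) \<partial>lborel) \<partial>\<pi>)
      = (\<integral>\<^sup>+\<gamma>. energy (apply_bcontfun \<gamma>) \<partial>\<pi>)" if "AE \<gamma> in \<pi>. regular_curve (apply_bcontfun \<gamma>)"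
  proof (intro nn_integral_cong_AE, use that in eventually_elim)
    case (elim \<gamma>)
    show ?case
      unfolding energy_def using regular_curve_metric_deriv[OF continuous_on_bcontfun elim]
      by (intro nn_integral_cong_AE, eventually_elim)
         (auto simp: indicator_def ennreal_power[symmetric] simp del: ennreal_power)
  qed
  have 3: "emeasure (distr \<pi> borel (\<lambda>\<gamma>. apply_bcontfun \<gamma> t)) A = emeasure \<pi> {\<gamma> \<in> space \<pi>. apply_bcontfun \<gamma> t \<in> A}"
    if "A \<in> sets borel" for A t
    using that measurable_curve_eval[OF True]
    by (subst emeasure_distr) (auto intro!: arg_cong[where f="emeasure \<pi>"])
  show ?thesis
    unfolding test_plan_def 1 using True 2 3 by (auto cong: conj_cong)
qed (auto simp: test_plan_def)

lemma weak_upper_gradient_iff: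
  fixes n :: "'a::{metric_space, second_countable_topology} measure"
  shows "weak_upper_gradient n f G \<longleftrightarrow> f \<in> borel_measurable borel \<and> G \<in> borel_measurable borel \<and>
     (\<forall>\<pi>. test_plan n \<pi> \<longrightarrow> (AE \<gamma> in \<pi>.
        ennreal \<bar>f (apply_bcontfun \<gamma> 1) - f (apply_bcontfun \<gamma> 0)\<bar> \<le> line_int G (apply_bcontfun \<gamma>) 0 1 \<and>
        line_int G (apply_bcontfun \<gamma>) 0 1 < \<infinity>))"
proof -
  have "(AE \<gamma> in \<pi>. ennreal \<bar>f (apply_bcontfun \<gamma> 1) - f (apply_bcontfun \<gamma> 0)\<bar>
             \<le> (\<integral>\<^sup>+s\<in>{0..1}. G (apply_bcontfun \<gamma> s) * ennreal (metric_deriv (apply_bcontfun \<gamma>) s) \<partial>lborel) \<and>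
           (\<integral>\<^sup>+s\<in>{0..1}. G (apply_bcontfun \<gamma> s) * ennreal (metric_deriv (apply_bcontfun \<gamma>) s) \<partial>lborel) < \<infinity>)
     \<longleftrightarrow> (AE \<gamma> in \<pi>.
        ennreal \<bar>f (apply_bcontfun \<gamma> 1) - f (apply_bcontfun \<gamma> 0)\<bar> \<le> line_int G (apply_bcontfun \<gamma>) 0 1 \<and>
        line_int G (apply_bcontfun \<gamma>) 0 1 < \<infinity>)" if "test_plan n \<pi>" for \<pi>
  proof -
    have "AE \<gamma> in \<pi>. regular_curve (apply_bcontfun \<gamma>)" using that by (simp add: test_plan_iff)
    then have *: "AE \<gamma> in \<pi>. line_int G (apply_bcontfun \<gamma>) 0 1 =
       (\<integral>\<^sup>+s\<in>{0..1}. G (apply_bcontfun \<gamma> s) * ennreal (metric_deriv (apply_bcontfun \<gamma>) s) \<partial>lborel)"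
    proof eventually_elim
      case (elim \<gamma>)
      show ?case
        unfolding line_int_def using regular_curve_metric_deriv[OF continuous_on_bcontfun elim]
        by (intro nn_integral_cong_AE, eventually_elim) (auto simp: indicator_def)
    qed
    show ?thesis (is "?A = ?B")
    proof
      assume ?A with * show ?B by eventually_elim simp
    next
      assume ?B with * show ?A by eventually_elim simp
    qed
  qed
  then show ?thesis unfolding weak_upper_gradient_def by blast
qed

lemma test_planD:
  fixes \<pi> :: "(real \<Rightarrow>\<^sub>C 'a::{metric_space, second_countable_topology}) measure"
  assumes "test_plan n \<pi>"
  shows "sets \<pi> = sets curve_space" "prob_space \<pi>" "space \<pi> = curves"
    "AE \<gamma> in \<pi>. regular_curve (apply_bcontfun \<gamma>)"
    "(\<integral>\<^sup>+\<gamma>. energy (apply_bcontfun \<gamma>) \<partial>\<pi>) < \<infinity>"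
proof -
  show "sets \<pi> = sets curve_space" using assms by (simp add: test_plan_iff)
  then show "space \<pi> = curves" using sets_eq_imp_space_eq[of \<pi> curve_space] by (simp add: space_restrict_space)
qed (use assms in \<open>auto simp: test_plan_iff\<close>)

section \<open>Marginals of test plans and exchange of curves with times\<close>

lemma pair_sigma_finite_lborel:
  "prob_space M \<Longrightarrow> pair_sigma_finite M (lborel :: real measure)"
  by (simp add: pair_sigma_finite_def prob_space_imp_sigma_finite lborel.sigma_finite_measure_axioms)

text \<open>The marginal bound extends from sets to functions by comparing the image measure with
  the measure of constant density \<open>C\<close>.\<close>

lemma test_plan_nn_integral_le:
  fixes \<pi> :: "(real \<Rightarrow>\<^sub>C 'a::{metric_space, second_countable_topology}) measure"
  assumes \<pi>: "test_plan n \<pi>" and n: "sets n = sets borel"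
  obtains C :: real where "C \<ge> 0"
    "\<And>t A. t \<in> {0..1} \<Longrightarrow> A \<in> sets borel \<Longrightarrow> emeasure \<pi> {\<gamma> \<in> space \<pi>. apply_bcontfun \<gamma> t \<in> A} \<le> ennreal C * emeasure n A"
    "\<And>t H. t \<in> {0..1} \<Longrightarrow> H \<in> borel_measurable borel \<Longrightarrow>
        (\<integral>\<^sup>+\<gamma>. H (apply_bcontfun \<gamma> t) \<partial>\<pi>) \<le> ennreal C * (\<integral>\<^sup>+x. H x \<partial>n)"
proof -
  obtain C :: real where C: "C \<ge> 0"
    "\<And>t A. t \<in> {0..1} \<Longrightarrow> A \<in> sets borel \<Longrightarrow> emeasure \<pi> {\<gamma> \<in> space \<pi>. apply_bcontfun \<gamma> t \<in> A} \<le> ennreal C * emeasure n A"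
    using \<pi> unfolding test_plan_iff by auto
  have "(\<integral>\<^sup>+\<gamma>. H (apply_bcontfun \<gamma> t) \<partial>\<pi>) \<le> ennreal C * (\<integral>\<^sup>+x. H x \<partial>n)"
    if t: "t \<in> {0..1}" and H: "H \<in> borel_measurable borel" for t and H :: "'a \<Rightarrow> ennreal"
  proof -
    note e[measurable] = measurable_curve_eval[OF test_planD(1)[OF \<pi>], of t]
    have Hn: "H \<in> borel_measurable n" using H n by (simp cong: measurable_cong_sets)
    have le: "distr \<pi> borel (\<lambda>\<gamma>. apply_bcontfun \<gamma> t) \<le> density n (\<lambda>_. ennreal C)"
    proof (subst le_measure)
      show "\<forall>A\<in>sets (distr \<pi> borel (\<lambda>\<gamma>. apply_bcontfun \<gamma> t)).
          emeasure (distr \<pi> borel (\<lambda>\<gamma>. apply_bcontfun \<gamma> t)) A \<le> emeasure (density n (\<lambda>_. ennreal C)) A"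
      proof
        fix A assume "A \<in> sets (distr \<pi> borel (\<lambda>\<gamma>. apply_bcontfun \<gamma> t))"
        then have A: "A \<in> sets borel" by simp
        have "emeasure (distr \<pi> borel (\<lambda>\<gamma>. apply_bcontfun \<gamma> t)) A = emeasure \<pi> {\<gamma> \<in> space \<pi>. apply_bcontfun \<gamma> t \<in> A}"
          using A by (subst emeasure_distr) (auto intro!: arg_cong[where f="emeasure \<pi>"])
        also have "\<dots> \<le> ennreal C * emeasure n A" using C(2) t A by blast
        also have "\<dots> = emeasure (density n (\<lambda>_. ennreal C)) A"
          using A n by (subst emeasure_density) (auto simp: nn_integral_cmult_indicator)
        finally show "emeasure (distr \<pi> borel (\<lambda>\<gamma>. apply_bcontfun \<gamma> t)) A \<le> emeasure (density n (\<lambda>_. ennreal C)) A" .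
      qed
    qed (simp add: n)
    have "(\<integral>\<^sup>+\<gamma>. H (apply_bcontfun \<gamma> t) \<partial>\<pi>) = (\<integral>\<^sup>+x. H x \<partial>distr \<pi> borel (\<lambda>\<gamma>. apply_bcontfun \<gamma> t))"
      using H by (subst nn_integral_distr) auto
    also have "\<dots> \<le> (\<integral>\<^sup>+x. H x \<partial>density n (\<lambda>_. ennreal C))"
      using le by (intro nn_integral_mono_measure) (simp add: n)
    also have "\<dots> = ennreal C * (\<integral>\<^sup>+x. H x \<partial>n)"
      using Hn by (subst nn_integral_density) (auto simp: nn_integral_cmult)
    finally show ?thesis .
  qed
  with C show ?thesis using that by blast
qed

text \<open>The marginals do not charge null sets of \<open>n\<close>. At a fixed time the
  exceptional set of curves depends on that time; Fubini gives one exceptional set, at the price of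
  exceptional times on each curve.\<close>

lemma
  fixes \<pi> :: "(real \<Rightarrow>\<^sub>C 'a::{metric_space, second_countable_topology}) measure"
  assumes \<pi>: "test_plan n \<pi>" and n: "sets n = sets borel" and Q: "AE x in n. Q x"
  shows AE_test_plan_eval: "t \<in> {0..1} \<Longrightarrow> AE \<gamma> in \<pi>. Q (apply_bcontfun \<gamma> t)"
    and AE_test_plan_AE_eval: "AE \<gamma> in \<pi>. AE t in lborel. t \<in> {0..1} \<longrightarrow> Q (apply_bcontfun \<gamma> t)"
proof -
  obtain C :: real where C: "C \<ge> 0"
    "\<And>t A. t \<in> {0..1} \<Longrightarrow> A \<in> sets borel \<Longrightarrow> emeasure \<pi> {\<gamma> \<in> space \<pi>. apply_bcontfun \<gamma> t \<in> A} \<le> ennreal C * emeasure n A"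
    by (rule test_plan_nn_integral_le[OF \<pi> n]) blast
  obtain N where N: "{x \<in> space n. \<not> Q x} \<subseteq> N" "emeasure n N = 0" "N \<in> sets n"
    using AE_E[OF Q] by auto
  have [measurable]: "N \<in> sets borel" using N n by simp
  have QN: "Q x" if "x \<notin> N" for x
    using N(1) that sets_eq_imp_space_eq[OF n] by auto
  note [measurable] = measurable_curve_eval[OF test_planD(1)[OF \<pi>]] measurable_curve_eval_pair[OF test_planD(1)[OF \<pi>]]
  have ev: "AE \<gamma> in \<pi>. apply_bcontfun \<gamma> t \<notin> N" if "t \<in> {0..1}" for t
  proof (rule AE_I)
    show "{\<gamma> \<in> space \<pi>. \<not> apply_bcontfun \<gamma> t \<notin> N} \<subseteq> {\<gamma> \<in> space \<pi>. apply_bcontfun \<gamma> t \<in> N}" by auto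
    show "emeasure \<pi> {\<gamma> \<in> space \<pi>. apply_bcontfun \<gamma> t \<in> N} = 0"
      using C(2)[OF that, of N] N(2) by simp
  qed measurable
  show "AE \<gamma> in \<pi>. Q (apply_bcontfun \<gamma> t)" if "t \<in> {0..1}"
    using ev[OF that] by (rule eventually_mono) (rule QN)
  interpret pair_sigma_finite \<pi> "lborel :: real measure"
    by (intro pair_sigma_finite_lborel test_planD(2)[OF \<pi>])
  have "AE \<gamma> in \<pi>. AE t in lborel. t \<in> {0..1} \<longrightarrow> apply_bcontfun \<gamma> t \<notin> N"
  proof (subst AE_commute)
    show "{x \<in> space (\<pi> \<Otimes>\<^sub>M lborel). snd x \<in> {0..1} \<longrightarrow> apply_bcontfun (fst x) (snd x) \<notin> N}
        \<in> sets (\<pi> \<Otimes>\<^sub>M lborel)"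
      by measurable
  qed (use ev in auto)
  then show "AE \<gamma> in \<pi>. AE t in lborel. t \<in> {0..1} \<longrightarrow> Q (apply_bcontfun \<gamma> t)"
    by (rule eventually_mono) (erule eventually_mono, use QN in auto)
qed

lemma AE_line_int_mono:
  fixes \<pi> :: "(real \<Rightarrow>\<^sub>C 'a::{metric_space, second_countable_topology}) measure"
  assumes \<pi>: "test_plan n \<pi>" and n: "sets n = sets borel" and le: "AE x in n. G x \<le> H x"
  shows "AE \<gamma> in \<pi>. \<forall>s t. 0 \<le> s \<longrightarrow> t \<le> 1 \<longrightarrow> line_int G (apply_bcontfun \<gamma>) s t \<le> line_int H (apply_bcontfun \<gamma>) s t"
  using AE_test_plan_AE_eval[OF \<pi> n le]
proof eventually_elim
  case (elim \<gamma>)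
  show ?case
    unfolding line_int_def
    by (intro allI impI nn_integral_mono_AE eventually_mono[OF elim]) (auto simp: indicator_def mult_right_mono)
qed

text \<open>By \<open>x y \<le> x^2 + y^2\<close> the mean of the line integral over the plan is at
  most \<open>C\<close> times the integral of the square of \<open>H\<close> plus the mean energy of
  the plan.\<close>

lemma AE_line_int_finite:
  fixes \<pi> :: "(real \<Rightarrow>\<^sub>C 'a::{metric_space, second_countable_topology}) measure"
  assumes \<pi>: "test_plan n \<pi>" and n: "sets n = sets borel"
    and H[measurable]: "H \<in> borel_measurable borel" and fin: "(\<integral>\<^sup>+x. (H x)\<^sup>2 \<partial>n) < \<infinity>"
  shows "AE \<gamma> in \<pi>. line_int H (apply_bcontfun \<gamma>) 0 1 < \<infinity>"
proof -
  interpret pair_sigma_finite \<pi> "lborel :: real measure"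
    by (intro pair_sigma_finite_lborel test_planD(2)[OF \<pi>])
  note \<pi>s = test_planD(1)[OF \<pi>]
  note [measurable] = measurable_curve_eval[OF \<pi>s] measurable_curve_eval_pair[OF \<pi>s] measurable_speed_pair[OF \<pi>s]
    measurable_energy[OF \<pi>s] measurable_line_int[OF \<pi>s H]
  obtain C :: real where C: "C \<ge> 0"
    "\<And>t H. t \<in> {0..1} \<Longrightarrow> H \<in> borel_measurable borel \<Longrightarrow>
        (\<integral>\<^sup>+\<gamma>. H (apply_bcontfun \<gamma> t) \<partial>\<pi>) \<le> ennreal C * (\<integral>\<^sup>+x. H x \<partial>n)"
    by (rule test_plan_nn_integral_le[OF \<pi> n]) blast
  have mul_le: "x * y \<le> x\<^sup>2 + y\<^sup>2" for x y :: ennreal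
  proof (cases "x \<le> y")
    case True
    then have "x * y \<le> y * y" by (rule mult_right_mono) simp
    then show ?thesis by (simp add: power2_eq_square add_increasing)
  next
    case False
    then have "x * y \<le> x * x" by (intro mult_left_mono) auto
    then show ?thesis by (simp add: power2_eq_square add_increasing2)
  qed
  have "line_int H (apply_bcontfun \<gamma>) 0 1 \<le> (\<integral>\<^sup>+r. (H (apply_bcontfun \<gamma> r))\<^sup>2 * indicator {0..1} r \<partial>lborel) + energy (apply_bcontfun \<gamma>)" for \<gamma>
  proof -
    have [measurable]: "apply_bcontfun \<gamma> \<in> borel_measurable borel"
      by (intro borel_measurable_continuous_onI continuous_on_bcontfun)
    have [measurable]: "speed (apply_bcontfun \<gamma>) \<in> borel_measurable borel"
      by (intro borel_measurable_speed continuous_on_bcontfun)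
    have "line_int H (apply_bcontfun \<gamma>) 0 1 \<le> (\<integral>\<^sup>+r. (H (apply_bcontfun \<gamma> r))\<^sup>2 * indicator {0..1} r + (speed (apply_bcontfun \<gamma>) r)\<^sup>2 * indicator {0..1} r \<partial>lborel)"
      unfolding line_int_def by (intro nn_integral_mono) (use mul_le in \<open>auto simp: indicator_def\<close>)
    also have "\<dots> = (\<integral>\<^sup>+r. (H (apply_bcontfun \<gamma> r))\<^sup>2 * indicator {0..1} r \<partial>lborel) + energy (apply_bcontfun \<gamma>)"
      unfolding energy_def by (rule nn_integral_add) auto
    finally show ?thesis .
  qed
  then have "(\<integral>\<^sup>+\<gamma>. line_int H (apply_bcontfun \<gamma>) 0 1 \<partial>\<pi>)
      \<le> (\<integral>\<^sup>+\<gamma>. (\<integral>\<^sup>+r. (H (apply_bcontfun \<gamma> r))\<^sup>2 * indicator {0..1} r \<partial>lborel) + energy (apply_bcontfun \<gamma>) \<partial>\<pi>)"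
    by (intro nn_integral_mono)
  also have "\<dots> = (\<integral>\<^sup>+\<gamma>. (\<integral>\<^sup>+r. (H (apply_bcontfun \<gamma> r))\<^sup>2 * indicator {0..1} r \<partial>lborel) \<partial>\<pi>) + (\<integral>\<^sup>+\<gamma>. energy (apply_bcontfun \<gamma>) \<partial>\<pi>)"
    by (intro nn_integral_add lborel.borel_measurable_nn_integral) (simp_all add: case_prod_beta')
  also have "(\<integral>\<^sup>+\<gamma>. (\<integral>\<^sup>+r. (H (apply_bcontfun \<gamma> r))\<^sup>2 * indicator {0..1} r \<partial>lborel) \<partial>\<pi>)
      = (\<integral>\<^sup>+r. (\<integral>\<^sup>+\<gamma>. (H (apply_bcontfun \<gamma> r))\<^sup>2 * indicator {0..1} r \<partial>\<pi>) \<partial>lborel)"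
    by (rule Fubini'[symmetric]) (simp add: case_prod_beta')
  also have "\<dots> \<le> (\<integral>\<^sup>+r. ennreal C * (\<integral>\<^sup>+x. (H x)\<^sup>2 \<partial>n) * indicator {0..1::real} r \<partial>lborel)"
    by (intro nn_integral_mono) (auto simp: indicator_def intro!: C(2))
  also have "\<dots> = ennreal C * (\<integral>\<^sup>+x. (H x)\<^sup>2 \<partial>n)"
    by (simp add: nn_integral_cmult_indicator)
  finally have "(\<integral>\<^sup>+\<gamma>. line_int H (apply_bcontfun \<gamma>) 0 1 \<partial>\<pi>) \<le> ennreal C * (\<integral>\<^sup>+x. (H x)\<^sup>2 \<partial>n) + (\<integral>\<^sup>+\<gamma>. energy (apply_bcontfun \<gamma>) \<partial>\<pi>)"
    by (simp add: add_right_mono)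
  also have "\<dots> < \<infinity>"
    using fin test_planD(5)[OF \<pi>] by (simp add: ennreal_mult_less_top)
  finally have "AE \<gamma> in \<pi>. line_int H (apply_bcontfun \<gamma>) 0 1 \<noteq> \<infinity>"
    by (intro nn_integral_PInf_AE) auto
  then show ?thesis by (simp add: less_top)
qed

text \<open>Conditioning divides all bounds by the mass of \<open>A\<close>. The marginal bound is
  required only for the curves in \<open>A\<close>, and it may refer to another measure
  \<open>n'\<close>: this is how a plan for \<open>m\<close> produces plans for
  \<open>\<rho>\<close>.\<close>

lemma test_plan_uniform_measure:
  fixes \<pi> :: "(real \<Rightarrow>\<^sub>C 'a::{metric_space, second_countable_topology}) measure"
  assumes \<pi>: "test_plan n \<pi>" and A: "A \<in> sets \<pi>" "emeasure \<pi> A \<noteq> 0" and C: "C \<ge> 0"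
    and le: "\<And>t B. t \<in> {0..1} \<Longrightarrow> B \<in> sets borel \<Longrightarrow>
      emeasure \<pi> {\<gamma> \<in> space \<pi>. \<gamma> \<in> A \<and> apply_bcontfun \<gamma> t \<in> B} \<le> ennreal C * emeasure n' B"
  shows "test_plan n' (uniform_measure \<pi> A)"
proof -
  interpret prob_space \<pi> using \<pi> by (rule test_planD)
  note \<pi>s = test_planD(1)[OF \<pi>]
  note [measurable] = measurable_curve_eval[OF \<pi>s] measurable_energy[OF \<pi>s] A(1)
  have A': "0 < measure \<pi> A" using A(2) by (simp add: emeasure_eq_measure zero_less_measure_iff)
  show ?thesis
    unfolding test_plan_iff
  proof (intro conjI)
    show "prob_space (uniform_measure \<pi> A)"
      using A by (intro prob_space_uniform_measure) (auto simp: emeasure_eq_measure)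
    show "AE \<gamma> in uniform_measure \<pi> A. regular_curve (apply_bcontfun \<gamma>)"
      using A test_planD(4)[OF \<pi>] by (intro AE_uniform_measureI) (auto elim: eventually_mono)
    have "(\<integral>\<^sup>+ \<gamma>. energy (apply_bcontfun \<gamma>) * indicator A \<gamma> \<partial>\<pi>) \<le> (\<integral>\<^sup>+ \<gamma>. energy (apply_bcontfun \<gamma>) \<partial>\<pi>)"
      by (intro nn_integral_mono) (auto simp: indicator_def)
    also have "\<dots> < \<infinity>" using test_planD(5)[OF \<pi>] .
    finally show "(\<integral>\<^sup>+ \<gamma>. energy (apply_bcontfun \<gamma>) \<partial>uniform_measure \<pi> A) < \<infinity>"
      using A by (subst nn_integral_uniform_measure) (auto simp: ennreal_divide_eq_top_iff less_top[symmetric])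
    show "\<exists>C::real. C \<ge> 0 \<and> (\<forall>t\<in>{0..1}. \<forall>B\<in>sets borel.
        emeasure (uniform_measure \<pi> A) {\<gamma> \<in> space (uniform_measure \<pi> A). apply_bcontfun \<gamma> t \<in> B} \<le> ennreal C * emeasure n' B)"
    proof (intro exI[of _ "C / measure \<pi> A"] conjI ballI)
      show "0 \<le> C / measure \<pi> A" using C by simp
      fix t :: real and B :: "'a set" assume t: "t \<in> {0..1}" and B[measurable]: "B \<in> sets borel"
      have "emeasure (uniform_measure \<pi> A) {\<gamma> \<in> space (uniform_measure \<pi> A). apply_bcontfun \<gamma> t \<in> B}
          = emeasure \<pi> {\<gamma> \<in> space \<pi>. \<gamma> \<in> A \<and> apply_bcontfun \<gamma> t \<in> B} / emeasure \<pi> A"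
        using A by (subst emeasure_uniform_measure)
          (auto intro!: arg_cong[where f="\<lambda>x. emeasure \<pi> x / _"] dest: sets.sets_into_space)
      also have "\<dots> \<le> ennreal C * emeasure n' B / ennreal (measure \<pi> A)"
        using le[OF t B] by (simp add: emeasure_eq_measure divide_right_mono_ennreal)
      also have "\<dots> = ennreal (C / measure \<pi> A) * emeasure n' B"
        using C A' by (simp add: divide_ennreal[symmetric] divide_ennreal_def mult_ac)
      finally show "emeasure (uniform_measure \<pi> A) {\<gamma> \<in> space (uniform_measure \<pi> A). apply_bcontfun \<gamma> t \<in> B}
          \<le> ennreal (C / measure \<pi> A) * emeasure n' B" .
    qed
  qed (simp add: \<pi>s)
qed

text \<open>The piece between \<open>s\<close> and \<open>t\<close>, reparametrized on the unit
  interval; the clamp makes it constant on either side, as the encoding by \<open>curves\<close>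
  demands.\<close>

definition subcurve :: "real \<Rightarrow> real \<Rightarrow> (real \<Rightarrow>\<^sub>C 'a::metric_space) \<Rightarrow> (real \<Rightarrow>\<^sub>C 'a)" where
  "subcurve s t \<gamma> = Bcontfun (\<lambda>r. apply_bcontfun \<gamma> (s + (t - s) * max 0 (min 1 r)))"

lemma subcurve_apply:
  "apply_bcontfun (subcurve s t \<gamma>) r = apply_bcontfun \<gamma> (s + (t - s) * max 0 (min 1 r))"
proof -
  have "(\<lambda>r. apply_bcontfun \<gamma> (s + (t - s) * max 0 (min 1 r))) \<in> bcontfun"
    unfolding bcontfun_def
  proof (intro CollectI conjI)
    show "continuous_on UNIV (\<lambda>r. apply_bcontfun \<gamma> (s + (t - s) * max 0 (min 1 r)))"
      by (intro continuous_on_compose2[OF continuous_on_bcontfun[of UNIV]] continuous_intros) auto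
    have "bounded (range (apply_bcontfun \<gamma>))"
      using apply_bcontfun[of \<gamma>] by (simp add: bcontfun_def)
    then show "bounded (range (\<lambda>r. apply_bcontfun \<gamma> (s + (t - s) * max 0 (min 1 r))))"
      by (rule bounded_subset) auto
  qed
  then show ?thesis by (simp add: subcurve_def Bcontfun_inverse)
qed

lemma subcurve_in_curves: "subcurve s t \<gamma> \<in> curves"
  by (simp add: curves_def subcurve_apply)

lemma measurable_subcurve:
  assumes "sets \<pi> = sets curve_space"
  shows "subcurve s t \<in> \<pi> \<rightarrow>\<^sub>M curve_space"
proof (rule measurable_restrict_space2)
  have "dist (subcurve s t \<gamma>) (subcurve s t \<gamma>') \<le> dist \<gamma> \<gamma>'" for \<gamma> \<gamma>' :: "real \<Rightarrow>\<^sub>C 'a"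
    by (rule dist_bound) (simp add: subcurve_apply dist_bounded)
  then have "continuous_on UNIV (subcurve s t :: (real \<Rightarrow>\<^sub>C 'a) \<Rightarrow> _)"
    unfolding continuous_on_iff using le_less_trans by blast
  then show "subcurve s t \<in> borel_measurable \<pi>"
    unfolding measurable_cong_sets[OF assms refl]
    by (intro measurable_restrict_space1 borel_measurable_continuous_onI)
qed (simp add: subcurve_in_curves)

lemma speed_subcurve_le:
  assumes "s < t" "0 \<le> r" "r < 1"
  shows "speed (apply_bcontfun (subcurve s t \<gamma>)) r \<le> ennreal (t - s) * speed (apply_bcontfun \<gamma>) (s + (t - s) * r)"
proof (rule speed_affine_le)
  \<comment> \<open>For such increments the clamp in \<open>subcurve\<close> is inactive.\<close>
  have "\<forall>\<^sub>F h in at_right 0. 0 < h \<and> h < 1 - r"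
    using assms by (auto simp: eventually_at_right_field intro!: exI[of _ "1 - r"])
  then show "\<forall>\<^sub>F h in at_right 0. apply_bcontfun (subcurve s t \<gamma>) (r + h) = apply_bcontfun \<gamma> (s + (t - s) * r + (t - s) * h)"
    by eventually_elim (use assms in \<open>auto simp: subcurve_apply algebra_simps\<close>)
qed (use assms in \<open>auto simp: subcurve_apply\<close>)

lemma line_int_subcurve_le:
  fixes \<gamma> :: "real \<Rightarrow>\<^sub>C 'a::{metric_space, second_countable_topology}"
  assumes G: "G \<in> borel_measurable borel" and "s < t"
  shows "line_int G (apply_bcontfun (subcurve s t \<gamma>)) 0 1 \<le> line_int G (apply_bcontfun \<gamma>) s t"
proof -
  note [measurable] = measurable_line_int_integrand[OF G, of \<gamma>]
  let ?I = "\<lambda>r. G (apply_bcontfun \<gamma> r) * speed (apply_bcontfun \<gamma>) r"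
  have "line_int G (apply_bcontfun (subcurve s t \<gamma>)) 0 1 \<le> (\<integral>\<^sup>+r\<in>{0..1}. ennreal (t - s) * ?I (s + (t - s) * r) \<partial>lborel)"
    unfolding line_int_def
  proof (intro nn_integral_mono_AE, use AE_lborel_singleton[of 1] in eventually_elim)
    case (elim r)
    then show ?case
      using mult_left_mono[OF speed_subcurve_le[OF \<open>s < t\<close>, of r \<gamma>], of "G (apply_bcontfun \<gamma> (s + (t - s) * r))"]
      by (auto simp: indicator_def subcurve_apply mult_ac)
  qed
  also have "\<dots> = ennreal (t - s) * (\<integral>\<^sup>+r\<in>{0..1}. ?I (s + (t - s) * r) \<partial>lborel)"
    unfolding mult.assoc by (rule nn_integral_cmult) (simp add: mult.assoc[symmetric])
  also have "\<dots> = line_int G (apply_bcontfun \<gamma>) s t"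
    unfolding line_int_def using nn_integral_Icc_affine[of ?I "t - s" s 0 1] \<open>s < t\<close> by simp
  finally show ?thesis .
qed

lemma energy_subcurve_le:
  fixes \<gamma> :: "real \<Rightarrow>\<^sub>C 'a::{metric_space, second_countable_topology}"
  assumes "0 \<le> s" "s < t" "t \<le> 1"
  shows "energy (apply_bcontfun (subcurve s t \<gamma>)) \<le> energy (apply_bcontfun \<gamma>)"
proof -
  have [measurable]: "speed (apply_bcontfun \<gamma>) \<in> borel_measurable borel"
    by (intro borel_measurable_speed continuous_on_bcontfun)
  let ?I = "\<lambda>r. (speed (apply_bcontfun \<gamma>) r)\<^sup>2"
  have "energy (apply_bcontfun (subcurve s t \<gamma>)) \<le> (\<integral>\<^sup>+r\<in>{0..1}. ennreal (t - s) * ?I (s + (t - s) * r) \<partial>lborel)"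
    unfolding energy_def
  proof (intro nn_integral_mono_AE, use AE_lborel_singleton[of 1] in eventually_elim)
    case (elim r)
    show ?case
    proof (cases "r \<in> {0..1}")
      case True
      then have "(speed (apply_bcontfun (subcurve s t \<gamma>)) r)\<^sup>2 \<le> (ennreal (t - s) * speed (apply_bcontfun \<gamma>) (s + (t - s) * r))\<^sup>2"
        using elim assms by (intro power_mono speed_subcurve_le) auto
      also have "\<dots> = ennreal (t - s) * ennreal (t - s) * ?I (s + (t - s) * r)"
        by (simp add: power2_eq_square mult_ac)
      \<comment> \<open>The square produces two factors \<open>t - s\<close>. One is at most one,
        the other is absorbed by the change of variables.\<close>
      also have "\<dots> \<le> ennreal (t - s) * 1 * ?I (s + (t - s) * r)"
        using assms by (intro mult_right_mono mult_left_mono) auto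
      finally show ?thesis using True by simp
    qed simp
  qed
  also have "\<dots> = ennreal (t - s) * (\<integral>\<^sup>+r\<in>{0..1}. ?I (s + (t - s) * r) \<partial>lborel)"
    unfolding mult.assoc by (rule nn_integral_cmult) auto
  also have "\<dots> = (\<integral>\<^sup>+r\<in>{s..t}. ?I r \<partial>lborel)"
    using nn_integral_Icc_affine[of ?I "t - s" s 0 1] assms by simp
  also have "\<dots> \<le> energy (apply_bcontfun \<gamma>)"
    unfolding energy_def using assms by (intro nn_integral_Icc_mono_set) auto
  finally show ?thesis .
qed

text \<open>The rescaled speed of the whole curve bounds the increments of the piece, hence so does
  the speed of the piece itself.\<close>

lemma regular_curve_subcurve:
  fixes \<gamma> :: "real \<Rightarrow>\<^sub>C 'a::{metric_space, second_countable_topology}"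
  assumes "0 \<le> s" "s < t" "t \<le> 1" and reg: "regular_curve (apply_bcontfun \<gamma>)"
  shows "regular_curve (apply_bcontfun (subcurve s t \<gamma>))"
proof -
  have sp[measurable]: "speed (apply_bcontfun \<gamma>) \<in> borel_measurable borel"
    by (intro borel_measurable_speed continuous_on_bcontfun)
  let ?v = "\<lambda>r. ennreal (t - s) * speed (apply_bcontfun \<gamma>) (s + (t - s) * r)"
  have eq: "(\<integral>\<^sup>+r\<in>{p..q}. ?v r \<partial>lborel) = (\<integral>\<^sup>+r\<in>{s + (t - s) * p..s + (t - s) * q}. speed (apply_bcontfun \<gamma>) r \<partial>lborel)" for p q
    unfolding mult.assoc using assms
    by (subst nn_integral_Icc_affine) (auto intro!: nn_integral_cmult)
  have bd: "ennreal (dist (apply_bcontfun (subcurve s t \<gamma>) p) (apply_bcontfun (subcurve s t \<gamma>) q)) \<le> (\<integral>\<^sup>+r\<in>{p..q}. ?v r \<partial>lborel)"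
    if pq: "0 \<le> p" "p \<le> q" "q \<le> 1" for p q
  proof -
    have le: "(t - s) * p \<le> (t - s) * q" "0 \<le> (t - s) * p"
      using pq assms by (auto intro: mult_left_mono)
    moreover have "s + (t - s) * q \<le> 1" using mult_left_le[of q "t - s"] pq assms by linarith
    moreover note assms
    ultimately have "ennreal (dist (apply_bcontfun \<gamma> (s + (t - s) * p)) (apply_bcontfun \<gamma> (s + (t - s) * q)))
       \<le> (\<integral>\<^sup>+r\<in>{s + (t - s) * p..s + (t - s) * q}. speed (apply_bcontfun \<gamma>) r \<partial>lborel)"
      by (intro regular_curve_dist_le[OF reg continuous_on_bcontfun]) auto
    then show ?thesis using pq by (simp add: eq subcurve_apply)
  qed
  have fin: "(\<integral>\<^sup>+r\<in>{0..1}. (speed (apply_bcontfun \<gamma>) r) \<partial>lborel) < \<infinity>"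
    by (rule nn_integral_le_of_square[OF sp]) (use reg in \<open>simp add: regular_curve_def energy_def\<close>)
  have "(\<integral>\<^sup>+r\<in>{s + (t - s) * 0..s + (t - s) * 1}. (speed (apply_bcontfun \<gamma>) r) \<partial>lborel)
     \<le> (\<integral>\<^sup>+r\<in>{0..1}. (speed (apply_bcontfun \<gamma>) r) \<partial>lborel)"
    using assms by (intro nn_integral_Icc_mono_set) auto
  then have vfin: "(\<integral>\<^sup>+r\<in>{0..1}. ?v r \<partial>lborel) < \<infinity>"
    unfolding eq using fin by (rule le_less_trans)
  have "ennreal (dist (apply_bcontfun (subcurve s t \<gamma>) p) (apply_bcontfun (subcurve s t \<gamma>) q))
     \<le> (\<integral>\<^sup>+r\<in>{p..q}. speed (apply_bcontfun (subcurve s t \<gamma>)) r \<partial>lborel)" if "0 \<le> p" "p \<le> q" "q \<le> 1" for p q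
    by (rule dist_le_integral_speed[OF continuous_on_bcontfun _ vfin]) (use bd that in auto)
  moreover have "energy (apply_bcontfun (subcurve s t \<gamma>)) < \<infinity>"
    using energy_subcurve_le[of s t \<gamma>] assms reg by (auto simp: regular_curve_def intro: le_less_trans)
  ultimately show ?thesis by (auto simp: regular_curve_def)
qed

text \<open>The marginals of the image plan are marginals of \<open>\<pi>\<close> at times between
  \<open>s\<close> and \<open>t\<close>, so the same constant serves.\<close>

lemma test_plan_subcurve:
  fixes \<pi> :: "(real \<Rightarrow>\<^sub>C 'a::{metric_space, second_countable_topology}) measure"
  assumes \<pi>: "test_plan n \<pi>" and st: "0 \<le> s" "s < t" "t \<le> 1"
  shows "test_plan n (distr \<pi> curve_space (subcurve s t))"
proof -
  note \<pi>s = test_planD(1)[OF \<pi>]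
  note ms[measurable] = measurable_subcurve[OF \<pi>s, of s t]
  note [measurable] = measurable_energy[OF refl] measurable_curve_eval[OF refl]
  interpret prob_space \<pi> using \<pi> by (rule test_planD)
  obtain C :: real where C: "C \<ge> 0"
    "\<And>t A. t \<in> {0..1} \<Longrightarrow> A \<in> sets borel \<Longrightarrow> emeasure \<pi> {\<gamma> \<in> space \<pi>. apply_bcontfun \<gamma> t \<in> A} \<le> ennreal C * emeasure n A"
    using \<pi> unfolding test_plan_iff by auto
  show ?thesis
    unfolding test_plan_iff
  proof (intro conjI)
    show "prob_space (distr \<pi> curve_space (subcurve s t))" by (rule prob_space_distr[OF ms])
    show "AE \<gamma> in distr \<pi> curve_space (subcurve s t). regular_curve (apply_bcontfun \<gamma>)"
      using test_planD(4)[OF \<pi>] regular_curve_subcurve[OF st] sets_regular_curve[OF refl]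
      by (subst AE_distr_iff[OF ms]) (auto elim!: eventually_mono)
    have "(\<integral>\<^sup>+ \<gamma>. energy (apply_bcontfun \<gamma>) \<partial>distr \<pi> curve_space (subcurve s t))
        = (\<integral>\<^sup>+ \<gamma>. energy (apply_bcontfun (subcurve s t \<gamma>)) \<partial>\<pi>)"
      by (rule nn_integral_distr) auto
    also have "\<dots> \<le> (\<integral>\<^sup>+ \<gamma>. energy (apply_bcontfun \<gamma>) \<partial>\<pi>)"
      by (intro nn_integral_mono energy_subcurve_le st)
    also have "\<dots> < \<infinity>" using test_planD(5)[OF \<pi>] .
    finally show "(\<integral>\<^sup>+ \<gamma>. energy (apply_bcontfun \<gamma>) \<partial>distr \<pi> curve_space (subcurve s t)) < \<infinity>" .
    show "\<exists>C::real. C \<ge> 0 \<and> (\<forall>t'\<in>{0..1}. \<forall>A\<in>sets borel.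
        emeasure (distr \<pi> curve_space (subcurve s t)) {\<gamma> \<in> space (distr \<pi> curve_space (subcurve s t)). apply_bcontfun \<gamma> t' \<in> A} \<le> ennreal C * emeasure n A)"
    proof (intro exI[of _ C] conjI ballI C)
      fix t' :: real and A :: "'a set" assume t': "t' \<in> {0..1}" and A[measurable]: "A \<in> sets borel"
      have "0 \<le> (t - s) * t'" using t' st by simp
      moreover have "s + (t - s) * t' \<le> 1" using mult_left_le[of t' "t - s"] t' st unfolding atLeastAtMost_iff by linarith
      ultimately have in01: "s + (t - s) * t' \<in> {0..1}" using st(1) by simp
      have "{\<gamma> \<in> space curve_space. apply_bcontfun \<gamma> t' \<in> A} \<in> sets curve_space" by measurable
      then have "emeasure (distr \<pi> curve_space (subcurve s t)) {\<gamma> \<in> space (distr \<pi> curve_space (subcurve s t)). apply_bcontfun \<gamma> t' \<in> A}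
          = emeasure \<pi> {\<gamma> \<in> space \<pi>. apply_bcontfun \<gamma> (s + (t - s) * t') \<in> A}"
        using t' by (subst emeasure_distr[OF ms])
          (auto intro!: arg_cong[where f="emeasure \<pi>"] simp: subcurve_apply space_restrict_space subcurve_in_curves)
      also have "\<dots> \<le> ennreal C * emeasure n A" by (rule C(2)[OF in01 A])
      finally show "emeasure (distr \<pi> curve_space (subcurve s t)) {\<gamma> \<in> space (distr \<pi> curve_space (subcurve s t)). apply_bcontfun \<gamma> t' \<in> A} \<le> ennreal C * emeasure n A" .
    qed
  qed simp
qed

section \<open>Representatives along curves\<close>

lemma weak_upper_gradientD:
  assumes "weak_upper_gradient n f G"
  shows "f \<in> borel_measurable borel" "G \<in> borel_measurable borel"
  using assms by (auto simp: weak_upper_gradient_def)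

lemma weak_upper_gradient_AE:
  fixes n :: "'a::{metric_space, second_countable_topology} measure"
  assumes "weak_upper_gradient n f G" "test_plan n \<pi>"
  shows "AE \<gamma> in \<pi>. ennreal \<bar>f (apply_bcontfun \<gamma> 1) - f (apply_bcontfun \<gamma> 0)\<bar> \<le> line_int G (apply_bcontfun \<gamma>) 0 1 \<and>
        line_int G (apply_bcontfun \<gamma>) 0 1 < \<infinity>"
  using assms unfolding weak_upper_gradient_iff by blast

text \<open>For square integrable \<open>G\<close> the finiteness clause is
  \<open>AE_line_int_finite\<close>.\<close>

lemma weak_upper_gradientI:
  fixes n :: "'a::{metric_space, second_countable_topology} measure"
  assumes n: "sets n = sets borel" and f: "f \<in> borel_measurable borel" and G: "G \<in> borel_measurable borel"
    and fin: "(\<integral>\<^sup>+x. (G x)\<^sup>2 \<partial>n) < \<infinity>"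
    and le: "\<And>\<pi>. test_plan n \<pi> \<Longrightarrow> AE \<gamma> in \<pi>.
        ennreal \<bar>f (apply_bcontfun \<gamma> 1) - f (apply_bcontfun \<gamma> 0)\<bar> \<le> line_int G (apply_bcontfun \<gamma>) 0 1"
  shows "weak_upper_gradient n f G"
  unfolding weak_upper_gradient_iff
proof (intro conjI allI impI f G)
  fix \<pi> assume \<pi>: "test_plan n \<pi>"
  show "AE \<gamma> in \<pi>. ennreal \<bar>f (apply_bcontfun \<gamma> 1) - f (apply_bcontfun \<gamma> 0)\<bar> \<le> line_int G (apply_bcontfun \<gamma>) 0 1 \<and>
        line_int G (apply_bcontfun \<gamma>) 0 1 < \<infinity>"
    using le[OF \<pi>] AE_line_int_finite[OF \<pi> n G fin] by eventually_elim simp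
qed

text \<open>The definition applied to the plan of subcurves, whose end points are the positions at
  times \<open>s\<close> and \<open>t\<close>.\<close>

lemma weak_upper_gradient_subinterval:
  fixes n :: "'a::{metric_space, second_countable_topology} measure"
  assumes w: "weak_upper_gradient n f G" and \<pi>: "test_plan n \<pi>" and st: "0 \<le> s" "s \<le> t" "t \<le> 1"
  shows "AE \<gamma> in \<pi>. ennreal \<bar>f (apply_bcontfun \<gamma> t) - f (apply_bcontfun \<gamma> s)\<bar> \<le> line_int G (apply_bcontfun \<gamma>) s t"
proof (cases "s = t")
  case False
  with st have "s < t" by simp
  note G = weak_upper_gradientD[OF w]
  note ms = measurable_subcurve[OF test_planD(1)[OF \<pi>], of s t]
  note [measurable] = measurable_curve_eval[OF refl] measurable_line_int[OF refl G(2)] G(1)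
  have "test_plan n (distr \<pi> curve_space (subcurve s t))"
    using \<open>s < t\<close> st by (intro test_plan_subcurve[OF \<pi>])
  from weak_upper_gradient_AE[OF w this] have "AE \<gamma> in distr \<pi> curve_space (subcurve s t).
      ennreal \<bar>f (apply_bcontfun \<gamma> 1) - f (apply_bcontfun \<gamma> 0)\<bar> \<le> line_int G (apply_bcontfun \<gamma>) 0 1"
    by eventually_elim simp
  then have "AE \<gamma> in \<pi>. ennreal \<bar>f (apply_bcontfun (subcurve s t \<gamma>) 1) - f (apply_bcontfun (subcurve s t \<gamma>) 0)\<bar>
      \<le> line_int G (apply_bcontfun (subcurve s t \<gamma>)) 0 1"
    by (subst (asm) AE_distr_iff[OF ms]) measurable
  then show ?thesis
  proof eventually_elim
    case (elim \<gamma>)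
    then show ?case
      using line_int_subcurve_le[OF G(2) \<open>s < t\<close>, of \<gamma>] by (simp add: subcurve_apply)
  qed
qed simp

text \<open>McShane's infimum formula for a function that is 1-Lipschitz in the pseudometric
  \<open>\<bar>v x - v y\<bar>\<close>.\<close>

lemma McShane_extension:
  fixes \<phi> v :: "'b \<Rightarrow> real"
  assumes "T \<noteq> {}" and le: "\<And>x y. x \<in> T \<Longrightarrow> y \<in> T \<Longrightarrow> \<bar>\<phi> x - \<phi> y\<bar> \<le> \<bar>v x - v y\<bar>"
  obtains F where "\<And>x. x \<in> T \<Longrightarrow> F x = \<phi> x" "\<And>x y. \<bar>F x - F y\<bar> \<le> \<bar>v x - v y\<bar>"
proof -
  define F where "F x = (INF p\<in>T. \<phi> p + \<bar>v x - v p\<bar>)" for x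
  obtain p0 where p0: "p0 \<in> T" using assms(1) by auto
  have bdd: "bdd_below ((\<lambda>p. \<phi> p + \<bar>v x - v p\<bar>) ` T)" for x
  proof (rule bdd_belowI2)
    fix p assume "p \<in> T"
    then show "\<phi> p0 - \<bar>v x - v p0\<bar> \<le> \<phi> p + \<bar>v x - v p\<bar>" using le[OF p0, of p] by linarith
  qed
  have le1: "F x \<le> F y + \<bar>v x - v y\<bar>" for x y
  proof -
    have "F x - \<bar>v x - v y\<bar> \<le> F y"
      unfolding F_def[of y]
    proof (rule cINF_greatest[OF assms(1)])
      fix p assume "p \<in> T"
      then have "F x \<le> \<phi> p + \<bar>v x - v p\<bar>" unfolding F_def by (rule cINF_lower[OF bdd])
      then show "F x - \<bar>v x - v y\<bar> \<le> \<phi> p + \<bar>v y - v p\<bar>" by linarith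
    qed
    then show ?thesis by simp
  qed
  show ?thesis
  proof (rule that)
    fix x assume x: "x \<in> T"
    have "F x \<le> \<phi> x + \<bar>v x - v x\<bar>" unfolding F_def by (rule cINF_lower[OF bdd x])
    moreover have "\<phi> x \<le> F x"
      unfolding F_def
    proof (rule cINF_greatest[OF assms(1)])
      fix p assume "p \<in> T"
      then show "\<phi> x \<le> \<phi> p + \<bar>v x - v p\<bar>" using le[OF x, of p] by linarith
    qed
    ultimately show "F x = \<phi> x" by simp
  next
    fix x y show "\<bar>F x - F y\<bar> \<le> \<bar>v x - v y\<bar>"
      using le1[of x y] le1[of y x] by linarith
  qed
qed

text \<open>With \<open>v\<close> the primitive of \<open>W\<close>, the hypotheses say that
  \<open>\<phi>\<close> is 1-Lipschitz in \<open>\<bar>v x - v y\<bar>\<close> between a good time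
  and a time in \<open>D\<close>. Two distinct good times are compared through a rational time
  strictly between them, at which the two variations of the monotone \<open>v\<close> add
  up.\<close>

lemma AC_extension:
  fixes \<phi> :: "real \<Rightarrow> real" and W :: "real \<Rightarrow> ennreal"
  assumes [measurable]: "W \<in> borel_measurable borel" and fin: "(\<integral>\<^sup>+r\<in>{0..1}. W r \<partial>lborel) < \<infinity>"
    and D: "\<rat> \<inter> {0..1} \<subseteq> D" "D \<subseteq> {0..1}"
    and DD: "\<And>p q. p \<in> D \<Longrightarrow> q \<in> D \<Longrightarrow> p \<le> q \<Longrightarrow> ennreal \<bar>\<phi> q - \<phi> p\<bar> \<le> (\<integral>\<^sup>+r\<in>{p..q}. W r \<partial>lborel)"
    and DT: "AE t in lborel. t \<in> {0..1} \<longrightarrow> (\<forall>p\<in>D. ennreal \<bar>\<phi> t - \<phi> p\<bar> \<le> (\<integral>\<^sup>+r\<in>{min p t..max p t}. W r \<partial>lborel))"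
  obtains F where "\<And>t. t \<in> D \<Longrightarrow> F t = \<phi> t" "AE t in lborel. t \<in> {0..1} \<longrightarrow> F t = \<phi> t"
    "\<And>s t. 0 \<le> s \<Longrightarrow> s \<le> t \<Longrightarrow> t \<le> 1 \<Longrightarrow> ennreal \<bar>F t - F s\<bar> \<le> (\<integral>\<^sup>+r\<in>{s..t}. W r \<partial>lborel)"
proof -
  define v where "v t = enn2real (\<integral>\<^sup>+r\<in>{0..t}. W r \<partial>lborel)" for t
  have fin': "(\<integral>\<^sup>+r\<in>{s..t}. W r \<partial>lborel) < \<infinity>" if "0 \<le> s" "t \<le> 1" for s t
    using nn_integral_Icc_mono_set[of "{s..t}" "{0..1}" W] that fin by (auto intro: le_less_trans)
  have v: "(\<integral>\<^sup>+r\<in>{s..t}. W r \<partial>lborel) = ennreal (v t - v s) \<and> v s \<le> v t" if "0 \<le> s" "s \<le> t" "t \<le> 1" for s t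
  proof -
    have e: "(\<integral>\<^sup>+r\<in>{0..x}. W r \<partial>lborel) = ennreal (v x)" if "x \<le> 1" for x
      using fin'[of 0 x] that by (simp add: v_def less_top)
    have "ennreal (v t) = ennreal (v s) + (\<integral>\<^sup>+r\<in>{s..t}. W r \<partial>lborel)"
      using nn_integral_Icc_split[of W 0 s t] that e[of s] e[of t] by simp
    moreover obtain i where i: "i \<ge> 0" "(\<integral>\<^sup>+r\<in>{s..t}. W r \<partial>lborel) = ennreal i"
      using fin'[OF \<open>0 \<le> s\<close> \<open>t \<le> 1\<close>] by (cases "(\<integral>\<^sup>+r\<in>{s..t}. W r \<partial>lborel)") auto
    moreover have "v s \<ge> 0" "v t \<ge> 0" by (simp_all add: v_def)
    ultimately show ?thesis by (simp add: ennreal_plus[symmetric] del: ennreal_plus)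
  qed
  define T where "T = {t \<in> {0..1}. \<forall>p\<in>D. ennreal \<bar>\<phi> t - \<phi> p\<bar> \<le> (\<integral>\<^sup>+r\<in>{min p t..max p t}. W r \<partial>lborel)}"
  have DT': "D \<subseteq> T"
  proof
    fix q assume q: "q \<in> D"
    have "ennreal \<bar>\<phi> q - \<phi> p\<bar> \<le> (\<integral>\<^sup>+r\<in>{min p q..max p q}. W r \<partial>lborel)" if p: "p \<in> D" for p
      using DD[OF p q] DD[OF q p] by (cases "p \<le> q") (simp_all add: abs_minus_commute)
    then show "q \<in> T" using q D(2) by (auto simp: T_def)
  qed
  have AET: "AE t in lborel. t \<in> {0..1} \<longrightarrow> t \<in> T"
    using DT by eventually_elim (auto simp: T_def)
  have Tle: "\<bar>\<phi> t - \<phi> p\<bar> \<le> \<bar>v t - v p\<bar>" if "t \<in> T" "p \<in> D" for t p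
  proof -
    have tp: "t \<in> {0..1}" "p \<in> {0..1}" "ennreal \<bar>\<phi> t - \<phi> p\<bar> \<le> (\<integral>\<^sup>+r\<in>{min p t..max p t}. W r \<partial>lborel)"
      using that D(2) by (auto simp: T_def)
    show ?thesis
    proof (cases "p \<le> t")
      case True
      then show ?thesis using tp v[of p t] by (simp add: max_absorb2 min_absorb1)
    next
      case False
      then show ?thesis using tp v[of t p] by (simp add: max_absorb1 min_absorb2)
    qed
  qed
  have lt: "\<bar>\<phi> x - \<phi> y\<bar> \<le> \<bar>v x - v y\<bar>" if xy: "x \<in> T" "y \<in> T" "x < y" for x y
  proof -
    obtain p where p: "p \<in> \<rat>" "x < p" "p < y" using Rats_dense_in_real[OF xy(3)] by auto
    have x01: "x \<in> {0..1}" "y \<in> {0..1}" using xy by (auto simp: T_def)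
    then have "p \<in> D" using p D(1) by auto
    moreover have "v x \<le> v p" "v p \<le> v y" using v[of x p] v[of p y] x01 p by auto
    ultimately show ?thesis using Tle[OF xy(1), of p] Tle[OF xy(2), of p] by linarith
  qed
  have le: "\<bar>\<phi> x - \<phi> y\<bar> \<le> \<bar>v x - v y\<bar>" if "x \<in> T" "y \<in> T" for x y
    using lt[of x y] lt[of y x] that by (cases x y rule: linorder_cases) (auto simp: abs_minus_commute)
  have "0 \<in> D" using D(1) by auto
  then have "T \<noteq> {}" using DT' by auto
  obtain F where F: "\<And>x. x \<in> T \<Longrightarrow> F x = \<phi> x" "\<And>x y. \<bar>F x - F y\<bar> \<le> \<bar>v x - v y\<bar>"
    by (rule McShane_extension[OF \<open>T \<noteq> {}\<close> le]) blast+
  show ?thesis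
  proof (rule that[of F])
    show "F t = \<phi> t" if "t \<in> D" for t using F(1) DT' that by auto
    show "AE t in lborel. t \<in> {0..1} \<longrightarrow> F t = \<phi> t" using AET by eventually_elim (auto intro: F)
    show "ennreal \<bar>F t - F s\<bar> \<le> (\<integral>\<^sup>+r\<in>{s..t}. W r \<partial>lborel)" if "0 \<le> s" "s \<le> t" "t \<le> 1" for s t
      using v[OF that] F(2)[of t s] by (simp add: ennreal_leI)
  qed
qed

text \<open>The inequality is known for each fixed pair of times off a null set of curves. Countably
  many pairs are handled by a union of null sets, and pairs of a time in \<open>D\<close> with a
  variable time by Fubini. The rationals contain both end points; the extra time \<open>t0\<close>
  allows a statement about an arbitrary prescribed time, the exceptional curves depending on
  it.\<close>

lemma weak_upper_gradient_representative:
  fixes n :: "'a::{metric_space, second_countable_topology} measure"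
  assumes w: "weak_upper_gradient n f G" and \<pi>: "test_plan n \<pi>" and t0: "t0 \<in> {0..1}"
  shows "AE \<gamma> in \<pi>. \<exists>F. (\<forall>t\<in>insert t0 (\<rat> \<inter> {0..1}). F t = f (apply_bcontfun \<gamma> t)) \<and>
      (AE t in lborel. t \<in> {0..1} \<longrightarrow> F t = f (apply_bcontfun \<gamma> t)) \<and>
      (\<forall>s t. 0 \<le> s \<longrightarrow> s \<le> t \<longrightarrow> t \<le> 1 \<longrightarrow> ennreal \<bar>F t - F s\<bar> \<le> line_int G (apply_bcontfun \<gamma>) s t)"
proof -
  define D where "D = insert t0 (\<rat> \<inter> {0..1})"
  have D: "countable D" "D \<subseteq> {0..1}" using t0 countable_rat by (auto simp: D_def)
  note \<pi>s = test_planD(1)[OF \<pi>]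
  note G[measurable] = weak_upper_gradientD[OF w]
  note [measurable] = measurable_curve_eval[OF \<pi>s] measurable_curve_eval_pair[OF \<pi>s]
    measurable_line_int_pair[OF \<pi>s G(2)]
  interpret pair_sigma_finite \<pi> "lborel :: real measure"
    by (intro pair_sigma_finite_lborel test_planD(2)[OF \<pi>])
  have *: "AE \<gamma> in \<pi>. ennreal \<bar>f (apply_bcontfun \<gamma> t) - f (apply_bcontfun \<gamma> p)\<bar> \<le> line_int G (apply_bcontfun \<gamma>) (min p t) (max p t)"
    if "p \<in> D" "t \<in> {0..1}" for p t
  proof (cases "p \<le> t")
    case True
    then show ?thesis using weak_upper_gradient_subinterval[OF w \<pi>, of p t] that D(2) by auto
  next
    case False
    then show ?thesis using weak_upper_gradient_subinterval[OF w \<pi>, of t p] that D(2)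
      by (auto simp: abs_minus_commute)
  qed
  have "AE \<gamma> in \<pi>. AE t in lborel. t \<in> {0..1} \<longrightarrow>
      ennreal \<bar>f (apply_bcontfun \<gamma> t) - f (apply_bcontfun \<gamma> p)\<bar> \<le> line_int G (apply_bcontfun \<gamma>) (min p t) (max p t)"
    if "p \<in> D" for p
  proof (subst AE_commute)
    have [measurable]: "(\<lambda>x. apply_bcontfun (fst x) p) \<in> borel_measurable (\<pi> \<Otimes>\<^sub>M lborel)"
      by (rule measurable_compose[OF measurable_fst]) (rule measurable_curve_eval[OF \<pi>s])
    show "{x \<in> space (\<pi> \<Otimes>\<^sub>M lborel). snd x \<in> {0..1} \<longrightarrow>
        ennreal \<bar>f (apply_bcontfun (fst x) (snd x)) - f (apply_bcontfun (fst x) p)\<bar>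
          \<le> line_int G (apply_bcontfun (fst x)) (min p (snd x)) (max p (snd x))} \<in> sets (\<pi> \<Otimes>\<^sub>M lborel)"
      by measurable
  qed (use *[OF that] in auto)
  then have "AE \<gamma> in \<pi>. \<forall>p\<in>D. AE t in lborel. t \<in> {0..1} \<longrightarrow>
      ennreal \<bar>f (apply_bcontfun \<gamma> t) - f (apply_bcontfun \<gamma> p)\<bar> \<le> line_int G (apply_bcontfun \<gamma>) (min p t) (max p t)"
    by (simp add: AE_ball_countable[OF D(1)])
  moreover have "AE \<gamma> in \<pi>. \<forall>p\<in>D. \<forall>q\<in>D. ennreal \<bar>f (apply_bcontfun \<gamma> q) - f (apply_bcontfun \<gamma> p)\<bar>
      \<le> line_int G (apply_bcontfun \<gamma>) (min p q) (max p q)"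
    unfolding AE_ball_countable[OF D(1)]
  proof (intro ballI)
    fix p q assume "p \<in> D" "q \<in> D"
    with D(2) show "AE \<gamma> in \<pi>. ennreal \<bar>f (apply_bcontfun \<gamma> q) - f (apply_bcontfun \<gamma> p)\<bar>
      \<le> line_int G (apply_bcontfun \<gamma>) (min p q) (max p q)" by (intro *) auto
  qed
  ultimately show ?thesis
    using weak_upper_gradient_AE[OF w \<pi>]
  proof eventually_elim
    case (elim \<gamma>)
    let ?W = "\<lambda>r. G (apply_bcontfun \<gamma> r) * speed (apply_bcontfun \<gamma>) r"
    have "AE t in lborel. \<forall>p\<in>D. t \<in> {0..1} \<longrightarrow>
        ennreal \<bar>f (apply_bcontfun \<gamma> t) - f (apply_bcontfun \<gamma> p)\<bar> \<le> (\<integral>\<^sup>+r\<in>{min p t..max p t}. ?W r \<partial>lborel)"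
      using elim(1) unfolding line_int_def AE_ball_countable[OF D(1)] .
    then have AE2: "AE t in lborel. t \<in> {0..1} \<longrightarrow> (\<forall>p\<in>D.
      ennreal \<bar>f (apply_bcontfun \<gamma> t) - f (apply_bcontfun \<gamma> p)\<bar> \<le> (\<integral>\<^sup>+r\<in>{min p t..max p t}. ?W r \<partial>lborel))"
      by eventually_elim blast
    have "(\<integral>\<^sup>+r\<in>{0..1}. ?W r \<partial>lborel) < \<infinity>" using elim(3) by (simp add: line_int_def)
    moreover have "\<rat> \<inter> {0..1} \<subseteq> D" by (auto simp: D_def)
    moreover have "ennreal \<bar>f (apply_bcontfun \<gamma> q) - f (apply_bcontfun \<gamma> p)\<bar> \<le> (\<integral>\<^sup>+r\<in>{p..q}. ?W r \<partial>lborel)"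
        if "p \<in> D" "q \<in> D" "p \<le> q" for p q
      using elim(2)[rule_format, OF that(1,2)] that(3) by (simp add: line_int_def min_absorb1 max_absorb2)
    ultimately obtain F where F: "\<And>t. t \<in> D \<Longrightarrow> F t = f (apply_bcontfun \<gamma> t)"
       "AE t in lborel. t \<in> {0..1} \<longrightarrow> F t = f (apply_bcontfun \<gamma> t)"
       "\<And>s t. 0 \<le> s \<Longrightarrow> s \<le> t \<Longrightarrow> t \<le> 1 \<Longrightarrow> ennreal \<bar>F t - F s\<bar> \<le> (\<integral>\<^sup>+r\<in>{s..t}. ?W r \<partial>lborel)"
      by (rule AC_extension[OF measurable_line_int_integrand[OF G(2)] _ _ D(2) _ AE2]) blast+
    then show ?case unfolding D_def[symmetric] line_int_def by (intro exI[of _ F]) auto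
  qed
qed

section \<open>Minimal weak upper gradients\<close>

lemma AC_bound_continuous_on:
  fixes F :: "real \<Rightarrow> real" and W :: "real \<Rightarrow> ennreal"
  assumes [measurable]: "W \<in> borel_measurable borel" and fin: "(\<integral>\<^sup>+r\<in>{0..1}. W r \<partial>lborel) < \<infinity>"
    and le: "\<And>s t. 0 \<le> s \<Longrightarrow> s \<le> t \<Longrightarrow> t \<le> 1 \<Longrightarrow> ennreal \<bar>F t - F s\<bar> \<le> (\<integral>\<^sup>+r\<in>{s..t}. W r \<partial>lborel)"
  shows "continuous_on {0..1} F"
  unfolding continuous_on_iff
proof (intro ballI allI impI)
  fix x e :: real assume x: "x \<in> {0..1}" and e: "e > 0"
  obtain d where d: "d > 0" "(\<integral>\<^sup>+r\<in>{x - d..x + d} \<inter> {0..1}. W r \<partial>lborel) < ennreal e"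
    by (rule nn_integral_Icc_small[OF \<open>W \<in> borel_measurable borel\<close> fin, of "ennreal e" x]) (use e in auto)
  show "\<exists>d>0. \<forall>x'\<in>{0..1}. dist x' x < d \<longrightarrow> dist (F x') (F x) < e"
  proof (intro exI[of _ d] conjI ballI impI d)
    fix y assume y: "y \<in> {0..1}" "dist y x < d"
    have *: "ennreal \<bar>F t - F s\<bar> < ennreal e" if "s \<in> {0..1}" "t \<in> {0..1}" "s \<le> t" "{s..t} \<subseteq> {x - d..x + d}" for s t
    proof -
      have "ennreal \<bar>F t - F s\<bar> \<le> (\<integral>\<^sup>+r\<in>{s..t}. W r \<partial>lborel)" using that by (intro le) auto
      also have "\<dots> \<le> (\<integral>\<^sup>+r\<in>{x - d..x + d} \<inter> {0..1}. W r \<partial>lborel)"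
        using that by (intro nn_integral_Icc_mono_set) auto
      finally show ?thesis using d by (rule_tac le_less_trans)
    qed
    have "ennreal \<bar>F y - F x\<bar> < ennreal e"
    proof (cases "x \<le> y")
      case True
      then show ?thesis using x y d by (intro *) (auto simp: dist_real_def)
    next
      case False
      have "ennreal \<bar>F x - F y\<bar> < ennreal e"
        using False x y d by (intro *) (auto simp: dist_real_def)
      then show ?thesis by (simp add: abs_minus_commute)
    qed
    then show "dist (F y) (F x) < e" using e by (simp add: dist_real_def ennreal_less_iff)
  qed
qed

lemma closure_Rats_unit_interval: "{0..1::real} \<subseteq> closure (\<rat> \<inter> {0..1})"
proof
  fix t :: real assume t: "t \<in> {0..1}"
  show "t \<in> closure (\<rat> \<inter> {0..1})"
    unfolding closure_approachable
  proof (intro allI impI)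
    fix e :: real assume e: "e > 0"
    show "\<exists>y\<in>\<rat> \<inter> {0..1}. dist y t < e"
    proof (cases "t < 1")
      case True
      then obtain r where "r \<in> \<rat>" "t < r" "r < min 1 (t + e)"
        using Rats_dense_in_real[of t "min 1 (t + e)"] e by auto
      then show ?thesis using t by (intro bexI[of _ r]) (auto simp: dist_real_def)
    next
      case False
      then show ?thesis using t e by (intro bexI[of _ 1]) (auto simp: dist_real_def)
    qed
  qed
qed

text \<open>The zero set of a continuous function on the unit interval is compact, so it has a least
  and a greatest element.\<close>

lemma first_last_zero:
  fixes F :: "real \<Rightarrow> real"
  assumes c: "continuous_on {0..1} F" and z: "z \<in> {0..1}" "F z = 0"
  obtains s t where "0 \<le> s" "s \<le> t" "t \<le> 1" "F s = 0" "F t = 0"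
    "\<And>r. 0 \<le> r \<Longrightarrow> r < s \<Longrightarrow> F r \<noteq> 0" "\<And>r. t < r \<Longrightarrow> r \<le> 1 \<Longrightarrow> F r \<noteq> 0"
proof -
  define Z where "Z = {t \<in> {0..1}. F t = 0}"
  have "closed Z" unfolding Z_def using c by (intro continuous_closed_preimage_constant) auto
  moreover have "bounded Z" by (rule bounded_subset[of "{0..1}"]) (auto simp: Z_def)
  ultimately have Z: "compact Z" "Z \<noteq> {}" using z by (auto simp: compact_eq_bounded_closed Z_def)
  obtain s where s: "s \<in> Z" "\<And>r. r \<in> Z \<Longrightarrow> s \<le> r" using compact_attains_inf[OF Z] by blast
  obtain t where t: "t \<in> Z" "\<And>r. r \<in> Z \<Longrightarrow> r \<le> t" using compact_attains_sup[OF Z] by blast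
  have st: "s \<le> t" using s t by blast
  show ?thesis
  proof (rule that[OF _ st])
    show "F r \<noteq> 0" if "0 \<le> r" "r < s" for r
      using s(2)[of r] s(1) that by (auto simp: Z_def)
    show "F r \<noteq> 0" if "t < r" "r \<le> 1" for r
      using t(2)[of r] t(1) that by (auto simp: Z_def)
  qed (use s t in \<open>auto simp: Z_def\<close>)
qed

text \<open>
  The minimum is controlled by the lower derivative: at almost every time it is bounded by both
  integrands.
\<close>

lemma weak_upper_gradient_min:
  fixes n :: "'a::{metric_space, second_countable_topology} measure"
  assumes w1: "weak_upper_gradient n f G" and w2: "weak_upper_gradient n f H"
  shows "weak_upper_gradient n f (\<lambda>x. min (G x) (H x))"
  unfolding weak_upper_gradient_iff
proof (intro conjI allI impI)
  note m[measurable] = weak_upper_gradientD[OF w1] weak_upper_gradientD[OF w2]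
  show "f \<in> borel_measurable borel" "(\<lambda>x. min (G x) (H x)) \<in> borel_measurable borel" by measurable
  fix \<pi> assume \<pi>: "test_plan n \<pi>"
  have zero: "(0::real) \<in> {0..1}" by simp
  show "AE \<gamma> in \<pi>. ennreal \<bar>f (apply_bcontfun \<gamma> 1) - f (apply_bcontfun \<gamma> 0)\<bar>
        \<le> line_int (\<lambda>x. min (G x) (H x)) (apply_bcontfun \<gamma>) 0 1 \<and>
        line_int (\<lambda>x. min (G x) (H x)) (apply_bcontfun \<gamma>) 0 1 < \<infinity>"
    using weak_upper_gradient_representative[OF w1 \<pi> zero] weak_upper_gradient_representative[OF w2 \<pi> zero]
      weak_upper_gradient_AE[OF w1 \<pi>] weak_upper_gradient_AE[OF w2 \<pi>]
  proof eventually_elim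
    case (elim \<gamma>)
    let ?c = "apply_bcontfun \<gamma>"
    let ?WG = "\<lambda>r. G (?c r) * speed ?c r"
    let ?WH = "\<lambda>r. H (?c r) * speed ?c r"
    note [measurable] = measurable_line_int_integrand[OF m(2), of \<gamma>] measurable_line_int_integrand[OF m(4), of \<gamma>]
    from elim(1) obtain F where F: "\<forall>t\<in>insert 0 (\<rat> \<inter> {0..1}). F t = f (?c t)"
      "\<forall>s t. 0 \<le> s \<longrightarrow> s \<le> t \<longrightarrow> t \<le> 1 \<longrightarrow> ennreal \<bar>F t - F s\<bar> \<le> (\<integral>\<^sup>+r\<in>{s..t}. ?WG r \<partial>lborel)"
      unfolding line_int_def by blast
    from elim(2) obtain F' where F': "\<forall>t\<in>insert 0 (\<rat> \<inter> {0..1}). F' t = f (?c t)"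
      "\<forall>s t. 0 \<le> s \<longrightarrow> s \<le> t \<longrightarrow> t \<le> 1 \<longrightarrow> ennreal \<bar>F' t - F' s\<bar> \<le> (\<integral>\<^sup>+r\<in>{s..t}. ?WH r \<partial>lborel)"
      unfolding line_int_def by blast
    have finG: "(\<integral>\<^sup>+r\<in>{0..1}. ?WG r \<partial>lborel) < \<infinity>" and finH: "(\<integral>\<^sup>+r\<in>{0..1}. ?WH r \<partial>lborel) < \<infinity>"
      using elim(3,4) by (auto simp: line_int_def)
    have c1: "continuous_on {0..1} F"
      by (rule AC_bound_continuous_on[of ?WG]) (use F(2) finG in auto)
    have c2: "continuous_on {0..1} F'"
      by (rule AC_bound_continuous_on[of ?WH]) (use F'(2) finH in auto)
    note cont = c1 c2
    \<comment> \<open>Each gradient comes with its own representative; both equal \<open>f\<close>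
      along the curve at rational times, so continuity identifies them. A single function is thus
      controlled by both integrands.\<close>
    have eq: "F t = F' t" if "t \<in> {0..1}" for t
    proof -
      have sub: "closure (\<rat> \<inter> {0..1}) \<subseteq> {0..1::real}" by (intro closure_minimal) auto
      have "continuous_on (closure (\<rat> \<inter> {0..1})) (\<lambda>t. F t - F' t)"
        using cont by (intro continuous_on_subset[OF _ sub] continuous_intros)
      then have "F t - F' t = 0"
        by (rule continuous_constant_on_closure) (use F(1) F'(1) that closure_Rats_unit_interval in auto)
      then show ?thesis by simp
    qed
    have Feq: "ennreal \<bar>F t - F s\<bar> \<le> (\<integral>\<^sup>+r\<in>{s..t}. ?WH r \<partial>lborel)" if "0 \<le> s" "s \<le> t" "t \<le> 1" for s t
      using F'(2)[rule_format, OF that] eq[of s] eq[of t] that by simp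
    have "AE t in lborel. 0 < t \<and> t < 1 \<longrightarrow> speed F t \<le> ?WG t"
      using finG F(2) by (intro speed_le_of_bound) (auto simp: dist_real_def abs_minus_commute)
    moreover have "AE t in lborel. 0 < t \<and> t < 1 \<longrightarrow> speed F t \<le> ?WH t"
      using finH Feq by (intro speed_le_of_bound) (auto simp: dist_real_def abs_minus_commute)
    ultimately have "AE t in lborel. 0 < t \<and> t < 1 \<longrightarrow> speed F t \<le> min (G (?c t)) (H (?c t)) * speed ?c t"
      by eventually_elim (auto simp: min_def)
    then have "ennreal (dist (F 0) (F 1)) \<le> (\<integral>\<^sup>+r\<in>{0..1}. min (G (?c r)) (H (?c r)) * speed ?c r \<partial>lborel)"
    proof (rule dist_le_integral_of_speed_le[where v = ?WG, rotated -1])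
      show "(\<lambda>r. min (G (?c r)) (H (?c r)) * speed ?c r) \<in> borel_measurable borel"
        by (rule measurable_line_int_integrand) measurable
    qed (use finG F(2) in \<open>auto simp: dist_real_def abs_minus_commute\<close>)
    moreover have "F 1 = f (?c 1)" using F(1) by auto
    moreover have "line_int (\<lambda>x. min (G x) (H x)) ?c 0 1 \<le> line_int G ?c 0 1"
      unfolding line_int_def by (intro nn_integral_mono mult_right_mono) auto
    then have "line_int (\<lambda>x. min (G x) (H x)) ?c 0 1 < \<infinity>" using elim(3) by (auto intro: le_less_trans)
    ultimately show ?case using F(1) by (simp add: line_int_def dist_real_def abs_minus_commute)
  qed
qed

text \<open>False for \<open>c = \<infinity>\<close> if the infimum is zero but no
  \<open>a k\<close> is. Applied with \<open>c\<close> the speed, which is finite at almost every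
  time.\<close>

lemma INF_mult_le_ennreal:
  fixes a :: "nat \<Rightarrow> ennreal"
  assumes "decseq a" "c < \<infinity>"
  shows "(INF k. a k * c) \<le> (INF k. a k) * c"
proof -
  have "(\<lambda>k. c * a k) \<longlonglongrightarrow> c * (INF k. a k)"
    using assms by (intro ennreal_tendsto_cmult LIMSEQ_INF) auto
  moreover have "(INF k. a k * c) \<le> c * a k" for k
    by (rule INF_lower2[of k]) (auto simp: mult.commute)
  ultimately have "(INF k. a k * c) \<le> c * (INF k. a k)"
    by (intro LIMSEQ_le_const) auto
  then show ?thesis by (simp add: mult.commute)
qed

text \<open>Monotone convergence for decreasing integrands, justified by the finite line integral of
  \<open>G 0\<close> along almost every curve.\<close>

lemma weak_upper_gradient_INF:
  fixes n :: "'a::{metric_space, second_countable_topology} measure" and G :: "nat \<Rightarrow> 'a \<Rightarrow> ennreal"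
  assumes w: "\<And>k. weak_upper_gradient n f (G k)" and dec: "\<And>x. decseq (\<lambda>k. G k x)"
  shows "weak_upper_gradient n f (\<lambda>x. INF k. G k x)"
  unfolding weak_upper_gradient_iff
proof (intro conjI allI impI)
  note m[measurable] = weak_upper_gradientD[OF w]
  show "f \<in> borel_measurable borel" "(\<lambda>x. INF k. G k x) \<in> borel_measurable borel" by measurable
  fix \<pi> assume \<pi>: "test_plan n \<pi>"
  have "AE \<gamma> in \<pi>. \<forall>k. ennreal \<bar>f (apply_bcontfun \<gamma> 1) - f (apply_bcontfun \<gamma> 0)\<bar>
        \<le> line_int (G k) (apply_bcontfun \<gamma>) 0 1 \<and> line_int (G k) (apply_bcontfun \<gamma>) 0 1 < \<infinity>"
    unfolding AE_all_countable by (intro allI weak_upper_gradient_AE[OF w \<pi>])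
  with test_planD(4)[OF \<pi>] show "AE \<gamma> in \<pi>. ennreal \<bar>f (apply_bcontfun \<gamma> 1) - f (apply_bcontfun \<gamma> 0)\<bar>
        \<le> line_int (\<lambda>x. INF k. G k x) (apply_bcontfun \<gamma>) 0 1 \<and>
        line_int (\<lambda>x. INF k. G k x) (apply_bcontfun \<gamma>) 0 1 < \<infinity>"
  proof eventually_elim
    case (elim \<gamma>)
    let ?c = "apply_bcontfun \<gamma>"
    note [measurable] = measurable_line_int_integrand[OF m(2), of _ \<gamma>]
    have sp[measurable]: "speed ?c \<in> borel_measurable borel"
      by (intro borel_measurable_speed continuous_on_bcontfun)
    have "(\<integral>\<^sup>+r\<in>{0..1}. (speed ?c r)\<^sup>2 \<partial>lborel) < \<infinity>"
      using elim(1) by (simp add: regular_curve_def energy_def)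
    then have "(\<integral>\<^sup>+r\<in>{0..1}. speed ?c r \<partial>lborel) < \<infinity>" by (rule nn_integral_le_of_square[OF sp])
    then have "AE r in lborel. speed ?c r * indicator {0..1} r \<noteq> \<infinity>"
      by (intro nn_integral_PInf_AE) auto
    then have AE: "AE r in lborel. (INF k. G k (?c r) * speed ?c r * indicator {0..1} r) \<le> (INF k. G k (?c r)) * speed ?c r * indicator {0..1} r"
    proof eventually_elim
      case (elim r)
      show ?case
      proof (cases "r \<in> {0..1}")
        case True
        with elim have "speed ?c r < \<infinity>" by (simp add: less_top)
        with INF_mult_le_ennreal[OF dec] True show ?thesis by simp
      qed simp
    qed
    have "ennreal \<bar>f (?c 1) - f (?c 0)\<bar> \<le> (INF k. line_int (G k) ?c 0 1)"
      using elim(2) by (intro INF_greatest) auto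
    also have "\<dots> = (\<integral>\<^sup>+r. (INF k. G k (?c r) * speed ?c r * indicator {0..1} r) \<partial>lborel)"
      unfolding line_int_def
    proof (rule nn_integral_monotone_convergence_INF_AE[symmetric, where i = 0])
      show "AE r in lborel. G (Suc i) (?c r) * speed ?c r * indicator {0..1} r
          \<le> G i (?c r) * speed ?c r * indicator {0..1} r" for i
        using dec by (intro AE_I2 mult_right_mono) (auto simp: decseq_Suc_iff)
      show "(\<integral>\<^sup>+r. G 0 (?c r) * speed ?c r * indicator {0..1} r \<partial>lborel) < \<infinity>"
        using elim(2) by (auto simp: line_int_def)
    qed measurable
    also have "\<dots> \<le> line_int (\<lambda>x. INF k. G k x) ?c 0 1"
      unfolding line_int_def by (rule nn_integral_mono_AE[OF AE])
    finally have "ennreal \<bar>f (?c 1) - f (?c 0)\<bar> \<le> line_int (\<lambda>x. INF k. G k x) ?c 0 1" .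
    moreover have "line_int (\<lambda>x. INF k. G k x) ?c 0 1 \<le> line_int (G 0) ?c 0 1"
      unfolding line_int_def by (intro nn_integral_mono mult_right_mono INF_lower) auto
    ultimately show ?case using elim(2) by (auto intro: le_less_trans)
  qed
qed

section \<open>Existence and pointwise minimality of the minimal gradient\<close>

lemma ennreal_power2_le_imp_le:
  fixes x y :: ennreal
  assumes "x\<^sup>2 \<le> y\<^sup>2"
  shows "x \<le> y"
proof (cases x; cases y)
  fix r s :: real assume "0 \<le> r" "x = ennreal r" "0 \<le> s" "y = ennreal s"
  then show ?thesis using assms by (auto simp: ennreal_power intro!: ennreal_leI power2_le_imp_le)
qed (use assms in \<open>auto simp: ennreal_power power2_eq_square top_unique ennreal_mult_eq_top_iff ennreal_mult_top\<close>)

text \<open>Weak upper gradients are closed under minima and under decreasing limits, so the running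
  minima \<open>M\<close> of a minimizing sequence decrease to a weak upper gradient
  \<open>K\<close> that attains the infimum of the norms.\<close>

lemma min_weak_upper_gradient_exists:
  fixes n :: "'a::{metric_space, second_countable_topology} measure"
  assumes f: "f \<in> S2 n" and n: "sets n = sets borel"
  shows "\<exists>G. weak_upper_gradient n f G \<and> (\<integral>\<^sup>+x. (G x)\<^sup>2 \<partial>n) < \<infinity> \<and>
        (\<forall>H. weak_upper_gradient n f H \<longrightarrow> (\<integral>\<^sup>+x. (G x)\<^sup>2 \<partial>n) \<le> (\<integral>\<^sup>+x. (H x)\<^sup>2 \<partial>n))"
proof -
  define \<G> where "\<G> = {G. weak_upper_gradient n f G}"
  define A where "A = (\<lambda>G. \<integral>\<^sup>+x. (G x)\<^sup>2 \<partial>n) ` \<G>"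
  obtain G0 where G0: "weak_upper_gradient n f G0" "(\<integral>\<^sup>+x. (G0 x)\<^sup>2 \<partial>n) < \<infinity>"
    using f by (auto simp: S2_def)
  then have "A \<noteq> {}" by (auto simp: A_def \<G>_def)
  from ennreal_Inf_countable_INF[OF this] obtain a :: "nat \<Rightarrow> ennreal" where a: "range a \<subseteq> A" "Inf A = (INF i. a i)"
    by blast
  have "\<forall>k. \<exists>G. weak_upper_gradient n f G \<and> a k = (\<integral>\<^sup>+x. (G x)\<^sup>2 \<partial>n)"
    using a(1) by (auto simp: A_def \<G>_def)
  then obtain G where G: "\<And>k. weak_upper_gradient n f (G k)" "\<And>k. a k = (\<integral>\<^sup>+x. (G k x)\<^sup>2 \<partial>n)"
    by metis
  define M where "M = rec_nat (G 0) (\<lambda>k K x. min (K x) (G (Suc k) x))"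
  have M0: "M 0 = G 0" and MS: "\<And>k. M (Suc k) = (\<lambda>x. min (M k x) (G (Suc k) x))" by (simp_all add: M_def)
  have wM: "weak_upper_gradient n f (M k)" for k
    by (induction k) (auto simp: M0 MS intro: G weak_upper_gradient_min)
  have MG: "M k x \<le> G k x" for k x by (cases k) (auto simp: M0 MS)
  have dec: "decseq (\<lambda>k. M k x)" for x by (intro decseq_SucI) (simp add: MS)
  define K where "K x = (INF k. M k x)" for x
  have wK: "weak_upper_gradient n f K" unfolding K_def using wM dec by (rule weak_upper_gradient_INF)
  have "(\<integral>\<^sup>+x. (K x)\<^sup>2 \<partial>n) \<le> a k" for k
    unfolding G(2) K_def by (intro nn_integral_mono power_mono) (auto intro!: INF_lower2[of k] MG)
  then have "(\<integral>\<^sup>+x. (K x)\<^sup>2 \<partial>n) \<le> Inf A" unfolding a(2) by (intro INF_greatest) auto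
  then have min: "(\<integral>\<^sup>+x. (K x)\<^sup>2 \<partial>n) \<le> (\<integral>\<^sup>+x. (H x)\<^sup>2 \<partial>n)" if "weak_upper_gradient n f H" for H
    using that by (auto simp: A_def \<G>_def intro: order_trans Inf_lower)
  with wK G0 show ?thesis by (intro exI[of _ K]) (auto intro: le_less_trans)
qed

lemma S2_borel_measurable: "f \<in> S2 n \<Longrightarrow> f \<in> borel_measurable borel"
  by (auto simp: S2_def weak_upper_gradient_def)

text \<open>Least norm becomes least almost everywhere: the minimum of the minimizer with a
  competitor \<open>H\<close> is again a weak upper gradient, and if it were smaller than the
  minimizer on a set of positive measure, its finite norm would be strictly smaller.\<close>

lemma min_weak_upper_gradient:
  fixes n :: "'a::{metric_space, second_countable_topology} measure"
  assumes f: "f \<in> S2 n" and n: "sets n = sets borel"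
  shows weak_upper_gradient_min_weak: "weak_upper_gradient n f (min_weak_upper_gradient n f)"
    and nn_integral_min_weak_upper_gradient: "(\<integral>\<^sup>+x. (min_weak_upper_gradient n f x)\<^sup>2 \<partial>n) < \<infinity>"
    and borel_measurable_min_weak_upper_gradient: "min_weak_upper_gradient n f \<in> borel_measurable borel"
    and min_weak_upper_gradient_le: "weak_upper_gradient n f H \<Longrightarrow> AE x in n. min_weak_upper_gradient n f x \<le> H x"
proof -
  let ?D = "min_weak_upper_gradient n f"
  have *: "weak_upper_gradient n f ?D" "(\<integral>\<^sup>+x. (?D x)\<^sup>2 \<partial>n) < \<infinity>"
    "\<And>H. weak_upper_gradient n f H \<Longrightarrow> (\<integral>\<^sup>+x. (?D x)\<^sup>2 \<partial>n) \<le> (\<integral>\<^sup>+x. (H x)\<^sup>2 \<partial>n)"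
    using someI_ex[OF min_weak_upper_gradient_exists[OF f n]] unfolding min_weak_upper_gradient_def by blast+
  show "weak_upper_gradient n f ?D" "(\<integral>\<^sup>+x. (?D x)\<^sup>2 \<partial>n) < \<infinity>" by fact+
  show D: "?D \<in> borel_measurable borel" using *(1) by (rule weak_upper_gradientD)
  assume H: "weak_upper_gradient n f H"
  have [measurable]: "?D \<in> borel_measurable n" "H \<in> borel_measurable n"
    using D weak_upper_gradientD(2)[OF H] n by (simp_all cong: measurable_cong_sets)
  let ?K = "\<lambda>x. min (?D x) (H x)"
  have K: "weak_upper_gradient n f ?K" using *(1) H by (rule weak_upper_gradient_min)
  have K2: "(\<integral>\<^sup>+x. (?K x)\<^sup>2 \<partial>n) \<le> (\<integral>\<^sup>+x. (?D x)\<^sup>2 \<partial>n)"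
    by (intro nn_integral_mono power_mono) auto
  have "AE x in n. (?D x)\<^sup>2 \<le> (?K x)\<^sup>2"
  proof (rule ccontr)
    assume "\<not> ?thesis"
    then have "(\<integral>\<^sup>+x. (?K x)\<^sup>2 \<partial>n) < (\<integral>\<^sup>+x. (?D x)\<^sup>2 \<partial>n)"
      using K2 *(2) by (intro nn_integral_less) (auto intro!: power_mono)
    with *(3)[OF K] show False by simp
  qed
  then show "AE x in n. ?D x \<le> H x"
    by eventually_elim (auto dest: ennreal_power2_le_imp_le)
qed

section \<open>Calculus rules\<close>

lemma line_int_add:
  fixes \<gamma> :: "real \<Rightarrow>\<^sub>C 'a::{metric_space, second_countable_topology}"
  assumes "G \<in> borel_measurable borel" "H \<in> borel_measurable borel"
  shows "line_int (\<lambda>x. G x + H x) (apply_bcontfun \<gamma>) s t = line_int G (apply_bcontfun \<gamma>) s t + line_int H (apply_bcontfun \<gamma>) s t"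
proof -
  note [measurable] = measurable_line_int_integrand[OF assms(1), of \<gamma>] measurable_line_int_integrand[OF assms(2), of \<gamma>]
  show ?thesis unfolding line_int_def by (subst nn_integral_add[symmetric]) (auto simp: distrib_right)
qed

lemma line_int_cmult:
  fixes \<gamma> :: "real \<Rightarrow>\<^sub>C 'a::{metric_space, second_countable_topology}"
  assumes "G \<in> borel_measurable borel"
  shows "line_int (\<lambda>x. c * G x) (apply_bcontfun \<gamma>) s t = c * line_int G (apply_bcontfun \<gamma>) s t"
proof -
  note [measurable] = measurable_line_int_integrand[OF assms(1), of \<gamma>]
  have "(\<integral>\<^sup>+r. c * (G (apply_bcontfun \<gamma> r) * speed (apply_bcontfun \<gamma>) r * indicator {s..t} r) \<partial>lborel)
      = c * line_int G (apply_bcontfun \<gamma>) s t"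
    unfolding line_int_def by (rule nn_integral_cmult) measurable
  then show ?thesis unfolding line_int_def by (simp add: mult.assoc)
qed

lemma line_int_mono: "(\<And>x. G x \<le> H x) \<Longrightarrow> line_int G c s t \<le> line_int H c s t"
  unfolding line_int_def by (intro nn_integral_mono mult_right_mono) auto

lemma weak_upper_gradient_lipschitz:
  fixes n :: "'a::{metric_space, second_countable_topology} measure"
  assumes w: "weak_upper_gradient n f G" and u: "u \<in> borel_measurable borel" and L: "L \<ge> 0"
    and le: "\<And>x y. \<bar>u x - u y\<bar> \<le> L * \<bar>f x - f y\<bar>"
  shows "weak_upper_gradient n u (\<lambda>x. ennreal L * G x)"
  unfolding weak_upper_gradient_iff
proof (intro conjI allI impI u)
  note G[measurable] = weak_upper_gradientD(2)[OF w]
  show "(\<lambda>x. ennreal L * G x) \<in> borel_measurable borel" by measurable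
  fix \<pi> assume "test_plan n \<pi>"
  from weak_upper_gradient_AE[OF w this]
  show "AE \<gamma> in \<pi>. ennreal \<bar>u (apply_bcontfun \<gamma> 1) - u (apply_bcontfun \<gamma> 0)\<bar>
        \<le> line_int (\<lambda>x. ennreal L * G x) (apply_bcontfun \<gamma>) 0 1 \<and>
        line_int (\<lambda>x. ennreal L * G x) (apply_bcontfun \<gamma>) 0 1 < \<infinity>"
  proof eventually_elim
    case (elim \<gamma>)
    have "ennreal \<bar>u (apply_bcontfun \<gamma> 1) - u (apply_bcontfun \<gamma> 0)\<bar> \<le> ennreal L * ennreal \<bar>f (apply_bcontfun \<gamma> 1) - f (apply_bcontfun \<gamma> 0)\<bar>"
      using L le by (simp add: ennreal_mult[symmetric] ennreal_leI)
    also have "\<dots> \<le> ennreal L * line_int G (apply_bcontfun \<gamma>) 0 1"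
      using elim by (intro mult_left_mono) auto
    finally show ?case using elim by (simp add: line_int_cmult[OF G] ennreal_mult_less_top)
  qed
qed

lemma weak_upper_gradient_add:
  fixes n :: "'a::{metric_space, second_countable_topology} measure"
  assumes w1: "weak_upper_gradient n f G" and w2: "weak_upper_gradient n h H"
  shows "weak_upper_gradient n (\<lambda>x. f x + h x) (\<lambda>x. G x + H x)"
  unfolding weak_upper_gradient_iff
proof (intro conjI allI impI)
  note m[measurable] = weak_upper_gradientD[OF w1] weak_upper_gradientD[OF w2]
  show "(\<lambda>x. f x + h x) \<in> borel_measurable borel" "(\<lambda>x. G x + H x) \<in> borel_measurable borel" by measurable
  fix \<pi> assume \<pi>: "test_plan n \<pi>"
  from weak_upper_gradient_AE[OF w1 \<pi>] weak_upper_gradient_AE[OF w2 \<pi>]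
  show "AE \<gamma> in \<pi>. ennreal \<bar>f (apply_bcontfun \<gamma> 1) + h (apply_bcontfun \<gamma> 1) - (f (apply_bcontfun \<gamma> 0) + h (apply_bcontfun \<gamma> 0))\<bar>
        \<le> line_int (\<lambda>x. G x + H x) (apply_bcontfun \<gamma>) 0 1 \<and>
        line_int (\<lambda>x. G x + H x) (apply_bcontfun \<gamma>) 0 1 < \<infinity>"
  proof eventually_elim
    case (elim \<gamma>)
    have "ennreal \<bar>f (apply_bcontfun \<gamma> 1) + h (apply_bcontfun \<gamma> 1) - (f (apply_bcontfun \<gamma> 0) + h (apply_bcontfun \<gamma> 0))\<bar>
        \<le> ennreal (\<bar>f (apply_bcontfun \<gamma> 1) - f (apply_bcontfun \<gamma> 0)\<bar> + \<bar>h (apply_bcontfun \<gamma> 1) - h (apply_bcontfun \<gamma> 0)\<bar>)"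
      by (intro ennreal_leI) linarith
    also have "\<dots> = ennreal \<bar>f (apply_bcontfun \<gamma> 1) - f (apply_bcontfun \<gamma> 0)\<bar> + ennreal \<bar>h (apply_bcontfun \<gamma> 1) - h (apply_bcontfun \<gamma> 0)\<bar>"
      by (rule ennreal_plus) auto
    also have "\<dots> \<le> line_int G (apply_bcontfun \<gamma>) 0 1 + line_int H (apply_bcontfun \<gamma>) 0 1"
      using elim by (intro add_mono) auto
    finally show ?case using elim by (simp add: line_int_add[OF m(2,4)])
  qed
qed

text \<open>Along a given curve the increment of \<open>u\<close> is bounded by that of
  \<open>f\<close> or by that of \<open>h\<close>; the maximum of the two gradients covers both
  cases. Suited to truncations.\<close>

lemma weak_upper_gradient_max:
  fixes n :: "'a::{metric_space, second_countable_topology} measure"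
  assumes w1: "weak_upper_gradient n f G" and w2: "weak_upper_gradient n h H" and u: "u \<in> borel_measurable borel"
    and le: "\<And>x y. \<bar>u x - u y\<bar> \<le> max \<bar>f x - f y\<bar> \<bar>h x - h y\<bar>"
  shows "weak_upper_gradient n u (\<lambda>x. max (G x) (H x))"
  unfolding weak_upper_gradient_iff
proof (intro conjI allI impI u)
  note m[measurable] = weak_upper_gradientD[OF w1] weak_upper_gradientD[OF w2]
  show "(\<lambda>x. max (G x) (H x)) \<in> borel_measurable borel" by measurable
  fix \<pi> assume \<pi>: "test_plan n \<pi>"
  from weak_upper_gradient_AE[OF w1 \<pi>] weak_upper_gradient_AE[OF w2 \<pi>]
  show "AE \<gamma> in \<pi>. ennreal \<bar>u (apply_bcontfun \<gamma> 1) - u (apply_bcontfun \<gamma> 0)\<bar>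
        \<le> line_int (\<lambda>x. max (G x) (H x)) (apply_bcontfun \<gamma>) 0 1 \<and>
        line_int (\<lambda>x. max (G x) (H x)) (apply_bcontfun \<gamma>) 0 1 < \<infinity>"
  proof eventually_elim
    case (elim \<gamma>)
    let ?c = "apply_bcontfun \<gamma>"
    have G: "line_int G ?c 0 1 \<le> line_int (\<lambda>x. max (G x) (H x)) ?c 0 1"
      and H: "line_int H ?c 0 1 \<le> line_int (\<lambda>x. max (G x) (H x)) ?c 0 1"
      by (intro line_int_mono; simp)+
    have "line_int (\<lambda>x. max (G x) (H x)) ?c 0 1 \<le> line_int (\<lambda>x. G x + H x) ?c 0 1"
      by (intro line_int_mono) (simp add: add_increasing add_increasing2)
    then have fin: "line_int (\<lambda>x. max (G x) (H x)) ?c 0 1 < \<infinity>"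
      using elim by (auto simp: line_int_add[OF m(2,4)] intro: le_less_trans)
    from le[of "?c 1" "?c 0"]
    have "\<bar>u (?c 1) - u (?c 0)\<bar> \<le> \<bar>f (?c 1) - f (?c 0)\<bar> \<or> \<bar>u (?c 1) - u (?c 0)\<bar> \<le> \<bar>h (?c 1) - h (?c 0)\<bar>"
      by linarith
    then have "ennreal \<bar>u (?c 1) - u (?c 0)\<bar> \<le> line_int (\<lambda>x. max (G x) (H x)) ?c 0 1"
      using elim G H by (auto intro: order_trans[OF ennreal_leI])
    with fin show ?case by simp
  qed
qed

lemma weak_upper_gradient_AE_cong:
  fixes n :: "'a::{metric_space, second_countable_topology} measure"
  assumes w: "weak_upper_gradient n f G" and n: "sets n = sets borel"
    and u: "u \<in> borel_measurable borel" and eq: "AE x in n. u x = f x"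
  shows "weak_upper_gradient n u G"
  unfolding weak_upper_gradient_iff
proof (intro conjI allI impI u weak_upper_gradientD(2)[OF w])
  fix \<pi> assume \<pi>: "test_plan n \<pi>"
  show "AE \<gamma> in \<pi>. ennreal \<bar>u (apply_bcontfun \<gamma> 1) - u (apply_bcontfun \<gamma> 0)\<bar>
        \<le> line_int G (apply_bcontfun \<gamma>) 0 1 \<and> line_int G (apply_bcontfun \<gamma>) 0 1 < \<infinity>"
    using weak_upper_gradient_AE[OF w \<pi>] AE_test_plan_eval[OF \<pi> n eq, of 0] AE_test_plan_eval[OF \<pi> n eq, of 1]
    by (auto elim: eventually_elim2)
qed

text \<open>
  Along a curve that meets the zero set, only the pieces before the first and after the last zero
  contribute to the increment.
\<close>

lemma weak_upper_gradient_nonzero: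
  fixes n :: "'a::{metric_space, second_countable_topology} measure"
  assumes w: "weak_upper_gradient n d G"
  shows "weak_upper_gradient n d (\<lambda>x. if d x = 0 then 0 else G x)"
  unfolding weak_upper_gradient_iff
proof (intro conjI allI impI)
  note m[measurable] = weak_upper_gradientD[OF w]
  let ?H = "\<lambda>x. if d x = 0 then 0 else G x"
  show "d \<in> borel_measurable borel" by measurable
  show H: "?H \<in> borel_measurable borel" by measurable
  fix \<pi> assume \<pi>: "test_plan n \<pi>"
  have zero: "(0::real) \<in> {0..1}" by simp
  show "AE \<gamma> in \<pi>. ennreal \<bar>d (apply_bcontfun \<gamma> 1) - d (apply_bcontfun \<gamma> 0)\<bar>
        \<le> line_int ?H (apply_bcontfun \<gamma>) 0 1 \<and> line_int ?H (apply_bcontfun \<gamma>) 0 1 < \<infinity>"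
    using weak_upper_gradient_representative[OF w \<pi> zero] weak_upper_gradient_AE[OF w \<pi>]
  proof eventually_elim
    case (elim \<gamma>)
    let ?c = "apply_bcontfun \<gamma>"
    note mI[measurable] = measurable_line_int_integrand[OF m(2), of \<gamma>] measurable_line_int_integrand[OF H, of \<gamma>]
    from elim(1) obtain F where F: "\<forall>t\<in>insert 0 (\<rat> \<inter> {0..1}). F t = d (?c t)"
      "AE t in lborel. t \<in> {0..1} \<longrightarrow> F t = d (?c t)"
      "\<forall>s t. 0 \<le> s \<longrightarrow> s \<le> t \<longrightarrow> t \<le> 1 \<longrightarrow> ennreal \<bar>F t - F s\<bar> \<le> line_int G ?c s t"
      by blast
    have c: "continuous_on {0..1} F"
      by (rule AC_bound_continuous_on[OF mI(1)]) (use F(3) elim(2) in \<open>auto simp: line_int_def\<close>)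
    \<comment> \<open>Between zeros of \<open>F\<close> the integrands agree at almost every time,
      because \<open>F\<close> equals \<open>d\<close> along the curve there.\<close>
    have eqI: "line_int G ?c s t \<le> line_int ?H ?c s t" if "0 \<le> s" "t \<le> 1" "\<And>r. s < r \<Longrightarrow> r < t \<Longrightarrow> F r \<noteq> 0" for s t
      unfolding line_int_def
    proof (intro nn_integral_mono_AE)
      show "AE r in lborel. G (?c r) * speed ?c r * indicator {s..t} r \<le> ?H (?c r) * speed ?c r * indicator {s..t} r"
        using F(2) AE_lborel_singleton[of s] AE_lborel_singleton[of t]
      proof eventually_elim
        case (elim r)
        show ?case
        proof (cases "r \<in> {s..t}")
          case True
          then have "F r \<noteq> 0" "r \<in> {0..1}" using elim that by auto
          then show ?thesis using elim by simp
        qed simp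
      qed
    qed
    have ends: "F 0 = d (?c 0)" "F 1 = d (?c 1)" using F(1) by auto
    have "line_int ?H ?c 0 1 \<le> line_int G ?c 0 1" by (rule line_int_mono) simp
    then have fin: "line_int ?H ?c 0 1 < \<infinity>" using elim(2) by (auto intro: le_less_trans)
    have "ennreal \<bar>F 1 - F 0\<bar> \<le> line_int ?H ?c 0 1"
    proof (cases "\<exists>z\<in>{0..1}. F z = 0")
      case False
      have "ennreal \<bar>F 1 - F 0\<bar> \<le> line_int G ?c 0 1" using F(3) by simp
      also have "\<dots> \<le> line_int ?H ?c 0 1" by (rule eqI) (use False in auto)
      finally show ?thesis .
    next
      case True
      then obtain s t where st: "0 \<le> s" "s \<le> t" "t \<le> 1" "F s = 0" "F t = 0"
        "\<And>r. 0 \<le> r \<Longrightarrow> r < s \<Longrightarrow> F r \<noteq> 0" "\<And>r. t < r \<Longrightarrow> r \<le> 1 \<Longrightarrow> F r \<noteq> 0"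
        using first_last_zero[OF c] by blast
      have "ennreal \<bar>F 1 - F 0\<bar> \<le> ennreal (\<bar>F s - F 0\<bar> + \<bar>F 1 - F t\<bar>)"
        using st by (intro ennreal_leI) auto
      also have "\<dots> = ennreal \<bar>F s - F 0\<bar> + ennreal \<bar>F 1 - F t\<bar>"
        by (rule ennreal_plus) auto
      also have "\<dots> \<le> line_int G ?c 0 s + line_int G ?c t 1"
        using F(3)[rule_format, of 0 s] F(3)[rule_format, of t 1] st by (intro add_mono) auto
      also have "\<dots> \<le> line_int ?H ?c 0 s + line_int ?H ?c t 1"
        using st by (intro add_mono eqI) auto
      also have "\<dots> \<le> line_int ?H ?c 0 s + (line_int ?H ?c s t + line_int ?H ?c t 1)"
        by (intro add_left_mono) simp
      also have "\<dots> = line_int ?H ?c 0 1"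
        unfolding line_int_def using st nn_integral_Icc_split[OF mI(2), of s t 1] nn_integral_Icc_split[OF mI(2), of 0 s 1]
        by simp
      finally show ?thesis .
    qed
    with fin show ?case by (simp add: ends)
  qed
qed

text \<open>Cutting the constant \<open>L\<close> to zero where \<open>\<phi>\<close> vanishes makes
  it square integrable as soon as \<open>\<phi>\<close> lives on a set of finite measure.\<close>

lemma weak_upper_gradient_of_lipschitz:
  fixes n :: "'a::{metric_space, second_countable_topology} measure" and \<phi> :: "'a \<Rightarrow> real"
  assumes lip: "L-lipschitz_on UNIV \<phi>"
  shows "weak_upper_gradient n \<phi> (\<lambda>x. if \<phi> x = 0 then 0 else ennreal L)"
proof (rule weak_upper_gradient_nonzero)
  have L: "L \<ge> 0" using lip by (rule lipschitz_on_nonneg)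
  have \<phi>: "\<phi> \<in> borel_measurable borel"
    using lipschitz_on_continuous_on[OF lip] by (rule borel_measurable_continuous_onI)
  show "weak_upper_gradient n \<phi> (\<lambda>x. ennreal L)"
    unfolding weak_upper_gradient_iff
  proof (intro conjI allI impI \<phi>)
    fix \<pi> assume \<pi>: "test_plan n \<pi>"
    show "AE \<gamma> in \<pi>. ennreal \<bar>\<phi> (apply_bcontfun \<gamma> 1) - \<phi> (apply_bcontfun \<gamma> 0)\<bar>
        \<le> line_int (\<lambda>x. ennreal L) (apply_bcontfun \<gamma>) 0 1 \<and> line_int (\<lambda>x. ennreal L) (apply_bcontfun \<gamma>) 0 1 < \<infinity>"
      using test_planD(4)[OF \<pi>]
    proof eventually_elim
      case (elim \<gamma>)
      let ?c = "apply_bcontfun \<gamma>"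
      have sp[measurable]: "speed ?c \<in> borel_measurable borel"
        by (intro borel_measurable_speed continuous_on_bcontfun)
      have eq: "line_int (\<lambda>x. ennreal L) ?c 0 1 = ennreal L * (\<integral>\<^sup>+r\<in>{0..1}. speed ?c r \<partial>lborel)"
        unfolding line_int_def by (subst nn_integral_cmult[symmetric]) (auto simp: mult.assoc)
      have "(\<integral>\<^sup>+r\<in>{0..1}. speed ?c r \<partial>lborel) < \<infinity>"
        by (rule nn_integral_le_of_square[OF sp]) (use elim in \<open>simp add: regular_curve_def energy_def\<close>)
      moreover have "\<bar>\<phi> (?c 1) - \<phi> (?c 0)\<bar> \<le> L * dist (?c 0) (?c 1)"
        using lipschitz_onD[OF lip, of "?c 1" "?c 0"] by (simp add: dist_real_def dist_commute)
      then have "ennreal \<bar>\<phi> (?c 1) - \<phi> (?c 0)\<bar> \<le> ennreal L * ennreal (dist (?c 0) (?c 1))"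
        using L by (simp add: ennreal_mult[symmetric] ennreal_leI)
      moreover have "ennreal L * ennreal (dist (?c 0) (?c 1)) \<le> ennreal L * (\<integral>\<^sup>+r\<in>{0..1}. speed ?c r \<partial>lborel)"
        by (intro mult_left_mono regular_curve_dist_le[OF elim continuous_on_bcontfun]) auto
      ultimately show ?case by (auto simp: eq ennreal_mult_less_top intro: order_trans)
    qed
  qed simp
qed

section \<open>Sobolev functions: linear structure and locality of the minimal gradient\<close>

lemma nn_integral_power2_cmult_finite:
  assumes "(\<integral>\<^sup>+x. (G x)\<^sup>2 \<partial>n) < \<infinity>" "G \<in> borel_measurable n"
  shows "(\<integral>\<^sup>+x. (ennreal L * G x)\<^sup>2 \<partial>n) < \<infinity>"
proof -
  have "(ennreal L)\<^sup>2 < \<infinity>" by (simp add: power2_eq_square ennreal_mult_less_top)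
  with assms show ?thesis by (simp add: power_mult_distrib nn_integral_cmult ennreal_mult_less_top)
qed

lemma ennreal_add_power2_le: "(x + y)\<^sup>2 \<le> 4 * x\<^sup>2 + 4 * (y::ennreal)\<^sup>2"
proof -
  have "x + y \<le> 2 * max x y" by (metis add_mono max.cobounded1 max.cobounded2 mult_2)
  then have "(x + y)\<^sup>2 \<le> (2 * max x y)\<^sup>2" by (intro power_mono) auto
  also have "\<dots> = 4 * (max x y)\<^sup>2" by (simp add: power_mult_distrib)
  also have "(max x y)\<^sup>2 \<le> x\<^sup>2 + y\<^sup>2" by (simp add: max_def)
  finally show ?thesis by (simp add: distrib_left mult_left_mono)
qed

lemma nn_integral_power2_add_finite:
  assumes "(\<integral>\<^sup>+x. (G x)\<^sup>2 \<partial>n) < \<infinity>" "(\<integral>\<^sup>+x. (H x)\<^sup>2 \<partial>n) < \<infinity>"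
    and [measurable]: "G \<in> borel_measurable n" "H \<in> borel_measurable n"
  shows "(\<integral>\<^sup>+x. (G x + H x)\<^sup>2 \<partial>n) < \<infinity>"
proof -
  have "(\<integral>\<^sup>+x. (G x + H x)\<^sup>2 \<partial>n) \<le> (\<integral>\<^sup>+x. 4 * (G x)\<^sup>2 + 4 * (H x)\<^sup>2 \<partial>n)"
    by (intro nn_integral_mono ennreal_add_power2_le)
  also have "\<dots> < \<infinity>" using assms by (simp add: nn_integral_add nn_integral_cmult ennreal_mult_less_top)
  finally show ?thesis .
qed

lemma S2I: "weak_upper_gradient n f G \<Longrightarrow> (\<integral>\<^sup>+x. (G x)\<^sup>2 \<partial>n) < \<infinity> \<Longrightarrow> f \<in> S2 n"
  by (auto simp: S2_def)

context
  fixes n :: "'a::{metric_space, second_countable_topology} measure"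
  assumes n: "sets n = sets borel"
begin

lemma borel_measurable_eq: "borel_measurable n = borel_measurable borel"
  by (intro measurable_cong_sets n refl)

lemma
  assumes f: "f \<in> S2 n" and u: "u \<in> borel_measurable borel" and L: "L \<ge> 0"
    and le: "\<And>x y. \<bar>u x - u y\<bar> \<le> L * \<bar>f x - f y\<bar>"
  shows S2_lipschitz: "u \<in> S2 n"
    and min_weak_upper_gradient_lipschitz: "AE x in n. min_weak_upper_gradient n u x \<le> ennreal L * min_weak_upper_gradient n f x"
proof -
  note w = weak_upper_gradient_lipschitz[OF weak_upper_gradient_min_weak[OF f n] u L le]
  show "u \<in> S2 n"
    using w nn_integral_min_weak_upper_gradient[OF f n] borel_measurable_min_weak_upper_gradient[OF f n]
    by (intro S2I[OF w] nn_integral_power2_cmult_finite) (auto simp: borel_measurable_eq)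
  then show "AE x in n. min_weak_upper_gradient n u x \<le> ennreal L * min_weak_upper_gradient n f x"
    using n w by (rule min_weak_upper_gradient_le)
qed

lemma
  assumes f: "f \<in> S2 n" and h: "h \<in> S2 n"
  shows S2_add: "(\<lambda>x. f x + h x) \<in> S2 n"
    and min_weak_upper_gradient_add: "AE x in n. min_weak_upper_gradient n (\<lambda>x. f x + h x) x
      \<le> min_weak_upper_gradient n f x + min_weak_upper_gradient n h x"
proof -
  note w = weak_upper_gradient_add[OF weak_upper_gradient_min_weak[OF f n] weak_upper_gradient_min_weak[OF h n]]
  show S: "(\<lambda>x. f x + h x) \<in> S2 n"
    using nn_integral_min_weak_upper_gradient[OF f n] borel_measurable_min_weak_upper_gradient[OF f n]
      nn_integral_min_weak_upper_gradient[OF h n] borel_measurable_min_weak_upper_gradient[OF h n]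
    by (intro S2I[OF w] nn_integral_power2_add_finite) (auto simp: borel_measurable_eq)
  show "AE x in n. min_weak_upper_gradient n (\<lambda>x. f x + h x) x
      \<le> min_weak_upper_gradient n f x + min_weak_upper_gradient n h x"
    by (rule min_weak_upper_gradient_le[OF S n w])
qed

lemma S2_affine:
  assumes "f \<in> S2 n"
  shows "(\<lambda>x. a * f x + b) \<in> S2 n"
  by (rule S2_lipschitz[OF assms, of _ "\<bar>a\<bar>"])
     (use S2_borel_measurable[OF assms] in \<open>auto simp: abs_mult[symmetric] right_diff_distrib\<close>)

lemma S2_diff:
  assumes f: "f \<in> S2 n" and h: "h \<in> S2 n"
  shows "(\<lambda>x. f x - h x) \<in> S2 n"
  using S2_add[OF f S2_affine[OF h, of "-1" 0]] by simp

lemma min_weak_upper_gradient_affine: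
  assumes f: "f \<in> S2 n" and a: "\<bar>a\<bar> = 1"
  shows "AE x in n. min_weak_upper_gradient n (\<lambda>x. a * f x + b) x = min_weak_upper_gradient n f x"
proof -
  have "AE x in n. min_weak_upper_gradient n (\<lambda>x. a * f x + b) x \<le> ennreal 1 * min_weak_upper_gradient n f x"
    by (rule min_weak_upper_gradient_lipschitz[OF f])
       (use S2_borel_measurable[OF f] a in \<open>auto simp: right_diff_distrib[symmetric] abs_mult\<close>)
  moreover have "AE x in n. min_weak_upper_gradient n f x \<le> ennreal 1 * min_weak_upper_gradient n (\<lambda>x. a * f x + b) x"
    by (rule min_weak_upper_gradient_lipschitz[OF S2_affine[OF f]])
       (use S2_borel_measurable[OF f] a in \<open>auto simp: right_diff_distrib[symmetric] abs_mult\<close>)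
  ultimately show ?thesis by eventually_elim auto
qed

text \<open>In \<open>f = h + (f - h)\<close> the gradient of the second summand can be taken to
  vanish on the coincidence set.\<close>

lemma min_weak_upper_gradient_le_on_eq:
  assumes f: "f \<in> S2 n" and h: "h \<in> S2 n"
  shows "AE x in n. f x = h x \<longrightarrow> min_weak_upper_gradient n f x \<le> min_weak_upper_gradient n h x"
proof -
  have d: "(\<lambda>x. f x - h x) \<in> S2 n" using f h by (rule S2_diff)
  note w = weak_upper_gradient_nonzero[OF weak_upper_gradient_min_weak[OF d n]]
  have "weak_upper_gradient n (\<lambda>x. h x + (f x - h x)) (\<lambda>x. min_weak_upper_gradient n h x +
      (if f x - h x = 0 then 0 else min_weak_upper_gradient n (\<lambda>x. f x - h x) x))"
    by (rule weak_upper_gradient_add[OF weak_upper_gradient_min_weak[OF h n] w])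
  then have "weak_upper_gradient n f (\<lambda>x. min_weak_upper_gradient n h x +
      (if f x - h x = 0 then 0 else min_weak_upper_gradient n (\<lambda>x. f x - h x) x))" by simp
  from min_weak_upper_gradient_le[OF f n this] show ?thesis by eventually_elim auto
qed

text \<open>Slopes of modulus one and a shift are included because the branches of a triangle wave
  are of this form.\<close>

lemma min_weak_upper_gradient_eq_on:
  assumes f: "f \<in> S2 n" and h: "h \<in> S2 n" and a: "\<bar>a\<bar> = 1"
  shows "AE x in n. f x = a * h x + b \<longrightarrow> min_weak_upper_gradient n f x = min_weak_upper_gradient n h x"
  using min_weak_upper_gradient_le_on_eq[OF f S2_affine[OF h, of a b]]
    min_weak_upper_gradient_le_on_eq[OF S2_affine[OF h, of a b] f]
    min_weak_upper_gradient_affine[OF h a, of b]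
  by eventually_elim auto

lemma min_weak_upper_gradient_const:
  assumes f: "f \<in> S2 n"
  shows "AE x in n. f x = b \<longrightarrow> min_weak_upper_gradient n f x = 0"
proof -
  have d: "(\<lambda>x. f x - b) \<in> S2 n" using S2_affine[OF f, of 1 "-b"] by simp
  from min_weak_upper_gradient_le[OF d n weak_upper_gradient_nonzero[OF weak_upper_gradient_min_weak[OF d n]]]
    min_weak_upper_gradient_affine[OF f, of 1 "-b", simplified]
  show ?thesis by eventually_elim auto
qed

lemma min_weak_upper_gradient_AE_cong:
  assumes f: "f \<in> S2 n" and u: "u \<in> borel_measurable borel" and eq: "AE x in n. u x = f x"
  shows "u \<in> S2 n" "AE x in n. min_weak_upper_gradient n u x = min_weak_upper_gradient n f x"
proof -
  show S: "u \<in> S2 n"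
    using weak_upper_gradient_AE_cong[OF weak_upper_gradient_min_weak[OF f n] n u eq]
      nn_integral_min_weak_upper_gradient[OF f n] by (rule S2I)
  show "AE x in n. min_weak_upper_gradient n u x = min_weak_upper_gradient n f x"
    using min_weak_upper_gradient_eq_on[OF S f, of 1 0, simplified] eq by eventually_elim auto
qed

lemma AE_min_weak_upper_gradient_finite:
  assumes f: "f \<in> S2 n"
  shows "AE x in n. min_weak_upper_gradient n f x < \<infinity>"
proof -
  have [measurable]: "min_weak_upper_gradient n f \<in> borel_measurable n"
    using borel_measurable_min_weak_upper_gradient[OF f n] by (simp add: borel_measurable_eq)
  have "AE x in n. (min_weak_upper_gradient n f x)\<^sup>2 \<noteq> \<infinity>"
    using nn_integral_min_weak_upper_gradient[OF f n] by (intro nn_integral_PInf_AE) auto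
  then show ?thesis by eventually_elim (auto simp: power2_eq_square ennreal_mult_eq_top_iff less_top[symmetric])
qed

end

section \<open>The pointwise parallelogram law\<close>

abbreviation wgrad :: "'a::metric_space measure \<Rightarrow> ('a \<Rightarrow> real) \<Rightarrow> 'a \<Rightarrow> ennreal" where
  "wgrad \<equiv> min_weak_upper_gradient"

text \<open>The left side of the pointwise parallelogram law; \<open>sum_square\<close> is the right
  side.\<close>

definition sum_diff_square :: "'a::metric_space measure \<Rightarrow> ('a \<Rightarrow> real) \<Rightarrow> ('a \<Rightarrow> real) \<Rightarrow> 'a \<Rightarrow> ennreal" where
  "sum_diff_square n f h x = (wgrad n (\<lambda>x. f x + h x) x)\<^sup>2 + (wgrad n (\<lambda>x. f x - h x) x)\<^sup>2"

definition sum_square :: "'a::metric_space measure \<Rightarrow> ('a \<Rightarrow> real) \<Rightarrow> ('a \<Rightarrow> real) \<Rightarrow> 'a \<Rightarrow> ennreal" where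
  "sum_square n f h x = 2 * (wgrad n f x)\<^sup>2 + 2 * (wgrad n h x)\<^sup>2"

context
  fixes n :: "'a::{metric_space, second_countable_topology} measure"
  assumes n: "sets n = sets borel"
begin

lemma wgrad_measurable: "f \<in> S2 n \<Longrightarrow> wgrad n f \<in> borel_measurable n"
  using borel_measurable_min_weak_upper_gradient[OF _ n] by (simp add: borel_measurable_eq[OF n])

text \<open>A local chain rule for \<open>\<psi>\<close> such as the logarithm, with a Lipschitz
  constant on an interval only: clamping \<open>f\<close> to the interval makes the composition
  globally Lipschitz, and locality removes the clamp where it is inactive.\<close>

lemma wgrad_composition_le:
  assumes f: "f \<in> S2 n" and \<psi>f: "(\<lambda>x. \<psi> (f x)) \<in> S2 n" and ab: "a \<le> b" and L: "L \<ge> 0"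
    and lip: "\<And>y z. y \<in> {a..b} \<Longrightarrow> z \<in> {a..b} \<Longrightarrow> \<bar>\<psi> y - \<psi> z\<bar> \<le> L * \<bar>y - z\<bar>"
  shows "AE x in n. a \<le> f x \<and> f x \<le> b \<longrightarrow> wgrad n (\<lambda>x. \<psi> (f x)) x \<le> ennreal L * wgrad n f x"
proof -
  define \<kappa> where "\<kappa> y = max a (min b y)" for y
  have \<kappa>: "\<kappa> y \<in> {a..b}" "\<bar>\<kappa> y - \<kappa> z\<bar> \<le> \<bar>y - z\<bar>" "a \<le> y \<and> y \<le> b \<Longrightarrow> \<kappa> y = y" for y z
    using ab by (auto simp: \<kappa>_def)
  have lip\<kappa>: "\<bar>\<psi> (\<kappa> y) - \<psi> (\<kappa> z)\<bar> \<le> L * \<bar>y - z\<bar>" for y z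
    using lip[OF \<kappa>(1) \<kappa>(1), of y z] mult_left_mono[OF \<kappa>(2) L, of y z] by linarith
  then have "L-lipschitz_on UNIV (\<lambda>y. \<psi> (\<kappa> y))"
    using L by (intro lipschitz_onI) (auto simp: dist_real_def)
  then have "(\<lambda>y. \<psi> (\<kappa> y)) \<in> borel_measurable borel"
    by (intro borel_measurable_continuous_onI lipschitz_on_continuous_on)
  then have m: "(\<lambda>x. \<psi> (\<kappa> (f x))) \<in> borel_measurable borel"
    by (rule measurable_compose[OF S2_borel_measurable[OF f]])
  have S: "(\<lambda>x. \<psi> (\<kappa> (f x))) \<in> S2 n"
    using lip\<kappa> by (intro S2_lipschitz[OF n f m L]) auto
  have "AE x in n. wgrad n (\<lambda>x. \<psi> (\<kappa> (f x))) x \<le> ennreal L * wgrad n f x"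
    using lip\<kappa> by (intro min_weak_upper_gradient_lipschitz[OF n f m L]) auto
  with min_weak_upper_gradient_le_on_eq[OF n \<psi>f S] show ?thesis
    by eventually_elim (auto simp: \<kappa>(3) intro: order_trans)
qed

lemma wgrad_cmult:
  assumes f: "f \<in> S2 n" and a: "a > 0"
  shows "AE x in n. wgrad n (\<lambda>x. a * f x) x = ennreal a * wgrad n f x"
proof -
  have m: "f \<in> borel_measurable borel" "(\<lambda>x. a * f x) \<in> borel_measurable borel"
    using S2_borel_measurable[OF f] by auto
  have "AE x in n. wgrad n (\<lambda>x. a * f x) x \<le> ennreal a * wgrad n f x"
    using a by (intro min_weak_upper_gradient_lipschitz[OF n f m(2)]) (auto simp: right_diff_distrib[symmetric] abs_mult)
  moreover have "(\<lambda>x. a * f x) \<in> S2 n" using S2_affine[OF n f, of a 0] by simp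
  then have "AE x in n. wgrad n f x \<le> ennreal (1 / a) * wgrad n (\<lambda>x. a * f x) x"
    using a by (intro min_weak_upper_gradient_lipschitz[OF n _ m(1)]) (auto simp: right_diff_distrib[symmetric] abs_mult)
  ultimately show ?thesis
  proof eventually_elim
    case (elim x)
    have "ennreal a * wgrad n f x \<le> ennreal a * (ennreal (1 / a) * wgrad n (\<lambda>x. a * f x) x)"
      using elim(2) by (rule mult_left_mono) simp
    also have "\<dots> = wgrad n (\<lambda>x. a * f x) x"
      using a by (simp add: mult.assoc[symmetric] ennreal_mult[symmetric])
    finally show ?case using elim(1) by simp
  qed
qed

lemma wgrad_uminus:
  assumes f: "f \<in> S2 n"
  shows "AE x in n. wgrad n (\<lambda>x. - f x) x = wgrad n f x"
  using min_weak_upper_gradient_affine[OF n f, of "-1" 0] by simp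

text \<open>With equal signs, sum and difference of the new pair are those of the old pair up to
  sign and a constant; with opposite signs they are exchanged, which \<open>sum_diff_square\<close>
  does not see.\<close>

lemma squares_eq_on:
  assumes S: "f \<in> S2 n" "h \<in> S2 n" "f' \<in> S2 n" "h' \<in> S2 n" and a: "\<bar>a\<bar> = 1" "\<bar>a'\<bar> = 1"
  shows "AE x in n. f' x = a * f x + b \<and> h' x = a' * h x + b' \<longrightarrow>
    sum_diff_square n f' h' x = sum_diff_square n f h x \<and> sum_square n f' h' x = sum_square n f h x"
proof -
  note p = S2_add[OF n S(1,2)] and d = S2_diff[OF n S(1,2)] and p' = S2_add[OF n S(3,4)] and d' = S2_diff[OF n S(3,4)]
  have 1: "AE x in n. f' x = a * f x + b \<and> h' x = a' * h x + b' \<longrightarrow> sum_square n f' h' x = sum_square n f h x"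
    using min_weak_upper_gradient_eq_on[OF n S(3,1) a(1), of b] min_weak_upper_gradient_eq_on[OF n S(4,2) a(2), of b']
    by (elim eventually_elim2) (auto simp: sum_square_def)
  have "a' = a \<or> a' = - a" using a by auto
  then have "AE x in n. f' x = a * f x + b \<and> h' x = a' * h x + b' \<longrightarrow> sum_diff_square n f' h' x = sum_diff_square n f h x"
  proof
    assume eq: "a' = a"
    show ?thesis
      using min_weak_upper_gradient_eq_on[OF n p' p a(1), of "b + b'"] min_weak_upper_gradient_eq_on[OF n d' d a(1), of "b - b'"]
      by (elim eventually_elim2) (auto simp: sum_diff_square_def eq algebra_simps)
  next
    assume eq: "a' = - a"
    show ?thesis
      using min_weak_upper_gradient_eq_on[OF n p' d a(1), of "b + b'"] min_weak_upper_gradient_eq_on[OF n d' p a(1), of "b - b'"]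
      by (elim eventually_elim2) (auto simp: sum_diff_square_def eq algebra_simps)
  qed
  with 1 show ?thesis by eventually_elim auto
qed

lemma measurable_squares:
  assumes "f \<in> S2 n" "h \<in> S2 n"
  shows "sum_diff_square n f h \<in> borel_measurable n" "sum_square n f h \<in> borel_measurable n"
proof -
  note [measurable] = wgrad_measurable[OF assms(1)] wgrad_measurable[OF assms(2)]
    wgrad_measurable[OF S2_add[OF n assms]] wgrad_measurable[OF S2_diff[OF n assms]]
  show "sum_diff_square n f h \<in> borel_measurable n" "sum_square n f h \<in> borel_measurable n"
    unfolding sum_diff_square_def[abs_def] sum_square_def[abs_def] by measurable
qed

lemma nn_integral_sum_square:
  assumes "f \<in> S2 n" "h \<in> S2 n"
  shows "(\<integral>\<^sup>+x. sum_square n f h x \<partial>n) = 2 * (\<integral>\<^sup>+x. (wgrad n f x)\<^sup>2 \<partial>n) + 2 * (\<integral>\<^sup>+x. (wgrad n h x)\<^sup>2 \<partial>n)"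
    "(\<integral>\<^sup>+x. sum_square n f h x \<partial>n) < \<infinity>"
proof -
  note [measurable] = wgrad_measurable[OF assms(1)] wgrad_measurable[OF assms(2)]
  show *: "(\<integral>\<^sup>+x. sum_square n f h x \<partial>n) = 2 * (\<integral>\<^sup>+x. (wgrad n f x)\<^sup>2 \<partial>n) + 2 * (\<integral>\<^sup>+x. (wgrad n h x)\<^sup>2 \<partial>n)"
    unfolding sum_square_def by (simp add: nn_integral_add nn_integral_cmult)
  show "(\<integral>\<^sup>+x. sum_square n f h x \<partial>n) < \<infinity>"
    unfolding * using nn_integral_min_weak_upper_gradient[OF assms(1) n] nn_integral_min_weak_upper_gradient[OF assms(2) n]
    by (simp add: ennreal_mult_less_top)
qed

lemma nn_integral_sum_diff_square:
  assumes "f \<in> S2 n" "h \<in> S2 n"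
  shows "(\<integral>\<^sup>+x. sum_diff_square n f h x \<partial>n)
      = (\<integral>\<^sup>+x. (wgrad n (\<lambda>x. f x + h x) x)\<^sup>2 \<partial>n) + (\<integral>\<^sup>+x. (wgrad n (\<lambda>x. f x - h x) x)\<^sup>2 \<partial>n)"
proof -
  note [measurable] = wgrad_measurable[OF S2_add[OF n assms]] wgrad_measurable[OF S2_diff[OF n assms]]
  show ?thesis unfolding sum_diff_square_def by (simp add: nn_integral_add)
qed

lemma cheeger_parallelogram_iff:
  assumes S: "f \<in> S2 n" "h \<in> S2 n"
  shows "cheeger n (\<lambda>x. f x + h x) + cheeger n (\<lambda>x. f x - h x) = 2 * cheeger n f + 2 * cheeger n h
    \<longleftrightarrow> (\<integral>\<^sup>+x. sum_diff_square n f h x \<partial>n) = (\<integral>\<^sup>+x. sum_square n f h x \<partial>n)"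
proof -
  have half: "x / 2 + y / 2 = 2 * (z / 2) + 2 * (w / 2) \<longleftrightarrow> x + y = 2 * z + 2 * (w::ennreal)" for x y z w
  proof -
    have e: "x / 2 + y / 2 = (x + y) / 2" "2 * (z / 2) + 2 * (w / 2) = (2 * z + 2 * w) / 2"
      by (simp_all add: add_divide_distrib_ennreal ennreal_times_divide)
    have "2 * (u / 2) = u" for u :: ennreal
      by (simp add: ennreal_times_divide mult_divide_eq_ennreal mult.commute)
    then show ?thesis unfolding e by metis
  qed
  show ?thesis
    using S S2_add[OF n S] S2_diff[OF n S]
    by (simp only: cheeger_def if_True half nn_integral_sum_diff_square[OF S] nn_integral_sum_square(1)[OF S])
qed

end

text \<open>The distance to the lattice of multiples of \<open>2 * d\<close>: a triangle wave with
  slopes of modulus one and height \<open>d\<close>. It makes a function bounded while keeping the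
  size of its gradient.\<close>

definition sawtooth :: "real \<Rightarrow> real \<Rightarrow> real" where
  "sawtooth d y = infdist y (range (\<lambda>j::int. 2 * d * of_int j))"

lemma sawtooth_lipschitz: "\<bar>sawtooth d y - sawtooth d z\<bar> \<le> \<bar>y - z\<bar>"
  unfolding sawtooth_def using infdist_triangle_abs[of y _ z] by (simp add: dist_real_def)

lemma sawtooth_nonneg: "sawtooth d y \<ge> 0"
  by (simp add: sawtooth_def infdist_nonneg)

lemma sawtooth_eq:
  assumes d: "d > 0"
  obtains j :: int where "sawtooth d y = \<bar>y - 2 * d * of_int j\<bar>" "\<bar>y - 2 * d * of_int j\<bar> \<le> d"
proof -
  \<comment> \<open>The index of a nearest lattice point, by rounding.\<close>
  define j where "j = \<lfloor>y / (2 * d) + 1 / 2\<rfloor>"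
  have "of_int j \<le> y / (2 * d) + 1 / 2" "y / (2 * d) + 1 / 2 < of_int j + 1"
    by (simp_all add: j_def)
  then have j: "\<bar>y - 2 * d * of_int j\<bar> \<le> d"
    using d by (auto simp: field_simps abs_le_iff)
  \<comment> \<open>Other lattice points are at least \<open>2 * d\<close> from the chosen one,
    hence at least \<open>d\<close> from \<open>y\<close>.\<close>
  have far: "\<bar>y - 2 * d * of_int j\<bar> \<le> \<bar>y - 2 * d * of_int i\<bar>" for i :: int
  proof (cases "i = j")
    case False
    then have "1 \<le> \<bar>real_of_int j - of_int i\<bar>" by linarith
    then have "2 * d * 1 \<le> 2 * d * \<bar>real_of_int j - of_int i\<bar>" using d by (intro mult_left_mono) auto
    also have "\<dots> = \<bar>2 * d * of_int j - 2 * d * of_int i\<bar>"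
      using d by (simp add: right_diff_distrib[symmetric] abs_mult)
    finally show ?thesis using j by linarith
  qed simp
  have "sawtooth d y = \<bar>y - 2 * d * of_int j\<bar>"
  proof (rule antisym)
    show "sawtooth d y \<le> \<bar>y - 2 * d * of_int j\<bar>"
      unfolding sawtooth_def dist_real_def[symmetric] by (rule infdist_le) (rule rangeI)
    show "\<bar>y - 2 * d * of_int j\<bar> \<le> sawtooth d y"
      unfolding sawtooth_def infdist_def using far by (auto intro!: cINF_greatest simp: dist_real_def)
  qed
  with j show ?thesis by (rule_tac that)
qed

lemma bounded_open_cutoff:
  fixes U :: "'a::metric_space set"
  assumes "open U"
  obtains \<eta> :: "'a \<Rightarrow> real" where "1-lipschitz_on UNIV \<eta>" "\<And>x. 0 \<le> \<eta> x" "\<And>x. \<eta> x \<le> 1" "\<And>x. \<eta> x = 0 \<longleftrightarrow> x \<notin> U"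
proof (cases "U = UNIV")
  \<comment> \<open>\<open>infdist\<close> to the empty set is \<open>0\<close> by convention, so
    the whole space gets a constant cutoff.\<close>
  case True
  show ?thesis
    by (rule that[of "\<lambda>_. 1"]) (auto simp: True intro!: lipschitz_onI)
next
  case False
  define \<eta> where "\<eta> x = min 1 (infdist x (- U))" for x
  have *: "\<bar>\<eta> x - \<eta> y\<bar> \<le> dist x y" for x y
    using infdist_triangle_abs[of x "- U" y] by (auto simp: \<eta>_def min_def)
  show ?thesis
  proof (rule that[of \<eta>])
    show "1-lipschitz_on UNIV \<eta>" using * by (intro lipschitz_onI) (auto simp: dist_real_def)
    show "\<eta> x = 0 \<longleftrightarrow> x \<notin> U" for x
    proof -
      have "- U \<noteq> {}" using False by auto
      then have "x \<in> - U \<longleftrightarrow> infdist x (- U) = 0"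
        using assms by (intro in_closed_iff_infdist_zero) (simp add: closed_Compl)
      then show ?thesis by (auto simp: \<eta>_def min_def)
    qed
  qed (auto simp: \<eta>_def infdist_nonneg)
qed

text \<open>
  Truncating with a cutoff and folding by the sawtooth localizes the parallelogram law: on the
  set where the cutoff is at least the tooth size both gradients are unchanged up to sign, and
  the transition layer shrinks to a null set as the tooth size tends to zero.
\<close>

lemma parallelogram_open_le:
  fixes m :: "'a::{metric_space, second_countable_topology} measure"
  assumes n: "sets m = sets borel" and q: "cheeger_quadratic m"
    and S: "f \<in> S2 m" "h \<in> S2 m" and U: "open U" "emeasure m U < \<infinity>"
  shows "(\<integral>\<^sup>+x\<in>U. sum_diff_square m f h x \<partial>m) \<le> (\<integral>\<^sup>+x\<in>U. sum_square m f h x \<partial>m)"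
proof -
  obtain \<eta> :: "'a \<Rightarrow> real" where \<eta>: "1-lipschitz_on UNIV \<eta>" "\<And>x. 0 \<le> \<eta> x" "\<And>x. \<eta> x \<le> 1" "\<And>x. \<eta> x = 0 \<longleftrightarrow> x \<notin> U"
    using bounded_open_cutoff[OF U(1)] by blast
  have [measurable]: "\<eta> \<in> borel_measurable borel" "U \<in> sets borel"
    using lipschitz_on_continuous_on[OF \<eta>(1)] U(1) by (auto intro: borel_measurable_continuous_onI)
  then have [measurable]: "\<eta> \<in> borel_measurable m" "U \<in> sets m"
    by (simp_all add: borel_measurable_eq[OF n] n)
  define \<delta> where "\<delta> k = 1 / real (Suc k)" for k
  have \<delta>: "\<delta> k > 0" for k by (simp add: \<delta>_def)
  define I where "I x = (if \<eta> x = 0 then 0 else ennreal 1)" for x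
  have wI: "weak_upper_gradient m \<eta> I"
    unfolding I_def by (rule weak_upper_gradient_of_lipschitz[OF \<eta>(1)])
  have I_eq: "I = indicator U" using \<eta>(4) by (auto simp: I_def indicator_def)
  \<comment> \<open>Between zero and one and zero off \<open>U\<close>, hence integrable, so that
    the assumption on the energy applies. The wave has height \<open>\<delta> k\<close>, so the
    minimum is inactive where \<open>\<eta>\<close> is at least \<open>\<delta> k\<close>.\<close>
  define cut where "cut k u x = min (sawtooth (\<delta> k) (u x)) (\<eta> x)" for k u x
  have sawm[measurable]: "sawtooth d \<in> borel_measurable borel" for d
    unfolding sawtooth_def[abs_def] by (intro borel_measurable_continuous_onI continuous_on_infdist continuous_intros)
  have cutm: "cut k u \<in> borel_measurable borel" if "u \<in> S2 m" for k u
  proof -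
    note [measurable] = S2_borel_measurable[OF that]
    show ?thesis unfolding cut_def[abs_def] by measurable
  qed
  have wcut: "weak_upper_gradient m (cut k u) (\<lambda>x. max (wgrad m u x) (I x))" if "u \<in> S2 m" for k u
  proof (rule weak_upper_gradient_max[OF weak_upper_gradient_min_weak[OF that n] wI cutm[OF that]])
    show "\<bar>cut k u x - cut k u y\<bar> \<le> max \<bar>u x - u y\<bar> \<bar>\<eta> x - \<eta> y\<bar>" for x y
      using sawtooth_lipschitz[of "\<delta> k" "u x" "u y"] unfolding cut_def by linarith
  qed
  have max2: "(\<integral>\<^sup>+x. (max (wgrad m u x) (I x))\<^sup>2 \<partial>m) < \<infinity>" if "u \<in> S2 m" for u
  proof -
    note [measurable] = wgrad_measurable[OF n that]
    have "(\<integral>\<^sup>+x. (max (wgrad m u x) (I x))\<^sup>2 \<partial>m) \<le> (\<integral>\<^sup>+x. (wgrad m u x)\<^sup>2 + indicator U x \<partial>m)"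
      by (intro nn_integral_mono) (auto simp: I_eq max_def indicator_def)
    also have "\<dots> = (\<integral>\<^sup>+x. (wgrad m u x)\<^sup>2 \<partial>m) + emeasure m U" by (subst nn_integral_add) auto
    also have "\<dots> < \<infinity>" using U nn_integral_min_weak_upper_gradient[OF that n] by simp
    finally show ?thesis .
  qed
  have cutS: "cut k u \<in> S2 m" if "u \<in> S2 m" for k u
    using wcut[OF that] max2[OF that] by (rule S2I)
  have cut0: "cut k u x = 0" if "x \<notin> U" for k u x
    using that \<eta>(4)[of x] sawtooth_nonneg[of "\<delta> k" "u x"] by (simp add: cut_def)
  have cut01: "\<bar>cut k u x\<bar> \<le> indicator U x" for k u x
    using \<eta>(2)[of x] \<eta>(3)[of x] sawtooth_nonneg[of "\<delta> k" "u x"] cut0[of x k u]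
    by (auto simp: indicator_def cut_def min_def split: if_splits)
  have cutint: "integrable m (cut k u)" if "u \<in> S2 m" for k u
  proof (rule Bochner_Integration.integrable_bound)
    show "integrable m (indicator U :: 'a \<Rightarrow> real)" using U by (intro integrable_real_indicator) auto
    show "cut k u \<in> borel_measurable m" using cutm[OF that] by (simp add: borel_measurable_eq[OF n])
    show "AE x in m. norm (cut k u x) \<le> norm (indicator U x :: real)" using cut01[of k u] by simp
  qed
  define A where "A = sum_diff_square m f h"
  define B where "B = sum_square m f h"
  define Ak where "Ak k = sum_diff_square m (cut k f) (cut k h)" for k
  define Bk where "Bk k = sum_square m (cut k f) (cut k h)" for k
  note mAB[measurable] = measurable_squares[OF n S, folded A_def B_def]
  have [measurable]: "Ak k \<in> borel_measurable m" "Bk k \<in> borel_measurable m" for k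
    unfolding Ak_def Bk_def using measurable_squares[OF n cutS[OF S(1)] cutS[OF S(2)]] by auto
  have AB: "(\<integral>\<^sup>+x. Ak k x \<partial>m) = (\<integral>\<^sup>+x. Bk k x \<partial>m)" for k
    using q cutint[OF S(1), of k] cutint[OF S(2), of k] cheeger_parallelogram_iff[OF n cutS[OF S(1)] cutS[OF S(2)], of k k]
    unfolding cheeger_quadratic_def Ak_def Bk_def by blast
  have same: "AE x in m. \<delta> k \<le> \<eta> x \<longrightarrow> Ak k x = A x \<and> Bk k x = B x" for k
  proof -
    \<comment> \<open>The active branch of the wave depends on the point, but there are only
      countably many pairs of branches, so the null sets from locality can be united.\<close>
    have "AE x in m. \<forall>i j :: int. \<forall>a\<in>{1, -1}. \<forall>a'\<in>{1, -1}.
        cut k f x = a * f x + a * (- 2 * \<delta> k * of_int i) \<and> cut k h x = a' * h x + a' * (- 2 * \<delta> k * of_int j) \<longrightarrow>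
        Ak k x = A x \<and> Bk k x = B x"
      unfolding AE_all_countable Ak_def Bk_def A_def B_def
    proof (intro allI)
      fix i j :: int
      show "AE x in m. \<forall>a\<in>{1, -1}. \<forall>a'\<in>{1, -1}.
        cut k f x = a * f x + a * (- 2 * \<delta> k * of_int i) \<and> cut k h x = a' * h x + a' * (- 2 * \<delta> k * of_int j) \<longrightarrow>
        sum_diff_square m (cut k f) (cut k h) x = sum_diff_square m f h x \<and>
        sum_square m (cut k f) (cut k h) x = sum_square m f h x"
      proof (intro AE_ball_countable[THEN iffD2] ballI)
        fix a a' :: real assume "a \<in> {1, -1}" "a' \<in> {1, -1}"
        then have "\<bar>a\<bar> = 1" "\<bar>a'\<bar> = 1" by auto
        from squares_eq_on[OF n S cutS[OF S(1)] cutS[OF S(2)] this]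
        show "AE x in m. cut k f x = a * f x + a * (- 2 * \<delta> k * of_int i) \<and> cut k h x = a' * h x + a' * (- 2 * \<delta> k * of_int j) \<longrightarrow>
        sum_diff_square m (cut k f) (cut k h) x = sum_diff_square m f h x \<and>
        sum_square m (cut k f) (cut k h) x = sum_square m f h x" .
      qed auto
    qed
    then show ?thesis
    proof eventually_elim
      case (elim x)
      show ?case
      proof
        assume \<eta>x: "\<delta> k \<le> \<eta> x"
        have ex: "\<exists>i::int. \<exists>a\<in>{1, -1}. cut k u x = a * u x + a * (- 2 * \<delta> k * of_int i)" for u
        proof -
          obtain i :: int where i: "sawtooth (\<delta> k) (u x) = \<bar>u x - 2 * \<delta> k * of_int i\<bar>" "\<bar>u x - 2 * \<delta> k * of_int i\<bar> \<le> \<delta> k"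
            using sawtooth_eq[OF \<delta>] by blast
          then have "cut k u x = \<bar>u x - 2 * \<delta> k * of_int i\<bar>" using \<eta>x by (simp add: cut_def)
          then show ?thesis
            by (cases "u x - 2 * \<delta> k * of_int i \<ge> 0") (auto intro!: exI[of _ i])
        qed
        from ex[of f] ex[of h] elim show "Ak k x = A x \<and> Bk k x = B x" by blast
      qed
    qed
  qed
  have Bk0: "AE x in m. x \<notin> U \<longrightarrow> Bk k x = 0" for k
    using min_weak_upper_gradient_const[OF n cutS[OF S(1), of k], of 0] min_weak_upper_gradient_const[OF n cutS[OF S(2), of k], of 0]
    by eventually_elim (auto simp: Bk_def sum_square_def cut0)
  \<comment> \<open>An integrable majorant of all \<open>Bk k\<close>, used on the transition layer
    where nothing else is known.\<close>
  define M where "M x = (2 * (max (wgrad m f x) (I x))\<^sup>2 + 2 * (max (wgrad m h x) (I x))\<^sup>2)" for x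
  have [measurable]: "M \<in> borel_measurable m"
    using wgrad_measurable[OF n S(1)] wgrad_measurable[OF n S(2)] unfolding M_def[abs_def] I_eq by measurable
  have Mfin: "(\<integral>\<^sup>+x. M x \<partial>m) < \<infinity>"
    using max2[OF S(1)] max2[OF S(2)] wgrad_measurable[OF n S(1)] wgrad_measurable[OF n S(2)]
    unfolding M_def I_eq by (simp add: nn_integral_add nn_integral_cmult ennreal_mult_less_top)
  have BkM: "AE x in m. Bk k x \<le> M x" for k
    using min_weak_upper_gradient_le[OF cutS[OF S(1)] n wcut[OF S(1)], of k] min_weak_upper_gradient_le[OF cutS[OF S(2)] n wcut[OF S(2)], of k]
    by eventually_elim (auto simp: Bk_def sum_square_def M_def intro!: add_mono mult_left_mono power_mono)
  have step: "(\<integral>\<^sup>+x. A x * indicator {x. \<delta> k \<le> \<eta> x} x \<partial>m)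
      \<le> (\<integral>\<^sup>+x\<in>U. B x \<partial>m) + (\<integral>\<^sup>+x. M x * indicator {x. 0 < \<eta> x \<and> \<eta> x < \<delta> k} x \<partial>m)" for k
  proof -
    have "(\<integral>\<^sup>+x. A x * indicator {x. \<delta> k \<le> \<eta> x} x \<partial>m) \<le> (\<integral>\<^sup>+x. Ak k x \<partial>m)"
      using same[of k] by (intro nn_integral_mono_AE, eventually_elim) (auto simp: indicator_def)
    also have "\<dots> = (\<integral>\<^sup>+x. Bk k x \<partial>m)" by (rule AB)
    \<comment> \<open>Three regions: off \<open>U\<close> the cut functions vanish, above the tooth
      size their squares are those of \<open>f\<close> and \<open>h\<close>, and in the layer the
      majorant takes over.\<close>
    also have "\<dots> \<le> (\<integral>\<^sup>+x. B x * indicator U x + M x * indicator {x. 0 < \<eta> x \<and> \<eta> x < \<delta> k} x \<partial>m)"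
      using same[of k] Bk0[of k] BkM[of k]
    proof (intro nn_integral_mono_AE, eventually_elim)
      case (elim x)
      consider "x \<notin> U" | "x \<in> U" "\<delta> k \<le> \<eta> x" | "x \<in> U" "0 < \<eta> x" "\<eta> x < \<delta> k"
        using \<eta>(2)[of x] \<eta>(4)[of x] by fastforce
      then show ?case using elim by cases (auto simp: indicator_def add_increasing)
    qed
    also have "\<dots> = (\<integral>\<^sup>+x\<in>U. B x \<partial>m) + (\<integral>\<^sup>+x. M x * indicator {x. 0 < \<eta> x \<and> \<eta> x < \<delta> k} x \<partial>m)"
      by (rule nn_integral_add) measurable
    finally show ?thesis .
  qed
  have \<delta>0: "\<delta> \<longlonglongrightarrow> 0" unfolding \<delta>_def[abs_def] using LIMSEQ_inverse_real_of_nat by (simp add: inverse_eq_divide)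
  have "(\<lambda>k. \<integral>\<^sup>+x. A x * indicator {x. \<delta> k \<le> \<eta> x} x \<partial>m) \<longlonglongrightarrow> (\<integral>\<^sup>+x\<in>U. A x \<partial>m)"
  proof (rule nn_integral_LIMSEQ)
    have "\<delta> (Suc k) \<le> \<delta> k" for k by (simp add: \<delta>_def field_simps)
    then show "incseq (\<lambda>k x. A x * indicator {x. \<delta> k \<le> \<eta> x} x)"
      by (intro incseq_SucI le_funI mult_left_mono) (auto simp: indicator_def intro: order_trans)
    show "(\<lambda>k. A x * indicator {x. \<delta> k \<le> \<eta> x} x) \<longlonglongrightarrow> A x * indicator U x" for x
    proof (rule tendsto_eventually)
      show "eventually (\<lambda>k. A x * indicator {x. \<delta> k \<le> \<eta> x} x = A x * indicator U x) sequentially"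
      proof (cases "x \<in> U")
        case True
        then have "\<eta> x > 0" using \<eta>(2)[of x] \<eta>(4)[of x] by simp
        then have "eventually (\<lambda>k. \<delta> k < \<eta> x) sequentially" using \<delta>0 by (rule order_tendstoD[rotated])
        then show ?thesis by eventually_elim (use True in auto)
      next
        case False
        then have "\<eta> x = 0" using \<eta>(4) by simp
        then show ?thesis using False \<delta> by (auto simp: not_le)
      qed
    qed
  qed measurable
  moreover have "(\<lambda>k. \<integral>\<^sup>+x. M x * indicator {x. 0 < \<eta> x \<and> \<eta> x < \<delta> k} x \<partial>m) \<longlonglongrightarrow> (\<integral>\<^sup>+x. 0 \<partial>m)"
  proof (rule nn_integral_dominated_convergence[where w = M])
    show "AE x in m. (\<lambda>k. M x * indicator {x. 0 < \<eta> x \<and> \<eta> x < \<delta> k} x) \<longlonglongrightarrow> 0"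
    proof (rule AE_I2, rule tendsto_eventually)
      fix x
      show "eventually (\<lambda>k. M x * indicator {x. 0 < \<eta> x \<and> \<eta> x < \<delta> k} x = 0) sequentially"
      proof (cases "0 < \<eta> x")
        case True
        then have "eventually (\<lambda>k. \<delta> k < \<eta> x) sequentially" using \<delta>0 by (rule order_tendstoD[rotated])
        then show ?thesis by eventually_elim auto
      qed auto
    qed
    show "AE x in m. M x * indicator {x. 0 < \<eta> x \<and> \<eta> x < \<delta> k} x \<le> M x" for k
      by (auto simp: indicator_def)
  qed (use Mfin in auto)
  then have "(\<lambda>k. (\<integral>\<^sup>+x\<in>U. B x \<partial>m) + (\<integral>\<^sup>+x. M x * indicator {x. 0 < \<eta> x \<and> \<eta> x < \<delta> k} x \<partial>m))
      \<longlonglongrightarrow> (\<integral>\<^sup>+x\<in>U. B x \<partial>m) + 0"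
    by (intro tendsto_add) auto
  ultimately have "(\<integral>\<^sup>+x\<in>U. A x \<partial>m) \<le> (\<integral>\<^sup>+x\<in>U. B x \<partial>m) + 0"
    using step by (intro LIMSEQ_le) auto
  then show ?thesis by (simp add: A_def B_def)
qed

section \<open>Densities\<close>

text \<open>The pair \<open>f + h\<close>, \<open>f - h\<close> has sum \<open>2 f\<close> and
  difference \<open>2 h\<close>, so the one-sided inequality applied to it is the reverse inequality
  for \<open>f\<close>, \<open>h\<close>. Equality of the integrals over bounded open sets, which
  generate the Borel sets and are stable under intersection, then identifies the two finite
  densities.\<close>

lemma parallelogram_AE:
  fixes m :: "'a::{metric_space, second_countable_topology} measure"
  assumes n: "sets m = sets borel" and fin: "finite_on_bounded m" and q: "cheeger_quadratic m"
    and S: "f \<in> S2 m" "h \<in> S2 m"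
  shows "AE x in m. sum_diff_square m f h x = sum_square m f h x"
proof -
  note mS[measurable] = measurable_squares[OF n S]
  note S' = S2_add[OF n S] S2_diff[OF n S]
  have twice: "AE x in m. sum_diff_square m (\<lambda>x. f x + h x) (\<lambda>x. f x - h x) x = 2 * sum_square m f h x"
    using wgrad_cmult[OF n S(1), of 2] wgrad_cmult[OF n S(2), of 2]
    by (auto simp: sum_diff_square_def sum_square_def power_mult_distrib distrib_left mult.assoc[symmetric]
        elim!: eventually_elim2)
  have eq: "(\<integral>\<^sup>+x\<in>U. sum_diff_square m f h x \<partial>m) = (\<integral>\<^sup>+x\<in>U. sum_square m f h x \<partial>m)"
    if U: "open U" "bounded U" for U
  proof (rule antisym)
    have [measurable]: "U \<in> sets m" using U n by simp
    have finU: "emeasure m U < \<infinity>" using fin U by (auto simp: finite_on_bounded_def)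
    show "(\<integral>\<^sup>+x\<in>U. sum_diff_square m f h x \<partial>m) \<le> (\<integral>\<^sup>+x\<in>U. sum_square m f h x \<partial>m)"
      by (rule parallelogram_open_le[OF n q S U(1) finU])
    have "2 * (\<integral>\<^sup>+x\<in>U. sum_square m f h x \<partial>m) = (\<integral>\<^sup>+x\<in>U. 2 * sum_square m f h x \<partial>m)"
      unfolding mult.assoc by (rule nn_integral_cmult[symmetric]) measurable
    also have "\<dots> = (\<integral>\<^sup>+x\<in>U. sum_diff_square m (\<lambda>x. f x + h x) (\<lambda>x. f x - h x) x \<partial>m)"
      using twice by (intro nn_integral_cong_AE, eventually_elim) simp
    also have "\<dots> \<le> (\<integral>\<^sup>+x\<in>U. sum_square m (\<lambda>x. f x + h x) (\<lambda>x. f x - h x) x \<partial>m)"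
      by (rule parallelogram_open_le[OF n q S' U(1) finU])
    also have "\<dots> = (\<integral>\<^sup>+x. 2 * (sum_diff_square m f h x * indicator U x) \<partial>m)"
      by (intro nn_integral_cong) (simp add: sum_square_def sum_diff_square_def algebra_simps)
    also have "\<dots> = 2 * (\<integral>\<^sup>+x\<in>U. sum_diff_square m f h x \<partial>m)"
      by (rule nn_integral_cmult) measurable
    finally have le: "2 * (\<integral>\<^sup>+x\<in>U. sum_square m f h x \<partial>m) \<le> 2 * (\<integral>\<^sup>+x\<in>U. sum_diff_square m f h x \<partial>m)" .
    have "2 * x \<le> 2 * y \<Longrightarrow> x \<le> y" for x y :: ennreal
      by (subst (asm) ennreal_mult_le_mult_iff) auto
    with le show "(\<integral>\<^sup>+x\<in>U. sum_square m f h x \<partial>m) \<le> (\<integral>\<^sup>+x\<in>U. sum_diff_square m f h x \<partial>m)" by blast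
  qed
  define E where "E = {U :: 'a set. open U \<and> bounded U}"
  define x0 :: 'a where "x0 = undefined"
  have balls: "(\<Union>i::nat. ball x0 (real (Suc i))) = UNIV"
  proof -
    have "\<exists>i::nat. dist x0 x < real (Suc i)" for x
    proof -
      obtain i :: nat where "dist x0 x < real i" using reals_Archimedean2 by blast
      then show ?thesis by (intro exI[of _ i]) simp
    qed
    then show ?thesis by auto
  qed
  have "sets (borel :: 'a measure) = sigma_sets UNIV {U. open U}" by (simp add: borel_def)
  also have "\<dots> = sigma_sets UNIV E"
  proof (rule sigma_sets_eqI)
    fix U :: "'a set" assume "U \<in> {U. open U}"
    then have "U \<inter> ball x0 (real (Suc i)) \<in> E" for i by (auto simp: E_def intro: bounded_subset[OF bounded_ball])
    then have "(\<Union>i::nat. U \<inter> ball x0 (real (Suc i))) \<in> sigma_sets UNIV E"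
      by (intro sigma_sets.Union) auto
    also have "(\<Union>i::nat. U \<inter> ball x0 (real (Suc i))) = U" using balls by auto
    finally show "U \<in> sigma_sets UNIV E" .
  next
    fix U assume "U \<in> E" then show "U \<in> sigma_sets UNIV {U. open U}" by (auto simp: E_def)
  qed
  finally have gen: "sets m = sigma_sets UNIV E" using n by simp
  have finS: "(\<integral>\<^sup>+x. sum_square m f h x \<partial>m) \<noteq> \<infinity>" using nn_integral_sum_square(2)[OF n S] by simp
  have "density m (sum_square m f h) = density m (sum_diff_square m f h)"
  proof (rule measure_eqI_generator_eq[where E = E and \<Omega> = UNIV and A = "\<lambda>i. ball x0 (real (Suc i))"])
    show "Int_stable E" by (auto simp: Int_stable_def E_def intro: bounded_subset)
    fix U assume "U \<in> E"
    then show "emeasure (density m (sum_square m f h)) U = emeasure (density m (sum_diff_square m f h)) U"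
      using eq[of U] n by (subst (1 2) emeasure_density) (auto simp: E_def)
  next
    fix i
    have "emeasure (density m (sum_square m f h)) (ball x0 (real (Suc i))) \<le> (\<integral>\<^sup>+x. sum_square m f h x \<partial>m)"
      using n by (subst emeasure_density) (auto intro!: nn_integral_mono simp: indicator_def)
    then show "emeasure (density m (sum_square m f h)) (ball x0 (real (Suc i))) \<noteq> \<infinity>"
      using finS by (auto simp: top_unique)
  qed (use gen balls in \<open>auto simp: E_def\<close>)
  then have "AE x in m. sum_square m f h x = sum_diff_square m f h x"
    using finS by (subst (asm) finite_density_unique) auto
  then show ?thesis by eventually_elim simp
qed

section \<open>Test plans and gradients for a measure with bounded density\<close>

lemma continuous_on_unit_interval_ge:
  fixes F :: "real \<Rightarrow> real"
  assumes "continuous_on {0..1} F" "\<And>q. q \<in> \<rat> \<inter> {0..1} \<Longrightarrow> e \<le> F q" "t \<in> {0..1}"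
  shows "e \<le> F t"
proof (rule continuous_ge_on_closure[of "\<rat> \<inter> {0..1}" F t e])
  have "closure (\<rat> \<inter> {0..1}) \<subseteq> {0..1::real}" by (intro closure_minimal) auto
  then show "continuous_on (closure (\<rat> \<inter> {0..1})) F" by (rule continuous_on_subset[OF assms(1)])
  show "t \<in> closure (\<rat> \<inter> {0..1})" using assms(3) closure_Rats_unit_interval by auto
qed (use assms(2) in auto)

locale bounded_density =
  fixes m \<rho> :: "'a::{metric_space, second_countable_topology} measure" and g :: "'a \<Rightarrow> real" and C :: real
  assumes n: "sets m = sets borel" and g: "g \<in> borel_measurable borel"
    and g0: "AE x in m. 0 \<le> g x" and gC: "AE x in m. g x \<le> C" and C0: "C \<ge> 0"
    and \<rho>: "\<rho> = density m (\<lambda>x. ennreal (g x))"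
begin

lemma sets_density_borel: "sets \<rho> = sets borel"
  by (simp add: \<rho> n)

lemma g_measurable: "g \<in> borel_measurable m" "(\<lambda>x. ennreal (g x)) \<in> borel_measurable m"
  using g by (simp_all add: borel_measurable_eq[OF n])

lemma AE_density_iff: "(AE x in \<rho>. P x) \<longleftrightarrow> (AE x in m. 0 < g x \<longrightarrow> P x)"
  unfolding \<rho> using g_measurable by (subst AE_density) (auto simp: ennreal_less_zero_iff)

lemma AE_density_of_AE: "AE x in m. P x \<Longrightarrow> AE x in \<rho>. P x"
  unfolding AE_density_iff by (auto elim: eventually_mono)

lemma nn_integral_density_le:
  assumes "F \<in> borel_measurable borel"
  shows "(\<integral>\<^sup>+x. F x \<partial>\<rho>) \<le> ennreal C * (\<integral>\<^sup>+x. F x \<partial>m)"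
proof -
  have [measurable]: "F \<in> borel_measurable m" using assms by (simp add: borel_measurable_eq[OF n])
  have "(\<integral>\<^sup>+x. F x \<partial>\<rho>) = (\<integral>\<^sup>+x. ennreal (g x) * F x \<partial>m)"
    unfolding \<rho> using g_measurable by (subst nn_integral_density) auto
  also have "\<dots> \<le> (\<integral>\<^sup>+x. ennreal C * F x \<partial>m)"
    using gC by (intro nn_integral_mono_AE, eventually_elim) (auto intro!: mult_right_mono ennreal_leI)
  also have "\<dots> = ennreal C * (\<integral>\<^sup>+x. F x \<partial>m)" by (rule nn_integral_cmult) auto
  finally show ?thesis .
qed

text \<open>From \<open>\<rho> \<le> C m\<close>; only the constant in the marginal bound changes.
  Hence weak upper gradients for \<open>m\<close> remain such for \<open>\<rho>\<close>.\<close>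

lemma test_plan_density: "test_plan \<rho> \<pi> \<Longrightarrow> test_plan m \<pi>"
proof -
  assume \<pi>: "test_plan \<rho> \<pi>"
  obtain D :: real where D: "D \<ge> 0"
    "\<And>t A. t \<in> {0..1} \<Longrightarrow> A \<in> sets borel \<Longrightarrow> emeasure \<pi> {\<gamma> \<in> space \<pi>. apply_bcontfun \<gamma> t \<in> A} \<le> ennreal D * emeasure \<rho> A"
    using \<pi> unfolding test_plan_iff by auto
  have "emeasure \<rho> A \<le> ennreal C * emeasure m A" if "A \<in> sets borel" for A
    using nn_integral_density_le[of "indicator A"] that n sets_density_borel by simp
  then have "ennreal D * emeasure \<rho> A \<le> ennreal (D * C) * emeasure m A" if "A \<in> sets borel" for A
    using that D(1) C0 by (auto simp: ennreal_mult mult.assoc intro!: mult_left_mono)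
  then show "test_plan m \<pi>"
    using \<pi> D(1) C0 order_trans[OF D(2)] unfolding test_plan_iff
    by (intro conjI exI[of _ "D * C"] ballI) auto
qed

lemma weak_upper_gradient_density: "weak_upper_gradient m f G \<Longrightarrow> weak_upper_gradient \<rho> f G"
  unfolding weak_upper_gradient_iff using test_plan_density by blast

lemma
  assumes f: "f \<in> S2 m"
  shows S2_density: "f \<in> S2 \<rho>" and wgrad_density_le: "AE x in \<rho>. wgrad \<rho> f x \<le> wgrad m f x"
proof -
  note w = weak_upper_gradient_density[OF weak_upper_gradient_min_weak[OF f n]]
  have [measurable]: "wgrad m f \<in> borel_measurable borel"
    by (rule borel_measurable_min_weak_upper_gradient[OF f n])
  have "(\<integral>\<^sup>+x. (wgrad m f x)\<^sup>2 \<partial>\<rho>) \<le> ennreal C * (\<integral>\<^sup>+x. (wgrad m f x)\<^sup>2 \<partial>m)"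
    by (rule nn_integral_density_le) measurable
  also have "\<dots> < \<infinity>" using nn_integral_min_weak_upper_gradient[OF f n] by (simp add: ennreal_mult_less_top)
  finally show S: "f \<in> S2 \<rho>" by (rule S2I[OF w])
  show "AE x in \<rho>. wgrad \<rho> f x \<le> wgrad m f x"
    by (rule min_weak_upper_gradient_le[OF S sets_density_borel w])
qed

text \<open>
  A curve of a test plan for \<^term>\<open>m\<close> either stays in a region where \<^term>\<open>g\<close> is bounded below, and
  conditioning on such curves gives a test plan for \<^term>\<open>\<rho>\<close>, or it meets a zero of the truncation
  level, and then the truncated function is controlled by the level alone.
\<close>

lemma weak_upper_gradient_truncate:
  assumes w\<eta>: "weak_upper_gradient m \<eta> H" and \<eta>0: "\<And>x. 0 \<le> \<eta> x"
    and \<epsilon>: "\<epsilon> > 0" "\<And>x. 0 < \<eta> x \<Longrightarrow> \<epsilon> \<le> g x"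
    and wf: "weak_upper_gradient \<rho> f G" and \<pi>: "test_plan m \<pi>"
  shows "AE \<gamma> in \<pi>. ennreal \<bar>max (- \<eta> (apply_bcontfun \<gamma> 1)) (min (f (apply_bcontfun \<gamma> 1)) (\<eta> (apply_bcontfun \<gamma> 1)))
      - max (- \<eta> (apply_bcontfun \<gamma> 0)) (min (f (apply_bcontfun \<gamma> 0)) (\<eta> (apply_bcontfun \<gamma> 0)))\<bar>
      \<le> line_int (\<lambda>x. max (if 0 < \<eta> x then G x else 0) (H x)) (apply_bcontfun \<gamma>) 0 1"
proof -
  note \<pi>s = test_planD(1)[OF \<pi>]
  note m\<eta>[measurable] = weak_upper_gradientD[OF w\<eta>]
  note [measurable] = measurable_curve_eval[OF \<pi>s]
  interpret prob_space \<pi> by (rule test_planD(2)[OF \<pi>])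
  \<comment> \<open>Rational times make the set measurable; the uniform lower bound survives in the
    continuous representative, where mere positivity at rational times would not.\<close>
  define A where "A k = {\<gamma> \<in> space \<pi>. \<forall>q::rat. 0 \<le> q \<and> q \<le> 1 \<longrightarrow> 1 / real (Suc k) \<le> \<eta> (apply_bcontfun \<gamma> (of_rat q))}" for k
  have A[measurable]: "A k \<in> sets \<pi>" for k unfolding A_def by measurable
  have AD: "1 / real (Suc k) \<le> \<eta> (apply_bcontfun \<gamma> q)" if "\<gamma> \<in> A k" "q \<in> \<rat> \<inter> {0..1}" for k \<gamma> q
  proof -
    have "q \<in> \<rat>" using that(2) by simp
    then obtain r where r: "q = of_rat r" by (auto simp: Rats_def)
    with that show ?thesis by (auto simp: A_def)
  qed
  obtain D :: real where D: "D \<ge> 0"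
    "\<And>t A. t \<in> {0..1} \<Longrightarrow> A \<in> sets borel \<Longrightarrow> emeasure \<pi> {\<gamma> \<in> space \<pi>. apply_bcontfun \<gamma> t \<in> A} \<le> ennreal D * emeasure m A"
    using \<pi> unfolding test_plan_iff by auto
  have rep: "AE \<gamma> in \<pi>. \<exists>F. continuous_on {0..1} F \<and> (\<forall>t\<in>insert t0 (\<rat> \<inter> {0..1}). F t = \<eta> (apply_bcontfun \<gamma> t)) \<and>
      (AE t in lborel. t \<in> {0..1} \<longrightarrow> F t = \<eta> (apply_bcontfun \<gamma> t)) \<and>
      (\<forall>s t. 0 \<le> s \<longrightarrow> s \<le> t \<longrightarrow> t \<le> 1 \<longrightarrow> ennreal \<bar>F t - F s\<bar> \<le> line_int H (apply_bcontfun \<gamma>) s t)"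
    if t0: "t0 \<in> {0..1}" for t0
    using weak_upper_gradient_representative[OF w\<eta> \<pi> t0] weak_upper_gradient_AE[OF w\<eta> \<pi>]
  proof eventually_elim
    case (elim \<gamma>)
    from elim(1) obtain F where F: "\<forall>t\<in>insert t0 (\<rat> \<inter> {0..1}). F t = \<eta> (apply_bcontfun \<gamma> t)"
      "AE t in lborel. t \<in> {0..1} \<longrightarrow> F t = \<eta> (apply_bcontfun \<gamma> t)"
      "\<forall>s t. 0 \<le> s \<longrightarrow> s \<le> t \<longrightarrow> t \<le> 1 \<longrightarrow> ennreal \<bar>F t - F s\<bar> \<le> line_int H (apply_bcontfun \<gamma>) s t"
      by blast
    have "continuous_on {0..1} F"
      by (rule AC_bound_continuous_on[OF measurable_line_int_integrand[OF m\<eta>(2), of \<gamma>]])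
         (use F(3) elim(2) in \<open>auto simp: line_int_def\<close>)
    with F show ?case by blast
  qed
  have stay: "AE \<gamma> in \<pi>. \<gamma> \<in> A k \<longrightarrow>
      ennreal \<bar>f (apply_bcontfun \<gamma> 1) - f (apply_bcontfun \<gamma> 0)\<bar> \<le> line_int G (apply_bcontfun \<gamma>) 0 1" for k
  proof (cases "emeasure \<pi> (A k) = 0")
    case True
    then have "A k \<in> null_sets \<pi>" by (intro null_setsI A)
    from AE_not_in[OF this] show ?thesis by eventually_elim simp
  next
    case False
    have "test_plan \<rho> (uniform_measure \<pi> (A k))"
    proof (rule test_plan_uniform_measure[OF \<pi> A False])
      \<comment> \<open>Curves in \<open>A k\<close> are almost surely in
        \<open>{x. 0 < \<eta> x}\<close> at each given time, and there
        \<open>\<epsilon> m \<le> \<rho>\<close>.\<close>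
      show "0 \<le> D / \<epsilon>" using D \<epsilon> by simp
      fix t :: real and B :: "'a set" assume t: "t \<in> {0..1}" and B[measurable]: "B \<in> sets borel"
      have [measurable]: "B \<inter> {x. 0 < \<eta> x} \<in> sets borel" by measurable
      \<comment> \<open>The time \<open>t\<close> may be irrational, so the representative is chosen
        to be exact at \<open>t\<close> as well.\<close>
      have "AE \<gamma> in \<pi>. \<gamma> \<in> A k \<longrightarrow> 0 < \<eta> (apply_bcontfun \<gamma> t)"
        using rep[OF t]
      proof eventually_elim
        case (elim \<gamma>)
        then obtain F where F: "continuous_on {0..1} F" "\<forall>t\<in>insert t (\<rat> \<inter> {0..1}). F t = \<eta> (apply_bcontfun \<gamma> t)" by blast
        show ?case
        proof
          assume "\<gamma> \<in> A k"
          then have "1 / real (Suc k) \<le> F t"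
            using F(2) AD by (intro continuous_on_unit_interval_ge[OF F(1) _ t]) auto
          moreover have "0 < 1 / real (Suc k)" by simp
          ultimately have "0 < F t" by (rule less_le_trans[rotated])
          then show "0 < \<eta> (apply_bcontfun \<gamma> t)" using F(2) by simp
        qed
      qed
      then have "emeasure \<pi> {\<gamma> \<in> space \<pi>. \<gamma> \<in> A k \<and> apply_bcontfun \<gamma> t \<in> B}
          \<le> emeasure \<pi> {\<gamma> \<in> space \<pi>. apply_bcontfun \<gamma> t \<in> B \<inter> {x. 0 < \<eta> x}}"
        by (intro emeasure_mono_AE) (auto elim!: eventually_mono)
      also have "\<dots> \<le> ennreal D * emeasure m (B \<inter> {x. 0 < \<eta> x})"
        by (rule D(2)[OF t]) measurable
      also have "\<dots> = ennreal (D / \<epsilon>) * (ennreal \<epsilon> * emeasure m (B \<inter> {x. 0 < \<eta> x}))"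
        using D \<epsilon> by (simp add: mult.assoc[symmetric] ennreal_mult[symmetric])
      also have "ennreal \<epsilon> * emeasure m (B \<inter> {x. 0 < \<eta> x}) \<le> emeasure \<rho> B"
      proof -
        have [measurable]: "B \<inter> {x. 0 < \<eta> x} \<in> sets m" "B \<in> sets m" using n by auto
        have "ennreal \<epsilon> * emeasure m (B \<inter> {x. 0 < \<eta> x}) = (\<integral>\<^sup>+x. ennreal \<epsilon> * indicator (B \<inter> {x. 0 < \<eta> x}) x \<partial>m)"
          by (rule nn_integral_cmult_indicator[symmetric]) measurable
        also have "\<dots> \<le> (\<integral>\<^sup>+x. ennreal (g x) * indicator B x \<partial>m)"
          using \<epsilon>(2) by (intro nn_integral_mono) (auto simp: indicator_def intro: ennreal_leI)
        also have "\<dots> = emeasure \<rho> B"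
          unfolding \<rho> using g_measurable by (subst emeasure_density) auto
        finally show ?thesis .
      qed
      finally show "emeasure \<pi> {\<gamma> \<in> space \<pi>. \<gamma> \<in> A k \<and> apply_bcontfun \<gamma> t \<in> B} \<le> ennreal (D / \<epsilon>) * emeasure \<rho> B"
        by (simp add: mult_left_mono)
    qed
    from weak_upper_gradient_AE[OF wf this] False
    have "AE \<gamma> in \<pi>. \<gamma> \<in> A k \<longrightarrow> (ennreal \<bar>f (apply_bcontfun \<gamma> 1) - f (apply_bcontfun \<gamma> 0)\<bar> \<le> line_int G (apply_bcontfun \<gamma>) 0 1 \<and>
        line_int G (apply_bcontfun \<gamma>) 0 1 < \<infinity>)"
      by (subst (asm) AE_uniform_measure) (auto simp: less_top[symmetric])
    then show ?thesis by eventually_elim simp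
  qed
  have zero: "(0::real) \<in> {0..1}" by simp
  have "AE \<gamma> in \<pi>. \<forall>k. \<gamma> \<in> A k \<longrightarrow>
      ennreal \<bar>f (apply_bcontfun \<gamma> 1) - f (apply_bcontfun \<gamma> 0)\<bar> \<le> line_int G (apply_bcontfun \<gamma>) 0 1"
    unfolding AE_all_countable using stay by blast
  moreover have "AE \<gamma> in \<pi>. \<gamma> \<in> space \<pi>" by (rule AE_space)
  ultimately show ?thesis
    using rep[OF zero]
  proof eventually_elim
    case (elim \<gamma>)
    let ?c = "apply_bcontfun \<gamma>"
    let ?u = "\<lambda>x. max (- \<eta> x) (min (f x) (\<eta> x))"
    let ?K = "\<lambda>x. max (if 0 < \<eta> x then G x else 0) (H x)"
    from elim(3) obtain F where F: "continuous_on {0..1} F" "\<forall>t\<in>insert 0 (\<rat> \<inter> {0..1}). F t = \<eta> (?c t)"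
      "AE t in lborel. t \<in> {0..1} \<longrightarrow> F t = \<eta> (?c t)"
      "\<forall>s t. 0 \<le> s \<longrightarrow> s \<le> t \<longrightarrow> t \<le> 1 \<longrightarrow> ennreal \<bar>F t - F s\<bar> \<le> line_int H ?c s t" by blast
    have ends: "F 0 = \<eta> (?c 0)" "F 1 = \<eta> (?c 1)" using F(2) by auto
    have HK: "line_int H ?c 0 1 \<le> line_int ?K ?c 0 1" by (rule line_int_mono) simp
    show ?case
    proof (cases "\<exists>z\<in>{0..1}. F z \<le> 0")
      case True
      then obtain z where z: "z \<in> {0..1}" "F z \<le> 0" by blast
      \<comment> \<open>The truncation is at most \<open>\<eta>\<close> in modulus, and at each end
        \<open>\<eta>\<close> is at most its variation from the time \<open>z\<close>, where it is
        not positive.\<close>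
      have "\<bar>?u (?c 1) - ?u (?c 0)\<bar> \<le> \<eta> (?c 0) + \<eta> (?c 1)"
        using \<eta>0[of "?c 0"] \<eta>0[of "?c 1"] by linarith
      also have "\<dots> \<le> \<bar>F z - F 0\<bar> + \<bar>F 1 - F z\<bar>" using ends z by linarith
      finally have "ennreal \<bar>?u (?c 1) - ?u (?c 0)\<bar> \<le> ennreal \<bar>F z - F 0\<bar> + ennreal \<bar>F 1 - F z\<bar>"
        by (simp add: ennreal_plus[symmetric] ennreal_leI del: ennreal_plus)
      also have "\<dots> \<le> line_int H ?c 0 z + line_int H ?c z 1"
        using F(4) z by (intro add_mono) auto
      also have "\<dots> = line_int H ?c 0 1"
        unfolding line_int_def using nn_integral_Icc_split[OF measurable_line_int_integrand[OF m\<eta>(2), of \<gamma>], of 0 z 1] z by simp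
      finally show ?thesis using HK by (rule order_trans)
    next
      case False
      \<comment> \<open>A positive continuous function has a positive minimum, which puts the curve
        in some \<open>A k\<close>.\<close>
      obtain z where z: "z \<in> {0..1}" "\<And>t. t \<in> {0..1} \<Longrightarrow> F z \<le> F t"
        using continuous_attains_inf[OF _ _ F(1)] by auto
      have "0 < F z" using False z(1) by force
      then obtain k where k: "1 / real (Suc k) < F z"
        using reals_Archimedean[of "F z"] by (auto simp: inverse_eq_divide)
      have "\<gamma> \<in> A k"
        unfolding A_def
      proof (intro CollectI conjI elim(2) allI impI)
        fix q :: rat assume q: "0 \<le> q \<and> q \<le> 1"
        then have "of_rat q \<in> \<rat> \<inter> {0..1::real}" by simp
        then show "1 / real (Suc k) \<le> \<eta> (?c (of_rat q))"
          using F(2) z(2)[of "of_rat q"] k by force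
      qed
      then have fle: "ennreal \<bar>f (?c 1) - f (?c 0)\<bar> \<le> line_int G ?c 0 1" using elim(1) by blast
      have "line_int G ?c 0 1 \<le> line_int ?K ?c 0 1"
        unfolding line_int_def
      proof (intro nn_integral_mono_AE, use F(3) in eventually_elim)
        case (elim r)
        show ?case
        proof (cases "r \<in> {0..1}")
          case True
          then have "0 < \<eta> (?c r)" using elim False by force
          then show ?thesis by (auto intro!: mult_right_mono)
        qed simp
      qed
      moreover have "ennreal \<bar>\<eta> (?c 1) - \<eta> (?c 0)\<bar> \<le> line_int ?K ?c 0 1"
        using F(4)[rule_format, of 0 1] HK ends by (auto intro: order_trans)
      moreover have "\<bar>?u (?c 1) - ?u (?c 0)\<bar> \<le> \<bar>f (?c 1) - f (?c 0)\<bar> \<or> \<bar>?u (?c 1) - ?u (?c 0)\<bar> \<le> \<bar>\<eta> (?c 1) - \<eta> (?c 0)\<bar>"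
        by linarith
      ultimately show ?thesis
        using fle by (auto intro: order_trans[OF ennreal_leI] order_trans)
    qed
  qed
qed

end

section \<open>Densities whose square root is Sobolev\<close>

locale sobolev_density = bounded_density +
  assumes w: "(\<lambda>x. sqrt (g x)) \<in> S2 m"
begin

lemma nn_integral_density_eq:
  assumes "F \<in> borel_measurable m"
  shows "(\<integral>\<^sup>+x. F x \<partial>\<rho>) = (\<integral>\<^sup>+x. ennreal (g x) * F x \<partial>m)"
  unfolding \<rho> using assms g_measurable by (subst nn_integral_density) auto

text \<open>A truncation height made of the root of \<open>g\<close>: zero while the root is at most
  \<open>1 / j\<close>, and equal to \<open>j\<close> once it reaches \<open>2 / j\<close>, because
  the slope \<open>j^2\<close> gains \<open>j\<close> over a length \<open>1 / j\<close>.\<close>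

definition level :: "real \<Rightarrow> 'a \<Rightarrow> real" where
  "level j x = min (j\<^sup>2 * max (sqrt (g x) - 1 / j) 0) j"

text \<open>Here \<open>level j\<close> equals \<open>j\<close>, so truncating \<open>f\<close> at
  that height does nothing.\<close>

definition good_set :: "('a \<Rightarrow> real) \<Rightarrow> real \<Rightarrow> 'a set" where
  "good_set f j = {x. 2 / j \<le> sqrt (g x) \<and> \<bar>f x\<bar> \<le> j}"

lemma good_set_exhaust:
  assumes "0 < g x"
  shows "\<exists>i. x \<in> good_set f (real (Suc i)) \<inter> good_set h (real (Suc i))"
proof -
  define s where "s = sqrt (g x)"
  have s: "s > 0" using assms by (simp add: s_def)
  obtain i :: nat where i: "max (2 / s) (max \<bar>f x\<bar> \<bar>h x\<bar>) < real i"
    using reals_Archimedean2 by blast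
  then have "2 / s \<le> real (Suc i)" "\<bar>f x\<bar> \<le> real (Suc i)" "\<bar>h x\<bar> \<le> real (Suc i)" by auto
  moreover from this(1) have "2 / real (Suc i) \<le> s" using s by (simp add: field_simps)
  ultimately show ?thesis by (intro exI[of _ i]) (auto simp: good_set_def s_def)
qed

lemma level_S2:
  assumes j: "j > 0"
  shows "level j \<in> S2 m"
proof (rule S2_lipschitz[OF n w, of _ "j\<^sup>2"])
  show "level j \<in> borel_measurable borel" using g unfolding level_def[abs_def] by measurable
  show "\<bar>level j x - level j y\<bar> \<le> j\<^sup>2 * \<bar>sqrt (g x) - sqrt (g y)\<bar>" for x y
  proof -
    define p q where "p = max (sqrt (g x) - 1 / j) 0" and "q = max (sqrt (g y) - 1 / j) 0"
    have "\<bar>p - q\<bar> \<le> \<bar>sqrt (g x) - sqrt (g y)\<bar>" unfolding p_def q_def by linarith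
    then have "\<bar>j\<^sup>2 * p - j\<^sup>2 * q\<bar> \<le> j\<^sup>2 * \<bar>sqrt (g x) - sqrt (g y)\<bar>"
      by (simp add: right_diff_distrib[symmetric] abs_mult mult_left_mono)
    moreover have "\<bar>level j x - level j y\<bar> \<le> \<bar>j\<^sup>2 * p - j\<^sup>2 * q\<bar>"
      unfolding level_def p_def[symmetric] q_def[symmetric] by linarith
    ultimately show ?thesis by linarith
  qed
qed simp

text \<open>The witness is \<open>f\<close> truncated at height \<open>level j\<close>. Its gradient
  for \<open>m\<close> is at most the maximum \<open>H\<close> of the gradient of \<open>f\<close>
  for \<open>\<rho>\<close>, counted where the level is positive, and the gradient of the
  level.\<close>

lemma truncation_exists:
  assumes f: "f \<in> S2 \<rho>" and j: "j > 0"
  shows "\<exists>u\<in>S2 m. (\<forall>x\<in>good_set f j. u x = f x) \<and> (AE x in m. x \<in> good_set f j \<longrightarrow> wgrad m u x \<le> wgrad \<rho> f x)"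
proof -
  note n\<rho> = sets_density_borel
  let ?\<eta> = "level j"
  note \<eta>S = level_S2[OF j]
  have \<eta>0: "0 \<le> ?\<eta> x" for x using j by (simp add: level_def)
  have \<eta>pos: "1 / j\<^sup>2 \<le> g x" if "0 < ?\<eta> x" for x
  proof -
    have "1 / j < sqrt (g x)"
      using that j by (auto simp: level_def max_def zero_less_mult_iff split: if_splits)
    then have "(1 / j)\<^sup>2 \<le> (sqrt (g x))\<^sup>2" using j by (intro power_mono) auto
    moreover have "0 < 1 / j" using j by simp
    then have "0 < sqrt (g x)" using \<open>1 / j < sqrt (g x)\<close> by (rule less_trans)
    then have "g x > 0" by simp
    ultimately show ?thesis by (simp add: power_divide)
  qed
  note [measurable] = S2_borel_measurable[OF f] S2_borel_measurable[OF \<eta>S]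
    borel_measurable_min_weak_upper_gradient[OF f n\<rho>] borel_measurable_min_weak_upper_gradient[OF \<eta>S n]
  define u where "u x = max (- ?\<eta> x) (min (f x) (?\<eta> x))" for x
  define H where "H x = max (if 0 < ?\<eta> x then wgrad \<rho> f x else 0) (wgrad m ?\<eta> x)" for x
  have [measurable]: "u \<in> borel_measurable borel" "H \<in> borel_measurable borel" unfolding u_def[abs_def] H_def[abs_def] by measurable
  have Hfin: "(\<integral>\<^sup>+x. (H x)\<^sup>2 \<partial>m) < \<infinity>"
  proof -
    have [measurable]: "(\<lambda>x. wgrad \<rho> f x) \<in> borel_measurable m" "(\<lambda>x. wgrad m ?\<eta> x) \<in> borel_measurable m"
      by (simp_all add: borel_measurable_eq[OF n])
    note [measurable] = g_measurable
    \<comment> \<open>Where the level is positive, \<open>j^2 g\<close> is at least one and can be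
      inserted as a weight, turning the integral for \<open>m\<close> into one for
      \<open>\<rho>\<close>.\<close>
    have "(\<integral>\<^sup>+x. (H x)\<^sup>2 \<partial>m) \<le> (\<integral>\<^sup>+x. ennreal (j\<^sup>2) * (ennreal (g x) * (wgrad \<rho> f x)\<^sup>2) + (wgrad m ?\<eta> x)\<^sup>2 \<partial>m)"
    proof (rule nn_integral_mono)
      fix x
      have "(wgrad \<rho> f x)\<^sup>2 \<le> ennreal (j\<^sup>2) * (ennreal (g x) * (wgrad \<rho> f x)\<^sup>2)" if "0 < ?\<eta> x"
      proof -
        have "1 \<le> j\<^sup>2 * g x" using \<eta>pos[OF that] j by (simp add: field_simps)
        then have "1 * (wgrad \<rho> f x)\<^sup>2 \<le> ennreal (j\<^sup>2 * g x) * (wgrad \<rho> f x)\<^sup>2"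
          by (intro mult_right_mono) auto
        then show ?thesis by (simp add: ennreal_mult' mult.assoc)
      qed
      then show "(H x)\<^sup>2 \<le> ennreal (j\<^sup>2) * (ennreal (g x) * (wgrad \<rho> f x)\<^sup>2) + (wgrad m ?\<eta> x)\<^sup>2"
        by (auto simp: H_def max_def add_increasing add_increasing2)
    qed
    also have "\<dots> = ennreal (j\<^sup>2) * (\<integral>\<^sup>+x. (wgrad \<rho> f x)\<^sup>2 \<partial>\<rho>) + (\<integral>\<^sup>+x. (wgrad m ?\<eta> x)\<^sup>2 \<partial>m)"
      by (simp add: nn_integral_add nn_integral_cmult nn_integral_density_eq)
    also have "\<dots> < \<infinity>"
      using nn_integral_min_weak_upper_gradient[OF f n\<rho>] nn_integral_min_weak_upper_gradient[OF \<eta>S n]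
      by (simp add: ennreal_mult_less_top)
    finally show ?thesis .
  qed
  have wu: "weak_upper_gradient m u H"
  proof (rule weak_upper_gradientI[OF n _ _ Hfin])
    fix \<pi> assume \<pi>: "test_plan m \<pi>"
    have "0 < 1 / j\<^sup>2" using j by simp
    from weak_upper_gradient_truncate[OF weak_upper_gradient_min_weak[OF \<eta>S n] \<eta>0 this \<eta>pos weak_upper_gradient_min_weak[OF f n\<rho>] \<pi>]
    show "AE \<gamma> in \<pi>. ennreal \<bar>u (apply_bcontfun \<gamma> 1) - u (apply_bcontfun \<gamma> 0)\<bar> \<le> line_int H (apply_bcontfun \<gamma>) 0 1"
      unfolding u_def H_def .
  qed measurable
  have uS: "u \<in> S2 m" using wu Hfin by (rule S2I)
  have lev: "?\<eta> x = j" if "x \<in> good_set f j" for x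
  proof -
    have "1 / j \<le> sqrt (g x) - 1 / j" using that by (simp add: good_set_def)
    then have "j\<^sup>2 * (1 / j) \<le> j\<^sup>2 * max (sqrt (g x) - 1 / j) 0" by (intro mult_left_mono) auto
    then have "j \<le> j\<^sup>2 * max (sqrt (g x) - 1 / j) 0" using j by (simp add: power2_eq_square)
    then show ?thesis by (simp add: level_def)
  qed
  \<comment> \<open>The level is constant on the good set, so its gradient vanishes there and
    \<open>H\<close> reduces to the gradient of \<open>f\<close>.\<close>
  have "AE x in m. x \<in> good_set f j \<longrightarrow> wgrad m u x \<le> wgrad \<rho> f x"
    using min_weak_upper_gradient_le[OF uS n wu] min_weak_upper_gradient_const[OF n \<eta>S, of j]
    by eventually_elim (auto simp: H_def lev j)
  moreover have "u x = f x" if "x \<in> good_set f j" for x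
    using lev[OF that] that by (auto simp: u_def good_set_def)
  ultimately show ?thesis using uS by blast
qed

text \<open>On each good set \<open>f\<close> agrees with a truncation whose gradient for
  \<open>m\<close> is at most the gradient of \<open>f\<close> for \<open>\<rho>\<close>; locality
  for \<open>m\<close> transfers this to \<open>f\<close>, and the good sets exhaust
  \<open>{x. 0 < g x}\<close>.\<close>

lemma wgrad_density_eq:
  assumes f: "f \<in> S2 m"
  shows "AE x in \<rho>. wgrad \<rho> f x = wgrad m f x"
proof -
  note f\<rho> = S2_density[OF f]
  have "AE x in m. \<forall>i. x \<in> good_set f (real (Suc i)) \<longrightarrow> wgrad m f x \<le> wgrad \<rho> f x"
    unfolding AE_all_countable
  proof
    fix i
    obtain u where u: "u \<in> S2 m" "\<forall>x\<in>good_set f (real (Suc i)). u x = f x"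
      "AE x in m. x \<in> good_set f (real (Suc i)) \<longrightarrow> wgrad m u x \<le> wgrad \<rho> f x"
      using truncation_exists[OF f\<rho>, of "real (Suc i)"] by auto
    show "AE x in m. x \<in> good_set f (real (Suc i)) \<longrightarrow> wgrad m f x \<le> wgrad \<rho> f x"
      using u(3) min_weak_upper_gradient_le_on_eq[OF n f u(1)]
      by eventually_elim (use u(2) in \<open>auto intro: order_trans\<close>)
  qed
  then have "AE x in \<rho>. wgrad m f x \<le> wgrad \<rho> f x"
    unfolding AE_density_iff by eventually_elim (use good_set_exhaust in blast)
  with wgrad_density_le[OF f] show ?thesis by eventually_elim simp
qed

text \<open>On a common good set \<open>f\<close> and \<open>h\<close> agree with Sobolev functions
  for \<open>m\<close>. The law for these is known, holds for their gradients with respect to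
  \<open>\<rho>\<close> as well, and returns to \<open>f\<close> and \<open>h\<close> by
  locality.\<close>

lemma parallelogram_density_AE:
  assumes fin: "finite_on_bounded m" and q: "cheeger_quadratic m" and S: "f \<in> S2 \<rho>" "h \<in> S2 \<rho>"
  shows "AE x in \<rho>. sum_diff_square \<rho> f h x = sum_square \<rho> f h x"
proof -
  note n\<rho> = sets_density_borel
  have "AE x in \<rho>. \<forall>i. x \<in> good_set f (real (Suc i)) \<inter> good_set h (real (Suc i)) \<longrightarrow>
      sum_diff_square \<rho> f h x = sum_square \<rho> f h x"
    unfolding AE_all_countable
  proof
    fix i
    obtain u where u: "u \<in> S2 m" "\<forall>x\<in>good_set f (real (Suc i)). u x = f x"
      using truncation_exists[OF S(1), of "real (Suc i)"] by auto
    obtain v where v: "v \<in> S2 m" "\<forall>x\<in>good_set h (real (Suc i)). v x = h x"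
      using truncation_exists[OF S(2), of "real (Suc i)"] by auto
    have one: "\<bar>1::real\<bar> = 1" by simp
    show "AE x in \<rho>. x \<in> good_set f (real (Suc i)) \<inter> good_set h (real (Suc i)) \<longrightarrow>
      sum_diff_square \<rho> f h x = sum_square \<rho> f h x"
      using AE_density_of_AE[OF parallelogram_AE[OF n fin q u(1) v(1)]]
        wgrad_density_eq[OF u(1)] wgrad_density_eq[OF v(1)]
        wgrad_density_eq[OF S2_add[OF n u(1) v(1)]] wgrad_density_eq[OF S2_diff[OF n u(1) v(1)]]
        squares_eq_on[OF n\<rho> S S2_density[OF u(1)] S2_density[OF v(1)] one one, of 0 0]
    proof eventually_elim
      case (elim x)
      show ?case
      proof
        assume x: "x \<in> good_set f (real (Suc i)) \<inter> good_set h (real (Suc i))"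
        then have "sum_diff_square \<rho> f h x = sum_diff_square \<rho> u v x" "sum_square \<rho> f h x = sum_square \<rho> u v x"
          using elim(6) u(2) v(2) by auto
        moreover have "sum_diff_square \<rho> u v x = sum_diff_square m u v x" "sum_square \<rho> u v x = sum_square m u v x"
          using elim(2-5) by (simp_all add: sum_diff_square_def sum_square_def)
        ultimately show "sum_diff_square \<rho> f h x = sum_square \<rho> f h x" using elim(1) by simp
      qed
    qed
  qed
  then show ?thesis
    unfolding AE_density_iff by eventually_elim (use good_set_exhaust in blast)
qed

lemma cheeger_quadratic_density:
  assumes fin: "finite_on_bounded m" and q: "cheeger_quadratic m"
  shows "cheeger_quadratic \<rho>"
  unfolding cheeger_quadratic_def
proof (intro allI impI)
  note n\<rho> = sets_density_borel
  fix f h :: "'a \<Rightarrow> real"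
  assume "integrable \<rho> f \<and> integrable \<rho> h"
  then have m: "f \<in> borel_measurable borel" "h \<in> borel_measurable borel"
    by (auto simp: borel_measurable_eq[OF n\<rho>, symmetric] dest: borel_measurable_integrable)
  show "cheeger \<rho> (\<lambda>x. f x + h x) + cheeger \<rho> (\<lambda>x. f x - h x) = 2 * cheeger \<rho> f + 2 * cheeger \<rho> h"
  proof (cases "f \<in> S2 \<rho> \<and> h \<in> S2 \<rho>")
    case True
    then have S: "f \<in> S2 \<rho>" "h \<in> S2 \<rho>" by auto
    show ?thesis
      unfolding cheeger_parallelogram_iff[OF n\<rho> S]
      by (rule nn_integral_cong_AE[OF parallelogram_density_AE[OF fin q S]])
  next
    case False
    \<comment> \<open>Sum and difference determine both functions linearly, so here both sides of
      the law are infinite.\<close>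
    have "\<not> ((\<lambda>x. f x + h x) \<in> S2 \<rho> \<and> (\<lambda>x. f x - h x) \<in> S2 \<rho>)"
    proof
      assume *: "(\<lambda>x. f x + h x) \<in> S2 \<rho> \<and> (\<lambda>x. f x - h x) \<in> S2 \<rho>"
      have 1: "(\<lambda>x. 1 / 2 * ((f x + h x) + (f x - h x)) + 0) \<in> S2 \<rho>"
        using * by (intro S2_affine[OF n\<rho> S2_add[OF n\<rho>]]) blast+
      have 2: "(\<lambda>x. 1 / 2 * ((f x + h x) - (f x - h x)) + 0) \<in> S2 \<rho>"
        using * by (intro S2_affine[OF n\<rho> S2_diff[OF n\<rho>]]) blast+
      have 3: "(\<lambda>x. 1 / 2 * ((f x + h x) + (f x - h x)) + 0) = f" "(\<lambda>x. 1 / 2 * ((f x + h x) - (f x - h x)) + 0) = h"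
        by (rule ext, simp)+
      show False using False 1[unfolded 3(1)] 2[unfolded 3(2)] by blast
    qed
    then have "cheeger \<rho> (\<lambda>x. f x + h x) + cheeger \<rho> (\<lambda>x. f x - h x) = \<infinity>"
      by (auto simp: cheeger_def)
    moreover have "2 * cheeger \<rho> f + 2 * cheeger \<rho> h = \<infinity>"
      using False by (auto simp: cheeger_def ennreal_mult_top)
    ultimately show ?thesis by (simp only:)
  qed
qed

end

section \<open>The logarithm of the density\<close>

text \<open>The Jordan-von Neumann argument over the rationals: in the odd part of \<open>q\<close>
  the even term \<open>e\<close> cancels, leaving \<open>s (c + d) + s (c - d) = 2 * s c\<close>.
  Hence \<open>s\<close> is additive, and additive functions are linear over the rationals.\<close>

lemma parallelogram_additive:
  fixes q e :: "rat \<Rightarrow> real"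
  assumes q: "\<And>c d. q (c + d) + q (c - d) = 2 * q c + 2 * e d" and e: "\<And>d. e (- d) = e d"
    and c: "c \<ge> 0"
  shows "q c - q (- c) = of_rat c * (q 1 - q (- 1))"
proof -
  define s where "s c = q c - q (- c)" for c
  have s2: "s (c + d) + s (c - d) = 2 * s c" for c d
    using q[of c d] q[of "- c" "- d"] e[of d] by (simp add: s_def algebra_simps)
  have s0: "s 0 = 0" by (simp add: s_def)
  have add: "s (x + y) = s x + s y" for x y
  proof -
    have "(x + y) / 2 + (x - y) / 2 = x" "(x + y) / 2 - (x - y) / 2 = y" "(x + y) / 2 + (x + y) / 2 = x + y"
      by (simp_all add: field_simps)
    then show ?thesis
      using s2[of "(x + y) / 2" "(x - y) / 2"] s2[of "(x + y) / 2" "(x + y) / 2"] s0 by (simp only: diff_self)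
  qed
  have mult: "s (of_nat k * x) = real k * s x" for k x
    by (induction k) (simp_all add: s0 add distrib_right)
  obtain a b where ab: "quotient_of c = (a, b)" by (cases "quotient_of c")
  have b: "b > 0" "c = of_int a / of_int b"
    using quotient_of_denom_pos[OF ab] quotient_of_div[OF ab] by auto
  have a: "a \<ge> 0" using c b by (simp add: zero_le_divide_iff)
  have "of_nat (nat b) * c = of_nat (nat a) * 1" using a b by simp
  from arg_cong[OF this, of s] have "real (nat b) * s c = real (nat a) * s 1"
    by (simp only: mult)
  then have "s c = of_int a / of_int b * s 1" using a b(1) by (simp add: field_simps)
  also have "of_int a / of_int b = (of_rat c :: real)" using b by (simp add: of_rat_divide)
  finally show ?thesis by (simp add: s_def)
qed

text \<open>The factor four collects the one half in the energy and the one half in the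
  polarization. Gradients are finite almost everywhere, so real integrals can be subtracted.\<close>

lemma cheeger_form_eq_integral:
  fixes n :: "'a::{metric_space, second_countable_topology} measure"
  assumes n: "sets n = sets borel" and S: "f \<in> S2 n" "h \<in> S2 n"
  shows "cheeger_form n f h = (LINT x|n. (enn2real (wgrad n (\<lambda>x. f x + h x) x))\<^sup>2
      - (enn2real (wgrad n (\<lambda>x. f x - h x) x))\<^sup>2) / 4"
proof -
  have *: "integrable n (\<lambda>x. (enn2real (wgrad n u x))\<^sup>2) \<and>
      enn2real (cheeger n u) = (LINT x|n. (enn2real (wgrad n u x))\<^sup>2) / 2" if u: "u \<in> S2 n" for u
  proof -
    note [measurable] = wgrad_measurable[OF n u]
    have eq: "(\<integral>\<^sup>+x. (wgrad n u x)\<^sup>2 \<partial>n) = (\<integral>\<^sup>+x. ennreal ((enn2real (wgrad n u x))\<^sup>2) \<partial>n)"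
      using AE_min_weak_upper_gradient_finite[OF n u]
      by (intro nn_integral_cong_AE, eventually_elim) (simp add: ennreal_power[symmetric] less_top del: ennreal_power)
    have int: "integrable n (\<lambda>x. (enn2real (wgrad n u x))\<^sup>2)"
      using nn_integral_min_weak_upper_gradient[OF u n] by (intro integrableI_bounded) (auto simp: eq)
    have "cheeger n u = ennreal (LINT x|n. (enn2real (wgrad n u x))\<^sup>2) / 2"
      using u nn_integral_eq_integral[OF int] by (simp add: cheeger_def eq)
    also have "\<dots> = ennreal ((LINT x|n. (enn2real (wgrad n u x))\<^sup>2) / 2)"
      using divide_ennreal[of "LINT x|n. (enn2real (wgrad n u x))\<^sup>2" 2] by simp
    finally show ?thesis using int by simp
  qed
  show ?thesis
    using *[OF S2_add[OF n S]] *[OF S2_diff[OF n S]] S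
    by (simp add: cheeger_form_def field_simps)
qed

text \<open>The reverse triangle inequality, in a form free of subtraction of extended
  reals.\<close>

lemma wgrad_diff_le:
  fixes n :: "'a::{metric_space, second_countable_topology} measure"
  assumes n: "sets n = sets borel" and S: "u \<in> S2 n" "v \<in> S2 n"
  shows "AE x in n. wgrad n u x \<le> wgrad n v x + wgrad n (\<lambda>x. u x - v x) x \<and>
    wgrad n v x \<le> wgrad n u x + wgrad n (\<lambda>x. u x - v x) x"
proof -
  note d = S2_diff[OF n S] and d' = S2_diff[OF n S(2,1)]
  have "AE x in n. wgrad n (\<lambda>x. v x + (u x - v x)) x \<le> wgrad n v x + wgrad n (\<lambda>x. u x - v x) x"
    by (rule min_weak_upper_gradient_add[OF n S(2) d])
  moreover have "AE x in n. wgrad n (\<lambda>x. u x + (v x - u x)) x \<le> wgrad n u x + wgrad n (\<lambda>x. v x - u x) x"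
    by (rule min_weak_upper_gradient_add[OF n S(1) d'])
  moreover have "AE x in n. wgrad n (\<lambda>x. - (u x - v x)) x = wgrad n (\<lambda>x. u x - v x) x"
    by (rule wgrad_uminus[OF n d])
  ultimately show ?thesis by eventually_elim simp
qed

text \<open>
  The value at the non-smooth function is a limit of values along rational multiples, which the
  parallelogram law determines.
\<close>

lemma polarization_limit:
  fixes p :: "rat \<Rightarrow> real" and e :: "rat \<Rightarrow> real" and \<gamma> N P M :: real
  assumes q: "\<And>c d. (p (c + d))\<^sup>2 + (p (c - d))\<^sup>2 = 2 * (p c)\<^sup>2 + 2 * e d" and e: "\<And>d. e (- d) = e d"
    and \<gamma>: "\<gamma> > 0"
    and close: "\<And>a b :: rat. 0 < a \<Longrightarrow> of_rat a \<le> \<gamma> \<Longrightarrow> \<gamma> \<le> of_rat b \<Longrightarrow>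
      \<bar>P - p (1 / a)\<bar> \<le> (1 / of_rat a - 1 / of_rat b) * N \<and> \<bar>M - p (- (1 / a))\<bar> \<le> (1 / of_rat a - 1 / of_rat b) * N"
  shows "\<gamma> * (P\<^sup>2 - M\<^sup>2) = (p 1)\<^sup>2 - (p (- 1))\<^sup>2"
proof -
  define K where "K = (p 1)\<^sup>2 - (p (- 1))\<^sup>2"
  \<comment> \<open>The margin is at most half of \<open>\<gamma>\<close>, so \<open>a k\<close>
    stays positive and \<open>1 / a k\<close> is a legitimate coefficient.\<close>
  have "\<forall>k. \<exists>a::rat. \<gamma> - \<gamma> / real (k + 2) < of_rat a \<and> of_rat a < \<gamma>"
    using \<gamma> by (intro allI of_rat_dense) simp
  then obtain a :: "nat \<Rightarrow> rat" where a: "\<And>k. \<gamma> - \<gamma> / real (k + 2) < of_rat (a k)" "\<And>k. of_rat (a k) < \<gamma>"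
    by metis
  have "\<forall>k. \<exists>b::rat. \<gamma> < of_rat b \<and> of_rat b < \<gamma> + \<gamma> / real (k + 2)"
    using \<gamma> by (intro allI of_rat_dense) simp
  then obtain b :: "nat \<Rightarrow> rat" where b: "\<And>k. \<gamma> < of_rat (b k)" "\<And>k. of_rat (b k) < \<gamma> + \<gamma> / real (k + 2)"
    by metis
  have z: "(\<lambda>k. \<gamma> / real (k + 2)) \<longlonglongrightarrow> 0"
    by (rule LIMSEQ_ignore_initial_segment[OF lim_const_over_n])
  have alim: "(\<lambda>k. of_rat (a k) :: real) \<longlonglongrightarrow> \<gamma>"
  proof (rule tendsto_sandwich[where f = "\<lambda>k. \<gamma> - \<gamma> / real (k + 2)" and h = "\<lambda>k. \<gamma>"])
    show "(\<lambda>k. \<gamma> - \<gamma> / real (k + 2)) \<longlonglongrightarrow> \<gamma>" using tendsto_diff[OF tendsto_const z, of \<gamma>] by simp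
    show "(\<lambda>k. \<gamma>) \<longlonglongrightarrow> \<gamma>" by simp
  qed (use a in \<open>auto intro!: always_eventually less_imp_le\<close>)
  have blim: "(\<lambda>k. of_rat (b k) :: real) \<longlonglongrightarrow> \<gamma>"
  proof (rule tendsto_sandwich[where f = "\<lambda>k. \<gamma>" and h = "\<lambda>k. \<gamma> + \<gamma> / real (k + 2)"])
    show "(\<lambda>k. \<gamma> + \<gamma> / real (k + 2)) \<longlonglongrightarrow> \<gamma>" using tendsto_add[OF tendsto_const z, of \<gamma>] by simp
    show "(\<lambda>k. \<gamma>) \<longlonglongrightarrow> \<gamma>" by simp
  qed (use b in \<open>auto intro!: always_eventually less_imp_le\<close>)
  have apos: "0 < a k" for k
  proof -
    have "\<gamma> / real (k + 2) \<le> \<gamma>" using \<gamma> by (simp add: field_simps)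
    then have "0 < (of_rat (a k) :: real)" using a(1)[of k] by linarith
    then show ?thesis by simp
  qed
  have err: "(\<lambda>k. (1 / of_rat (a k) - 1 / of_rat (b k)) * N) \<longlonglongrightarrow> (1 / \<gamma> - 1 / \<gamma>) * N"
    using \<gamma> by (intro tendsto_intros alim blim) auto
  have cl: "\<bar>P - p (1 / a k)\<bar> \<le> (1 / of_rat (a k) - 1 / of_rat (b k)) * N"
    "\<bar>M - p (- (1 / a k))\<bar> \<le> (1 / of_rat (a k) - 1 / of_rat (b k)) * N" for k
    using close[OF apos less_imp_le[OF a(2)] less_imp_le[OF b(1)], of k k] by auto
  have lim: "(\<lambda>k. P - p (1 / a k)) \<longlonglongrightarrow> 0" "(\<lambda>k. M - p (- (1 / a k))) \<longlonglongrightarrow> 0"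
    using err cl by (auto intro!: Lim_null_comparison[where g = "\<lambda>k. (1 / of_rat (a k) - 1 / of_rat (b k)) * N"] always_eventually)
  have P: "(\<lambda>k. p (1 / a k)) \<longlonglongrightarrow> P" and M: "(\<lambda>k. p (- (1 / a k))) \<longlonglongrightarrow> M"
    using tendsto_diff[OF tendsto_const lim(1), of P] tendsto_diff[OF tendsto_const lim(2), of M] by simp_all
  have "(p (1 / a k))\<^sup>2 - (p (- (1 / a k)))\<^sup>2 = of_rat (1 / a k) * K" for k
    unfolding K_def using apos[of k] by (intro parallelogram_additive[of "\<lambda>c. (p c)\<^sup>2" e, OF q e]) auto
  then have id: "(p (1 / a k))\<^sup>2 - (p (- (1 / a k)))\<^sup>2 = 1 / of_rat (a k) * K" for k
    by (simp add: of_rat_divide)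
  have "(\<lambda>k. (p (1 / a k))\<^sup>2 - (p (- (1 / a k)))\<^sup>2) \<longlonglongrightarrow> P\<^sup>2 - M\<^sup>2"
    by (intro tendsto_intros P M)
  moreover have "(\<lambda>k. 1 / of_rat (a k) * K) \<longlonglongrightarrow> 1 / \<gamma> * K"
    using \<gamma> by (intro tendsto_intros alim) auto
  ultimately have "P\<^sup>2 - M\<^sup>2 = 1 / \<gamma> * K" unfolding id by (rule LIMSEQ_unique)
  then show ?thesis using \<gamma> by (simp add: K_def)
qed

text \<open>On \<open>{a..b}\<close> the derivative \<open>1 / y - 1 / a\<close> lies between
  \<open>1 / b - 1 / a\<close> and zero. The constant is small when \<open>a\<close> and
  \<open>b\<close> are close, which makes \<open>ln g - g / a\<close> nearly flat where
  \<open>g\<close> lies between them.\<close>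

lemma ln_minus_linear_lipschitz:
  fixes a b :: real
  assumes "0 < a" "y \<in> {a..b}" "z \<in> {a..b}"
  shows "\<bar>(ln y - 1 / a * y) - (ln z - 1 / a * z)\<bar> \<le> (1 / a - 1 / b) * \<bar>y - z\<bar>"
proof -
  have main: "\<bar>(ln y - 1 / a * y) - (ln z - 1 / a * z)\<bar> \<le> (1 / a - 1 / b) * \<bar>y - z\<bar>"
    if "a \<le> z" "z \<le> y" "y \<le> b" for y z
  proof -
    have pos: "0 < z" "0 < y" "0 < b" using that assms(1) by auto
    have "ln y - ln z = ln (y / z)" using pos by (simp add: ln_div)
    also have "\<dots> \<le> y / z - 1" using pos by (intro ln_le_minus_one) simp
    also have "\<dots> = (y - z) * (1 / z)" using pos by (simp add: field_simps)
    also have "\<dots> \<le> (y - z) * (1 / a)" using that assms(1) pos by (intro mult_left_mono divide_left_mono) auto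
    finally have up: "ln y - ln z \<le> (y - z) * (1 / a)" .
    have "ln z - ln y = ln (z / y)" using pos by (simp add: ln_div)
    also have "\<dots> \<le> z / y - 1" using pos by (intro ln_le_minus_one) simp
    also have "\<dots> = - ((y - z) * (1 / y))" using pos by (simp add: field_simps)
    finally have "(y - z) * (1 / y) \<le> ln y - ln z" by simp
    moreover have "(y - z) * (1 / b) \<le> (y - z) * (1 / y)"
      using that pos by (intro mult_left_mono divide_left_mono) auto
    ultimately have lo: "(y - z) * (1 / b) \<le> ln y - ln z" by linarith
    have "(ln y - 1 / a * y) - (ln z - 1 / a * z) = (ln y - ln z) - (y - z) * (1 / a)"
      by (simp add: diff_divide_distrib)
    moreover have "(1 / a - 1 / b) * \<bar>y - z\<bar> = (y - z) * (1 / a) - (y - z) * (1 / b)"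
    proof -
      have "\<bar>y - z\<bar> = y - z" using that by simp
      then show ?thesis by (simp only: mult.commute[of "1 / a - 1 / b"] right_diff_distrib[of "y - z"])
    qed
    ultimately show ?thesis using up lo by linarith
  qed
  show ?thesis
  proof (cases "z \<le> y")
    case True
    then show ?thesis using main[of z y] assms by auto
  next
    case False
    then have "\<bar>(ln z - 1 / a * z) - (ln y - 1 / a * y)\<bar> \<le> (1 / a - 1 / b) * \<bar>z - y\<bar>"
      using main[of y z] assms by auto
    then show ?thesis by (simp only: abs_minus_commute)
  qed
qed

text \<open>With \<open>a = 0\<close> the shifted logarithm is globally Lipschitz, with a constant
  depending on \<open>d\<close>; with \<open>a > 0\<close> the constant is at most
  \<open>1 / a\<close> for every \<open>d\<close>.\<close>

lemma ln_shift_lipschitz: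
  fixes a d y z :: real
  assumes "0 \<le> a" "0 \<le> d" "0 < a + d" "a \<le> y" "a \<le> z"
  shows "\<bar>ln (y + d) - ln (z + d)\<bar> \<le> 1 / (a + d) * \<bar>y - z\<bar>"
proof -
  have main: "ln (y + d) - ln (z + d) \<le> 1 / (a + d) * (y - z)" "0 \<le> ln (y + d) - ln (z + d)"
    if "a \<le> z" "z \<le> y" for y z
  proof -
    have pos: "0 < z + d" "0 < y + d" using that assms by auto
    have "ln (y + d) - ln (z + d) = ln ((y + d) / (z + d))" using pos by (simp add: ln_div)
    also have "\<dots> \<le> (y + d) / (z + d) - 1" using pos by (intro ln_le_minus_one) simp
    also have "\<dots> = (y - z) * (1 / (z + d))" using pos by (simp add: field_simps)
    also have "\<dots> \<le> (y - z) * (1 / (a + d))" using that assms by (intro mult_left_mono divide_left_mono) auto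
    finally show "ln (y + d) - ln (z + d) \<le> 1 / (a + d) * (y - z)" by (simp add: mult.commute)
    show "0 \<le> ln (y + d) - ln (z + d)" using pos that by simp
  qed
  show ?thesis using main[of z y] main[of y z] assms by (cases "z \<le> y") (auto simp: abs_if)
qed

section \<open>The logarithm as a Sobolev function and the identity of the two forms\<close>

context sobolev_density
begin

lemma integral_density_eq:
  fixes F :: "'a \<Rightarrow> real"
  assumes "F \<in> borel_measurable m"
  shows "(LINT x|\<rho>. F x) = (LINT x|m. g x *\<^sub>R F x)"
  unfolding \<rho> using assms g_measurable g0 by (intro integral_density) auto

text \<open>The logarithm of \<open>g\<close> is twice that of its root \<open>v\<close>. Shifted
  logarithms of \<open>v\<close> are Sobolev for \<open>\<rho>\<close>, with gradients bounded by
  one function \<open>H\<close> of order \<open>wgrad m v / v\<close>; the weight \<open>g\<close>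
  of \<open>\<rho>\<close> cancels the square of \<open>1 / v\<close>. Plans for
  \<open>\<rho>\<close> start and end where \<open>g\<close> is positive, so the increments converge
  when the shift tends to zero.\<close>

lemma log_density_S2: "(\<lambda>x. ln (g x)) \<in> S2 \<rho>"
proof -
  note n\<rho> = sets_density_borel
  define v where "v x = sqrt (g x)" for x
  have vS: "v \<in> S2 m" using w by (simp add: v_def[abs_def])
  note v\<rho> = S2_density[OF vS]
  note [measurable] = S2_borel_measurable[OF vS] g
  \<comment> \<open>On the null set where \<open>g\<close> is negative \<open>sqrt\<close> is
    negative as well; the maximum keeps the argument of the logarithm positive everywhere.\<close>
  define l where "l k x = 2 * ln (max 0 (v x) + 1 / real (Suc k))" for k x
  have lm: "l k \<in> borel_measurable borel" for k unfolding l_def[abs_def] by measurable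
  have llip: "\<bar>l k x - l k y\<bar> \<le> (2 * real (Suc k)) * \<bar>v x - v y\<bar>" for k x y
  proof -
    have "\<bar>ln (max 0 (v x) + 1 / real (Suc k)) - ln (max 0 (v y) + 1 / real (Suc k))\<bar>
        \<le> 1 / (0 + 1 / real (Suc k)) * \<bar>max 0 (v x) - max 0 (v y)\<bar>"
      by (rule ln_shift_lipschitz) auto
    also have "\<dots> \<le> real (Suc k) * \<bar>v x - v y\<bar>"
    proof -
      have "1 / (0 + 1 / real (Suc k)) = real (Suc k)" by simp
      moreover have "\<bar>max 0 (v x) - max 0 (v y)\<bar> \<le> \<bar>v x - v y\<bar>" by linarith
      ultimately show ?thesis by (simp only: mult_left_mono of_nat_0_le_iff)
    qed
    finally have *: "\<bar>ln (max 0 (v x) + 1 / real (Suc k)) - ln (max 0 (v y) + 1 / real (Suc k))\<bar>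
        \<le> real (Suc k) * \<bar>v x - v y\<bar>" .
    have "\<bar>l k x - l k y\<bar> = 2 * \<bar>ln (max 0 (v x) + 1 / real (Suc k)) - ln (max 0 (v y) + 1 / real (Suc k))\<bar>"
    proof -
      have "\<bar>2 * r - 2 * t\<bar> = 2 * \<bar>r - t\<bar>" for r t :: real by (auto simp: abs_if)
      then show ?thesis unfolding l_def .
    qed
    also have "\<dots> \<le> 2 * (real (Suc k) * \<bar>v x - v y\<bar>)" using * by (rule mult_left_mono) simp
    finally show ?thesis by (simp only: mult.assoc)
  qed
  have lS: "l k \<in> S2 \<rho>" for k
    using llip[of k] by (intro S2_lipschitz[OF n\<rho> v\<rho> lm, of "2 * real (Suc k)"]) auto
  \<comment> \<open>One factor two comes from \<open>ln g = 2 ln v\<close>, the other from a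
    rational lower bound for \<open>v x\<close>, which is chosen above
    \<open>v x / 2\<close>.\<close>
  define H where "H x = ennreal (4 / v x) * wgrad m v x" for x
  have [measurable]: "wgrad m v \<in> borel_measurable borel"
    by (rule borel_measurable_min_weak_upper_gradient[OF vS n])
  have Hm: "H \<in> borel_measurable borel" unfolding H_def[abs_def] by measurable
  have "AE x in \<rho>. 0 < g x" unfolding AE_density_iff by simp
  then have pos: "AE x in \<rho>. 0 < v x" by eventually_elim (simp add: v_def)
  have Hfin: "(\<integral>\<^sup>+x. (H x)\<^sup>2 \<partial>\<rho>) < \<infinity>"
  proof -
    have [measurable]: "(\<lambda>x. wgrad m v x) \<in> borel_measurable m" "H \<in> borel_measurable m"
      using Hm by (simp_all add: borel_measurable_eq[OF n])
    have "(\<integral>\<^sup>+x. (H x)\<^sup>2 \<partial>\<rho>) = (\<integral>\<^sup>+x. ennreal (g x) * (H x)\<^sup>2 \<partial>m)"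
      by (rule nn_integral_density_eq) measurable
    also have "\<dots> \<le> (\<integral>\<^sup>+x. 16 * (wgrad m v x)\<^sup>2 \<partial>m)"
    proof (rule nn_integral_mono)
      fix x
      show "ennreal (g x) * (H x)\<^sup>2 \<le> 16 * (wgrad m v x)\<^sup>2"
      proof (cases "0 < g x")
        case True
        then have "g x * (4 / v x)\<^sup>2 = 16" by (simp add: v_def power_divide)
        moreover have "ennreal (g x) * (H x)\<^sup>2 = ennreal (g x * (4 / v x)\<^sup>2) * (wgrad m v x)\<^sup>2"
          using True by (simp add: H_def power_mult_distrib ennreal_mult ennreal_power v_def mult.assoc)
        ultimately show ?thesis by simp
      qed (simp add: ennreal_neg)
    qed
    also have "\<dots> = 16 * (\<integral>\<^sup>+x. (wgrad m v x)\<^sup>2 \<partial>m)" by (rule nn_integral_cmult) measurable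
    also have "\<dots> < \<infinity>" using nn_integral_min_weak_upper_gradient[OF vS n] by (simp add: ennreal_mult_less_top)
    finally show ?thesis .
  qed
  have lH: "AE x in \<rho>. wgrad \<rho> (l k) x \<le> H x" for k
  proof -
    have "AE x in \<rho>. \<forall>a b :: rat. 0 < a \<and> a \<le> b \<longrightarrow> of_rat a \<le> v x \<and> v x \<le> of_rat b \<longrightarrow>
        wgrad \<rho> (l k) x \<le> ennreal (2 / of_rat a) * wgrad \<rho> v x"
      unfolding AE_all_countable
    proof (intro allI)
      fix a b :: rat
      show "AE x in \<rho>. 0 < a \<and> a \<le> b \<longrightarrow> of_rat a \<le> v x \<and> v x \<le> of_rat b \<longrightarrow>
        wgrad \<rho> (l k) x \<le> ennreal (2 / of_rat a) * wgrad \<rho> v x"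
      proof (cases "0 < a \<and> a \<le> b")
        case True
        then have ab: "0 < (of_rat a :: real)" "(of_rat a :: real) \<le> of_rat b" by (auto simp: of_rat_less_eq)
        have "AE x in \<rho>. of_rat a \<le> v x \<and> v x \<le> of_rat b \<longrightarrow>
            wgrad \<rho> (\<lambda>x. 2 * ln (max 0 (v x) + 1 / real (Suc k))) x \<le> ennreal (2 / of_rat a) * wgrad \<rho> v x"
        proof (rule wgrad_composition_le[OF n\<rho> v\<rho> _ ab(2), where \<psi> = "\<lambda>y. 2 * ln (max 0 y + 1 / real (Suc k))"])
          show "(\<lambda>x. 2 * ln (max 0 (v x) + 1 / real (Suc k))) \<in> S2 \<rho>" using lS by (simp add: l_def[abs_def])
        next
          fix y z :: real assume yz: "y \<in> {of_rat a..of_rat b}" "z \<in> {of_rat a..of_rat b}"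
          have "0 < y" "0 < z" using ab(1) yz unfolding atLeastAtMost_iff by linarith+
          then have yz0: "max 0 y = y" "max 0 z = z" by auto
          have "\<bar>ln (y + 1 / real (Suc k)) - ln (z + 1 / real (Suc k))\<bar> \<le> 1 / (of_rat a + 1 / real (Suc k)) * \<bar>y - z\<bar>"
            using ab yz by (intro ln_shift_lipschitz) (auto intro: add_pos_pos)
          also have "\<dots> \<le> 1 / of_rat a * \<bar>y - z\<bar>"
            using ab by (intro mult_right_mono frac_le) auto
          finally show "\<bar>2 * ln (max 0 y + 1 / real (Suc k)) - 2 * ln (max 0 z + 1 / real (Suc k))\<bar> \<le> 2 / of_rat a * \<bar>y - z\<bar>"
            unfolding yz0 right_diff_distrib[symmetric] abs_mult by simp
        qed (use ab in auto)
        then show ?thesis by (auto simp: l_def[abs_def] elim: eventually_mono)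
      qed auto
    qed
    with pos wgrad_density_le[OF vS] show ?thesis
    proof eventually_elim
      case (elim x)
      obtain a :: rat where a: "v x / 2 < of_rat a" "of_rat a < v x" using of_rat_dense[of "v x / 2" "v x"] elim(1) by auto
      obtain b :: rat where b: "v x < of_rat b" "of_rat b < v x + 1" using of_rat_dense[of "v x" "v x + 1"] by auto
      have "0 < (of_rat a :: real)" using a elim(1) by linarith
      then have a0: "0 < a" by simp
      have "(of_rat a :: real) < of_rat b" using a b by linarith
      then have "a \<le> b" by (simp add: of_rat_less)
      with elim(3) a0 a b have "wgrad \<rho> (l k) x \<le> ennreal (2 / of_rat a) * wgrad \<rho> v x" by (auto simp: less_imp_le)
      also have "\<dots> \<le> ennreal (4 / v x) * wgrad m v x"
      proof (rule mult_mono)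
        show "ennreal (2 / of_rat a) \<le> ennreal (4 / v x)"
          using a elim(1) \<open>0 < (of_rat a :: real)\<close> by (intro ennreal_leI) (simp add: field_simps)
      qed (use elim(2) in auto)
      finally show ?case by (simp add: H_def)
    qed
  qed
  have "weak_upper_gradient \<rho> (\<lambda>x. ln (g x)) H"
  proof (rule weak_upper_gradientI[OF n\<rho> _ Hm Hfin])
    show "(\<lambda>x. ln (g x)) \<in> borel_measurable borel" by measurable
    fix \<pi> assume \<pi>: "test_plan \<rho> \<pi>"
    have "AE \<gamma> in \<pi>. \<forall>k. ennreal \<bar>l k (apply_bcontfun \<gamma> 1) - l k (apply_bcontfun \<gamma> 0)\<bar> \<le> line_int H (apply_bcontfun \<gamma>) 0 1"
      unfolding AE_all_countable
    proof
      fix k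
      show "AE \<gamma> in \<pi>. ennreal \<bar>l k (apply_bcontfun \<gamma> 1) - l k (apply_bcontfun \<gamma> 0)\<bar> \<le> line_int H (apply_bcontfun \<gamma>) 0 1"
        using weak_upper_gradient_AE[OF weak_upper_gradient_min_weak[OF lS n\<rho>] \<pi>, of k] AE_line_int_mono[OF \<pi> n\<rho> lH, of k]
      proof eventually_elim
        case (elim \<gamma>)
        then have "line_int (wgrad \<rho> (l k)) (apply_bcontfun \<gamma>) 0 1 \<le> line_int H (apply_bcontfun \<gamma>) 0 1" by simp
        with elim(1) show ?case by (auto intro: order_trans)
      qed
    qed
    moreover have "AE \<gamma> in \<pi>. 0 < v (apply_bcontfun \<gamma> 0)" by (rule AE_test_plan_eval[OF \<pi> n\<rho> pos]) simp
    moreover have "AE \<gamma> in \<pi>. 0 < v (apply_bcontfun \<gamma> 1)" by (rule AE_test_plan_eval[OF \<pi> n\<rho> pos]) simp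
    ultimately show "AE \<gamma> in \<pi>. ennreal \<bar>ln (g (apply_bcontfun \<gamma> 1)) - ln (g (apply_bcontfun \<gamma> 0))\<bar> \<le> line_int H (apply_bcontfun \<gamma>) 0 1"
    proof eventually_elim
      case (elim \<gamma>)
      have lim: "(\<lambda>k. l k x) \<longlonglongrightarrow> ln (g x)" if "0 < v x" for x
      proof -
        have gx: "0 < g x" using that by (simp add: v_def)
        have "(\<lambda>k. 1 / real (Suc k)) \<longlonglongrightarrow> 0"
          using LIMSEQ_inverse_real_of_nat by (simp add: inverse_eq_divide)
        then have "(\<lambda>k. l k x) \<longlonglongrightarrow> 2 * ln (max 0 (v x) + 0)"
          unfolding l_def using that by (intro tendsto_intros) auto
        moreover have "2 * ln (max 0 (v x) + 0) = ln (g x)"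
          using that gx by (simp add: v_def ln_sqrt)
        ultimately show ?thesis by simp
      qed
      have "(\<lambda>k. ennreal \<bar>l k (apply_bcontfun \<gamma> 1) - l k (apply_bcontfun \<gamma> 0)\<bar>)
          \<longlonglongrightarrow> ennreal \<bar>ln (g (apply_bcontfun \<gamma> 1)) - ln (g (apply_bcontfun \<gamma> 0))\<bar>"
        using elim by (intro tendsto_ennrealI tendsto_rabs tendsto_diff lim) auto
      then show ?case by (rule LIMSEQ_le_const2) (use elim(1) in auto)
    qed
  qed
  then show ?thesis using Hfin by (rule S2I)
qed

text \<open>Squaring is Lipschitz with constant \<open>2 * sqrt C\<close> on the range of the root
  of a density bounded by \<open>C\<close>.\<close>

lemma density_S2: "g \<in> S2 m"
proof -
  define u where "u x = (min (max 0 (sqrt (g x))) (sqrt C))\<^sup>2" for x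
  have [measurable]: "u \<in> borel_measurable borel" using g unfolding u_def[abs_def] by measurable
  have "\<bar>u x - u y\<bar> \<le> (2 * sqrt C) * \<bar>sqrt (g x) - sqrt (g y)\<bar>" for x y
  proof -
    define p q where "p = min (max 0 (sqrt (g x))) (sqrt C)" and "q = min (max 0 (sqrt (g y))) (sqrt C)"
    have "sqrt C \<ge> 0" using C0 by simp
    then have pq: "0 \<le> p" "p \<le> sqrt C" "0 \<le> q" "q \<le> sqrt C" "\<bar>p - q\<bar> \<le> \<bar>sqrt (g x) - sqrt (g y)\<bar>"
      unfolding p_def q_def by linarith+
    have "u x - u y = (p + q) * (p - q)" unfolding u_def p_def[symmetric] q_def[symmetric] by (simp add: power2_eq_square algebra_simps)
    then have "\<bar>u x - u y\<bar> = (p + q) * \<bar>p - q\<bar>" using pq by (simp add: abs_mult)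
    also have "\<dots> \<le> (2 * sqrt C) * \<bar>sqrt (g x) - sqrt (g y)\<bar>" using pq C0 by (intro mult_mono) auto
    finally show ?thesis .
  qed
  then have uS: "u \<in> S2 m" using C0 by (intro S2_lipschitz[OF n w, of u "2 * sqrt C"]) auto
  have "AE x in m. g x = u x"
    using g0 gC by eventually_elim (auto simp: u_def min_def max_def)
  from min_weak_upper_gradient_AE_cong(1)[OF n uS g this] show ?thesis .
qed

text \<open>The chain rule \<open>g \<Gamma>(ln g, \<phi>) = \<Gamma>(g, \<phi>)\<close> with both
  products written by polarization. At almost every point \<open>polarization_limit\<close> is
  applied with \<open>\<gamma> = g x\<close> and \<open>p c\<close> the gradient of
  \<open>c g + \<phi>\<close>: the coefficient \<open>c = 1 / a\<close>, with \<open>a\<close> near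
  \<open>g x\<close>, imitates the derivative of the logarithm.\<close>

lemma log_density_polarization:
  assumes fin: "finite_on_bounded m" and q: "cheeger_quadratic m" and \<phi>: "\<phi> \<in> S2 m"
  shows "AE x in \<rho>. g x * ((enn2real (wgrad \<rho> (\<lambda>x. ln (g x) + \<phi> x) x))\<^sup>2 - (enn2real (wgrad \<rho> (\<lambda>x. ln (g x) - \<phi> x) x))\<^sup>2)
    = (enn2real (wgrad \<rho> (\<lambda>x. g x + \<phi> x) x))\<^sup>2 - (enn2real (wgrad \<rho> (\<lambda>x. g x - \<phi> x) x))\<^sup>2"
proof -
  note n\<rho> = sets_density_borel
  note l = log_density_S2 and gS = S2_density[OF density_S2] and \<phi>S = S2_density[OF \<phi>]
  have cg: "(\<lambda>x. c * g x) \<in> S2 \<rho>" for c using S2_affine[OF n\<rho> gS, of c 0] by simp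
  have cg\<phi>: "(\<lambda>x. c * g x + \<phi> x) \<in> S2 \<rho>" "(\<lambda>x. c * g x - \<phi> x) \<in> S2 \<rho>" for c
    using S2_add[OF n\<rho> cg \<phi>S] S2_diff[OF n\<rho> cg \<phi>S] by auto
  note l\<phi> = S2_add[OF n\<rho> l \<phi>S] S2_diff[OF n\<rho> l \<phi>S]
  have lcg: "(\<lambda>x. ln (g x) - c * g x) \<in> S2 \<rho>" for c by (rule S2_diff[OF n\<rho> l cg])
  let ?r = "\<lambda>c::rat. of_rat c :: real"
  have fin_c: "AE x in \<rho>. \<forall>c. wgrad \<rho> (\<lambda>x. ?r c * g x + \<phi> x) x < \<infinity> \<and> wgrad \<rho> (\<lambda>x. ?r c * g x) x < \<infinity>"
    unfolding AE_all_countable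
    using AE_min_weak_upper_gradient_finite[OF n\<rho> cg\<phi>(1)] AE_min_weak_upper_gradient_finite[OF n\<rho> cg]
    by (auto intro: eventually_conj)
  have fin_l: "AE x in \<rho>. wgrad \<rho> (\<lambda>x. ln (g x) + \<phi> x) x < \<infinity>" "AE x in \<rho>. wgrad \<rho> (\<lambda>x. ln (g x) - \<phi> x) x < \<infinity>"
    "AE x in \<rho>. wgrad \<rho> g x < \<infinity>"
    using AE_min_weak_upper_gradient_finite[OF n\<rho>] l\<phi> gS by auto
  have par: "AE x in \<rho>. \<forall>c d. (wgrad \<rho> (\<lambda>x. ?r (c + d) * g x + \<phi> x) x)\<^sup>2 + (wgrad \<rho> (\<lambda>x. ?r (c - d) * g x + \<phi> x) x)\<^sup>2
      = 2 * (wgrad \<rho> (\<lambda>x. ?r c * g x + \<phi> x) x)\<^sup>2 + 2 * (wgrad \<rho> (\<lambda>x. ?r d * g x) x)\<^sup>2"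
    unfolding AE_all_countable
  proof (intro allI)
    fix c d :: rat
    have eq: "(\<lambda>x. ?r c * g x + \<phi> x + ?r d * g x) = (\<lambda>x. ?r (c + d) * g x + \<phi> x)"
      "(\<lambda>x. ?r c * g x + \<phi> x - ?r d * g x) = (\<lambda>x. ?r (c - d) * g x + \<phi> x)"
      by (auto simp: of_rat_add of_rat_diff algebra_simps)
    show "AE x in \<rho>. (wgrad \<rho> (\<lambda>x. ?r (c + d) * g x + \<phi> x) x)\<^sup>2 + (wgrad \<rho> (\<lambda>x. ?r (c - d) * g x + \<phi> x) x)\<^sup>2
      = 2 * (wgrad \<rho> (\<lambda>x. ?r c * g x + \<phi> x) x)\<^sup>2 + 2 * (wgrad \<rho> (\<lambda>x. ?r d * g x) x)\<^sup>2"
      using parallelogram_density_AE[OF fin q cg\<phi>(1) cg, of "?r c" "?r d"]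
      unfolding sum_diff_square_def sum_square_def eq .
  qed
  have ev: "AE x in \<rho>. \<forall>d. wgrad \<rho> (\<lambda>x. ?r (- d) * g x) x = wgrad \<rho> (\<lambda>x. ?r d * g x) x"
    unfolding AE_all_countable
  proof
    fix d
    show "AE x in \<rho>. wgrad \<rho> (\<lambda>x. ?r (- d) * g x) x = wgrad \<rho> (\<lambda>x. ?r d * g x) x"
      using wgrad_uminus[OF n\<rho> cg, of "?r d"] by (simp add: of_rat_minus)
  qed
  \<comment> \<open>Replacing \<open>ln g\<close> by \<open>c g\<close> changes a gradient by at
    most that of \<open>ln g - c g\<close>. Gradients are even, so \<open>c g - \<phi>\<close> is
    listed as the member of the family \<open>c g + \<phi>\<close> with coefficient
    \<open>- c\<close>.\<close>
  have near: "AE x in \<rho>. \<forall>c.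
      (wgrad \<rho> (\<lambda>x. ln (g x) + \<phi> x) x \<le> wgrad \<rho> (\<lambda>x. ?r c * g x + \<phi> x) x + wgrad \<rho> (\<lambda>x. ln (g x) - ?r c * g x) x \<and>
       wgrad \<rho> (\<lambda>x. ?r c * g x + \<phi> x) x \<le> wgrad \<rho> (\<lambda>x. ln (g x) + \<phi> x) x + wgrad \<rho> (\<lambda>x. ln (g x) - ?r c * g x) x) \<and>
      (wgrad \<rho> (\<lambda>x. ln (g x) - \<phi> x) x \<le> wgrad \<rho> (\<lambda>x. ?r (- c) * g x + \<phi> x) x + wgrad \<rho> (\<lambda>x. ln (g x) - ?r c * g x) x \<and>
       wgrad \<rho> (\<lambda>x. ?r (- c) * g x + \<phi> x) x \<le> wgrad \<rho> (\<lambda>x. ln (g x) - \<phi> x) x + wgrad \<rho> (\<lambda>x. ln (g x) - ?r c * g x) x)"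
    unfolding AE_all_countable
  proof
    fix c
    have eq: "(\<lambda>x. ln (g x) + \<phi> x - (?r c * g x + \<phi> x)) = (\<lambda>x. ln (g x) - ?r c * g x)"
      "(\<lambda>x. ln (g x) - \<phi> x - (?r c * g x - \<phi> x)) = (\<lambda>x. ln (g x) - ?r c * g x)"
      "(\<lambda>x. - (?r c * g x - \<phi> x)) = (\<lambda>x. ?r (- c) * g x + \<phi> x)"
      by (auto simp: of_rat_minus)
    show "AE x in \<rho>.
      (wgrad \<rho> (\<lambda>x. ln (g x) + \<phi> x) x \<le> wgrad \<rho> (\<lambda>x. ?r c * g x + \<phi> x) x + wgrad \<rho> (\<lambda>x. ln (g x) - ?r c * g x) x \<and>
       wgrad \<rho> (\<lambda>x. ?r c * g x + \<phi> x) x \<le> wgrad \<rho> (\<lambda>x. ln (g x) + \<phi> x) x + wgrad \<rho> (\<lambda>x. ln (g x) - ?r c * g x) x) \<and>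
      (wgrad \<rho> (\<lambda>x. ln (g x) - \<phi> x) x \<le> wgrad \<rho> (\<lambda>x. ?r (- c) * g x + \<phi> x) x + wgrad \<rho> (\<lambda>x. ln (g x) - ?r c * g x) x \<and>
       wgrad \<rho> (\<lambda>x. ?r (- c) * g x + \<phi> x) x \<le> wgrad \<rho> (\<lambda>x. ln (g x) - \<phi> x) x + wgrad \<rho> (\<lambda>x. ln (g x) - ?r c * g x) x)"
      using wgrad_diff_le[OF n\<rho> l\<phi>(1) cg\<phi>(1), of "?r c"] wgrad_diff_le[OF n\<rho> l\<phi>(2) cg\<phi>(2), of "?r c"]
        wgrad_uminus[OF n\<rho> cg\<phi>(2), of "?r c"]
      unfolding eq by eventually_elim simp
  qed
  \<comment> \<open>The brackets \<open>a\<close>, \<open>b\<close> around \<open>g x\<close> are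
    rational so that one null set works for all of them.\<close>
  have small: "AE x in \<rho>. \<forall>a b. 0 < a \<and> a \<le> b \<longrightarrow> ?r a \<le> g x \<and> g x \<le> ?r b \<longrightarrow>
      wgrad \<rho> (\<lambda>x. ln (g x) - ?r (1 / a) * g x) x \<le> ennreal (1 / ?r a - 1 / ?r b) * wgrad \<rho> g x"
    unfolding AE_all_countable
  proof (intro allI)
    fix a b :: rat
    show "AE x in \<rho>. 0 < a \<and> a \<le> b \<longrightarrow> ?r a \<le> g x \<and> g x \<le> ?r b \<longrightarrow>
      wgrad \<rho> (\<lambda>x. ln (g x) - ?r (1 / a) * g x) x \<le> ennreal (1 / ?r a - 1 / ?r b) * wgrad \<rho> g x"
    proof (cases "0 < a \<and> a \<le> b")
      case True
      then have ab: "0 < ?r a" "?r a \<le> ?r b" by (auto simp: of_rat_less_eq)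
      have D: "0 \<le> 1 / ?r a - 1 / ?r b" using ab by (simp add: frac_le)
      have ra: "?r (1 / a) = 1 / ?r a" by (simp add: of_rat_divide)
      have "AE x in \<rho>. ?r a \<le> g x \<and> g x \<le> ?r b \<longrightarrow>
          wgrad \<rho> (\<lambda>x. ln (g x) - ?r (1 / a) * g x) x \<le> ennreal (1 / ?r a - 1 / ?r b) * wgrad \<rho> g x"
        unfolding ra
        by (rule wgrad_composition_le[OF n\<rho> gS lcg ab(2) D]) (rule ln_minus_linear_lipschitz[OF ab(1)])
      then show ?thesis by eventually_elim simp
    qed auto
  qed
  have pos: "AE x in \<rho>. 0 < g x" unfolding AE_density_iff by simp
  have neg: "AE x in \<rho>. wgrad \<rho> (\<lambda>x. ?r (- 1) * g x + \<phi> x) x = wgrad \<rho> (\<lambda>x. g x - \<phi> x) x"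
  proof -
    have "(\<lambda>x. - (g x - \<phi> x)) = (\<lambda>x. ?r (- 1) * g x + \<phi> x)" by (auto simp: of_rat_minus)
    then show ?thesis using wgrad_uminus[OF n\<rho> S2_diff[OF n\<rho> gS \<phi>S]] by simp
  qed
  show ?thesis
    using fin_c fin_l par ev near small pos neg
  proof eventually_elim
    case (elim x)
    define p where "p c = enn2real (wgrad \<rho> (\<lambda>x. ?r c * g x + \<phi> x) x)" for c
    define e where "e c = (enn2real (wgrad \<rho> (\<lambda>x. ?r c * g x) x))\<^sup>2" for c
    define P where "P = enn2real (wgrad \<rho> (\<lambda>x. ln (g x) + \<phi> x) x)"
    define M where "M = enn2real (wgrad \<rho> (\<lambda>x. ln (g x) - \<phi> x) x)"
    define N where "N = enn2real (wgrad \<rho> g x)"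
    have p: "wgrad \<rho> (\<lambda>x. ?r c * g x + \<phi> x) x = ennreal (p c)" "0 \<le> p c" for c
      using elim(1) by (auto simp: p_def less_top)
    have e': "(wgrad \<rho> (\<lambda>x. ?r c * g x) x)\<^sup>2 = ennreal (e c)" "0 \<le> e c" for c
    proof -
      have "wgrad \<rho> (\<lambda>x. ?r c * g x) x = ennreal (enn2real (wgrad \<rho> (\<lambda>x. ?r c * g x) x))"
        using elim(1) by (simp add: less_top)
      then show "(wgrad \<rho> (\<lambda>x. ?r c * g x) x)\<^sup>2 = ennreal (e c)"
        unfolding e_def by (metis ennreal_power enn2real_nonneg)
    qed (simp add: e_def)
    have PMN: "wgrad \<rho> (\<lambda>x. ln (g x) + \<phi> x) x = ennreal P" "wgrad \<rho> (\<lambda>x. ln (g x) - \<phi> x) x = ennreal M"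
      "wgrad \<rho> g x = ennreal N" "0 \<le> P" "0 \<le> M" "0 \<le> N"
      using elim(2,3,4) by (auto simp: P_def M_def N_def less_top)
    have "g x * (P\<^sup>2 - M\<^sup>2) = (p 1)\<^sup>2 - (p (- 1))\<^sup>2"
    proof (rule polarization_limit[where e = e and N = N])
      fix c d
      have "ennreal ((p (c + d))\<^sup>2 + (p (c - d))\<^sup>2) = ennreal (2 * (p c)\<^sup>2 + 2 * e d)"
        using elim(5)[rule_format, of c d] p(2) e'(2)[of d] unfolding p(1) e'(1)
        by (simp add: ennreal_power ennreal_mult)
      then show "(p (c + d))\<^sup>2 + (p (c - d))\<^sup>2 = 2 * (p c)\<^sup>2 + 2 * e d"
        using e'(2)[of d] by (subst (asm) ennreal_inj) auto
      show "e (- d) = e d" using elim(6) by (simp add: e_def)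
    next
      fix a b :: rat assume ab: "0 < a" "?r a \<le> g x" "g x \<le> ?r b"
      then have "?r a \<le> ?r b" by linarith
      then have le: "a \<le> b" by (simp add: of_rat_less_eq)
      have D0: "0 \<le> 1 / ?r a - 1 / ?r b" using \<open>?r a \<le> ?r b\<close> ab(1) by (simp add: frac_le)
      have sm: "wgrad \<rho> (\<lambda>x. ln (g x) - ?r (1 / a) * g x) x \<le> ennreal ((1 / ?r a - 1 / ?r b) * N)"
        using elim(8) ab le D0 PMN by (auto simp: ennreal_mult)
      have DN: "0 \<le> (1 / ?r a - 1 / ?r b) * N" using D0 PMN by simp
      note nr = elim(7)[rule_format, of "1 / a"]
      have "ennreal P \<le> ennreal (p (1 / a)) + ennreal ((1 / ?r a - 1 / ?r b) * N)"
        "ennreal (p (1 / a)) \<le> ennreal P + ennreal ((1 / ?r a - 1 / ?r b) * N)"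
        "ennreal M \<le> ennreal (p (- (1 / a))) + ennreal ((1 / ?r a - 1 / ?r b) * N)"
        "ennreal (p (- (1 / a))) \<le> ennreal M + ennreal ((1 / ?r a - 1 / ?r b) * N)"
        using nr sm unfolding p(1) PMN by (auto intro: order_trans add_left_mono)
      then have "P \<le> p (1 / a) + (1 / ?r a - 1 / ?r b) * N" "p (1 / a) \<le> P + (1 / ?r a - 1 / ?r b) * N"
        "M \<le> p (- (1 / a)) + (1 / ?r a - 1 / ?r b) * N" "p (- (1 / a)) \<le> M + (1 / ?r a - 1 / ?r b) * N"
        using DN PMN p(2)[of "1 / a"] p(2)[of "- (1 / a)"]
        by (simp_all add: ennreal_plus[symmetric] del: ennreal_plus)
      then show "\<bar>P - p (1 / a)\<bar> \<le> (1 / ?r a - 1 / ?r b) * N \<and> \<bar>M - p (- (1 / a))\<bar> \<le> (1 / ?r a - 1 / ?r b) * N"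
        by linarith
    qed (rule elim(9))
    moreover have "p 1 = enn2real (wgrad \<rho> (\<lambda>x. g x + \<phi> x) x)" by (simp add: p_def)
    moreover have "p (- 1) = enn2real (wgrad \<rho> (\<lambda>x. g x - \<phi> x) x)"
      unfolding p_def using elim(10) by simp
    ultimately show ?case by (simp add: P_def M_def)
  qed
qed

lemma cheeger_form_log_density:
  assumes fin: "finite_on_bounded m" and q: "cheeger_quadratic m" and \<phi>: "\<phi> \<in> S2 m"
  shows "cheeger_form \<rho> (\<lambda>x. ln (g x)) \<phi> = cheeger_form m g \<phi>"
proof -
  note n\<rho> = sets_density_borel
  note gS = density_S2 and l = log_density_S2 and \<phi>S = S2_density[OF \<phi>]
  note sums = S2_add[OF n gS \<phi>] S2_diff[OF n gS \<phi>]
  let ?L = "\<lambda>x. (enn2real (wgrad \<rho> (\<lambda>x. ln (g x) + \<phi> x) x))\<^sup>2 - (enn2real (wgrad \<rho> (\<lambda>x. ln (g x) - \<phi> x) x))\<^sup>2"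
  let ?R = "\<lambda>x. (enn2real (wgrad m (\<lambda>x. g x + \<phi> x) x))\<^sup>2 - (enn2real (wgrad m (\<lambda>x. g x - \<phi> x) x))\<^sup>2"
  note [measurable] = wgrad_measurable[OF n sums(1)] wgrad_measurable[OF n sums(2)]
    wgrad_measurable[OF n\<rho> S2_add[OF n\<rho> l \<phi>S], unfolded borel_measurable_eq[OF n\<rho>], folded borel_measurable_eq[OF n]]
    wgrad_measurable[OF n\<rho> S2_diff[OF n\<rho> l \<phi>S], unfolded borel_measurable_eq[OF n\<rho>], folded borel_measurable_eq[OF n]]
    g_measurable
  have "AE x in \<rho>. g x * ?L x = ?R x"
    using log_density_polarization[OF fin q \<phi>] wgrad_density_eq[OF sums(1)] wgrad_density_eq[OF sums(2)]
    by eventually_elim simp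
  then have "AE x in m. 0 < g x \<longrightarrow> g x * ?L x = ?R x" unfolding AE_density_iff .
  \<comment> \<open>Where \<open>g\<close> vanishes, which \<open>\<rho>\<close> does not see,
    \<open>g + \<phi>\<close> and \<open>g - \<phi>\<close> equal \<open>\<phi>\<close> and
    \<open>- \<phi>\<close>; by locality the two gradients agree and the difference of squares is
    zero.\<close>
  moreover have "AE x in m. g x = 0 \<longrightarrow> ?R x = 0"
    using min_weak_upper_gradient_eq_on[OF n sums(1) \<phi>, of 1 0] min_weak_upper_gradient_eq_on[OF n sums(2) \<phi>, of "-1" 0]
    by (auto elim!: eventually_elim2)
  ultimately have eq: "AE x in m. g x *\<^sub>R ?L x = ?R x"
    using g0 by eventually_elim auto
  have "(LINT x|\<rho>. ?L x) = (LINT x|m. g x *\<^sub>R ?L x)"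
    by (rule integral_density_eq) measurable
  also have "\<dots> = (LINT x|m. ?R x)" using eq by (intro integral_cong_AE) auto
  finally show ?thesis
    unfolding cheeger_form_eq_integral[OF n\<rho> l \<phi>S] cheeger_form_eq_integral[OF n gS \<phi>] by simp
qed

end

theorem theorem3p9:
  fixes m \<rho> :: "'a::{complete_space, second_countable_topology} measure"
    and g :: "'a \<Rightarrow> real"
  assumes "borel_measure m" and "finite_on_bounded m" and "msupport m = UNIV"
    and "g \<in> borel_measurable m" and "AE x in m. 0 \<le> g x"
    and "\<exists>C. AE x in m. \<bar>g x\<bar> \<le> C"
    and "\<rho> = density m (\<lambda>x. ennreal (g x))" and "\<rho> \<in> P2"
    and "cheeger m (\<lambda>x. sqrt (g x)) < \<infinity>"
    and "cheeger_quadratic m"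
  shows "cheeger_quadratic \<rho> \<and>
    (\<forall>\<phi> :: 'a \<Rightarrow> real.
       (\<exists>L. L-lipschitz_on UNIV \<phi>) \<and> bounded (closure {x. \<phi> x \<noteq> 0}) \<longrightarrow>
       cheeger_form \<rho> (\<lambda>x. ln (g x)) \<phi> = cheeger_form m g \<phi>)"
proof -
  have n: "sets m = sets borel" using assms(1) by (simp add: borel_measure_def)
  obtain C where C: "AE x in m. \<bar>g x\<bar> \<le> C" using assms(6) by blast
  \<comment> \<open>The maximum supplies the nonnegative bound that the locale asks for.\<close>
  interpret sobolev_density m \<rho> g "max 0 C"
  proof
    show "g \<in> borel_measurable borel" using assms(4) by (simp add: borel_measurable_eq[OF n])
    show "AE x in m. g x \<le> max 0 C" using C by eventually_elim auto
    show "(\<lambda>x. sqrt (g x)) \<in> S2 m" using assms(9) by (auto simp: cheeger_def split: if_splits)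
  qed (use n assms in auto)
  show ?thesis
  proof (intro conjI allI impI)
    show "cheeger_quadratic \<rho>" using assms(2,10) by (rule cheeger_quadratic_density)
    fix \<phi> :: "'a \<Rightarrow> real"
    assume *: "(\<exists>L. L-lipschitz_on UNIV \<phi>) \<and> bounded (closure {x. \<phi> x \<noteq> 0})"
    then obtain L where L: "L-lipschitz_on UNIV \<phi>" by blast
    \<comment> \<open>The support is bounded, hence of finite measure, so the Lipschitz constant cut
      off outside it is square integrable.\<close>
    have "(\<integral>\<^sup>+x. (if \<phi> x = 0 then 0 else ennreal L)\<^sup>2 \<partial>m) \<le> (\<integral>\<^sup>+x. (ennreal L)\<^sup>2 * indicator (closure {x. \<phi> x \<noteq> 0}) x \<partial>m)"
      using closure_subset[of "{x. \<phi> x \<noteq> 0}"] by (intro nn_integral_mono) (auto simp: indicator_def)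
    also have "\<dots> = (ennreal L)\<^sup>2 * emeasure m (closure {x. \<phi> x \<noteq> 0})"
      using n by (intro nn_integral_cmult_indicator) simp
    also have "\<dots> < \<infinity>"
      using assms(2) * by (auto simp: finite_on_bounded_def ennreal_mult_less_top power2_eq_square)
    finally have "\<phi> \<in> S2 m"
      by (rule S2I[OF weak_upper_gradient_of_lipschitz[OF L]])
    then show "cheeger_form \<rho> (\<lambda>x. ln (g x)) \<phi> = cheeger_form m g \<phi>"
      using assms(2,10) by (intro cheeger_form_log_density)
  qed
qed

end
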